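(* Consider the generalized equation $0\in\Phi x=Fx+Tx$ in the expectation setting $Fx=\mathbb{E}_\xi[\mathbf F(x,\xi)]$ under the standing assumptions of the context, with $L\rho<1$. Let $\hat L>L$ with $\hat L\rho<1$, $\bar\beta:=\frac{\lambda(4-\hat L\lambda)-4\rho}{4(1-\rho\hat L)}$, $\Lambda:=\frac{\hat L-L}{L\hat L}$, and $$2\rho\le\lambda<\tfrac{2(1+\sqrt{1-\hat L\rho})}{\hat L},\quad 0<\mu<\tfrac23,\quad \nu:=\tfrac\mu2,\quad 0<\beta\le\tfrac{(2-\mu)\bar\beta}{2+\mu},\quad t_k:=\mu(k+r),\quad \eta_k:=\tfrac{2\beta(t_k-1)}{t_k-\nu},\quad r>5+\tfrac1\mu .$$ For $x^\star\in\mathrm{zer}(\Phi)$ let $\Psi_0^2:=\mu^2r^2\,\mathbb{E}[\|G_\lambda x^0\|^2]+\frac{2r-1}{4\beta^2(\mu r-1)}\|x^0-x^\star\|^2$. Let $\{(x^k,z^k)\}$ be generated by the VFOSA$_+$ iteration (see context) where $\widetilde F^k$ is the L-SVRG estimator with mega-batches (see context) with $$b_k=b:=\Big\lfloor\frac{c_b}{\epsilon^2}\Big\rfloor,\qquad n_k=n:=\Big\lfloor\frac{c_n}{\epsilon^3}\Big\rfloor,\qquad \mathbf p_k:=2\epsilon+\frac{4\mu}{\mu(k+r-1)-1},$$ where $\epsilon\in\big(0,\frac{\mu(r-5)-1}{2\mu(r-1)-2}\big]$, $c_b:=\frac{10\beta}{\mu\Lambda}$, and $c_n:=12\sigma^2\max\big\{1,\frac{2\sqrt2\,\Psi_0}{\mu^2}\big\}$.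 Then the expected total number $\bar{\mathcal T}_K$ of oracle calls $\mathbf F(\cdot,\xi)$ and evaluations of $J_{\lambda T}$ to obtain $x^K$ such that $\mathbb{E}[\|G_\lambda x^K\|^2]\le\epsilon^2$ is at most $\bar{\mathcal T}_K=\mathcal O\big(\epsilon^{-3}+\epsilon^{-3}\ln(\epsilon^{-1})\big)$ (with constants independent of $\epsilon$).
   Context: Problem: $F:\mathbb{R}^p\to\mathbb{R}^p$ is single-valued with $Fx=\mathbb{E}_\xi[\mathbf F(x,\xi)]$ for a random variable $\xi$ (unbiased stochastic oracle), $T:\mathbb{R}^p\rightrightarrows2^{\mathbb{R}^p}$ is possibly multi-valued, $\Phi:=F+T$, $\mathrm{zer}(\Phi):=\{x:0\in\Phi x\}$, $\mathrm{dom}(\Phi)=\{x:\Phi x\neq\emptyset\}$. Standing assumptions. $\mathrm{zer}(\Phi)\neq\emptyset$. There is $\sigma\ge0$ with $\mathbb{E}_\xi[\|\mathbf F(x,\xi)-Fx\|^2]\le\sigma^2$ for all $x\in\mathrm{dom}(F)$. $T$ is maximally $\rho$-co-hypomonotone for some $\rho\ge0$: $\langle u-v,x-y\rangle\ge-\rho\|u-v\|^2$ for all $(x,u),(y,v)$ in the graph of $T$, and the graph is not properly contained in that of another such operator. There is $L>0$ with $\langle Fx-Fy,x-y\rangle\ge\frac1L\mathbb{E}_\xi[\|\mathbf F(x,\xi)-\mathbf F(y,\xi)\|^2]$ for all $x,y\in\mathrm{dom}(F)$. Operators: for $\lambda>0$, $J_{\lambda T}x:=\{w:x\in w+\lambda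 Tw\}$ and $G_\lambda x:=\frac1\lambda\big(x-J_{\lambda T}(x-\lambda Fx)\big)$. VFOSA$_+$ iteration: given $x^0\in\mathrm{dom}(\Phi)$, $z^0:=x^0$, for $k\ge0$: $y^k:=\frac{t_k-1}{t_k}x^k+\frac1{t_k}z^k$; $x^{k+1}:=y^k-\eta_k\widetilde G_\lambda^k$; $z^{k+1}:=z^k+\nu(x^{k+1}-y^k)$, where $\widetilde G_\lambda^k:=\frac1\lambda\big(x^k-J_{\lambda T}(x^k-\lambda\widetilde F^k)\big)$ and $\widetilde F^k$ is a stochastic estimator of $Fx^k$. L-SVRG (loopless SVRG) estimator with mega-batches: with an i.i.d. mini-batch $\mathcal S_k$ of $\xi$ of size $b_k$, $\widetilde F^k:=\bar F\tilde x^k+\frac1{b_k}\sum_{\xi_i\in\mathcal S_k}(\mathbf F(x^k,\xi_i)-\mathbf F(\tilde x^k,\xi_i))$, where $\tilde x^0:=x^0$ and, for $k\ge1$, $\tilde x^k:=x^{k-1}$ with probability $\mathbf p_k$ and $\tilde x^k:=\tilde x^{k-1}$ with probability $1-\mathbf p_k$; here $\bar F\tilde x^k:=\frac1{n_k}\sum_{\xi\in\bar{\mathcal S}_k}\mathbf F(\tilde x^k,\xi)$ with an i.i.d. mega-batch $\bar{\mathcal S}_k$ of size $n_k$, so that it is an unbiased estimator of $F\tilde x^k$ with variance at most $\sigma^2/n_k$. In counting calls, the mega-batch is evaluated when the snapshot $\tilde x^k$ is refreshed (and once initially). *)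

theory Defs
  imports "HOL-Probability.Probability"
begin

section \<open>Set-valued operators\<close>

definition op_graph :: "('a \<Rightarrow> 'a set) \<Rightarrow> ('a \<times> 'a) set" where
  "op_graph T = {(x, u). u \<in> T x}"

definition op_dom :: "('a \<Rightarrow> 'a set) \<Rightarrow> 'a set" where
  "op_dom T = {x. T x \<noteq> {}}"

definition op_zer :: "('a::zero \<Rightarrow> 'a set) \<Rightarrow> 'a set" where
  "op_zer T = {x. 0 \<in> T x}"

definition op_sum :: "('a::plus \<Rightarrow> 'a) \<Rightarrow> ('a \<Rightarrow> 'a set) \<Rightarrow> 'a \<Rightarrow> 'a set" where
  "op_sum F T x = {F x + u | u. u \<in> T x}"

definition co_hypomonotone :: "real \<Rightarrow> ('a::real_inner \<Rightarrow> 'a set) \<Rightarrow> bool" where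
  "co_hypomonotone \<rho> T \<longleftrightarrow>
     (\<forall>(x, u) \<in> op_graph T. \<forall>(y, v) \<in> op_graph T.
        (u - v) \<bullet> (x - y) \<ge> - \<rho> * (norm (u - v))\<^sup>2)"

definition maximally_co_hypomonotone :: "real \<Rightarrow> ('a::real_inner \<Rightarrow> 'a set) \<Rightarrow> bool" where
  "maximally_co_hypomonotone \<rho> T \<longleftrightarrow>
     co_hypomonotone \<rho> T \<and>
     \<not> (\<exists>T'. co_hypomonotone \<rho> T' \<and> op_graph T \<subset> op_graph T')"

definition resolvent_set :: "real \<Rightarrow> ('a::real_vector \<Rightarrow> 'a set) \<Rightarrow> 'a \<Rightarrow> 'a set" where
  "resolvent_set lam T x = {w. \<exists>u \<in> T w. x = w + lam *\<^sub>R u}"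

text \<open>
  The resolvent as a point: meaningful when \<^const>\<open>resolvent_set\<close> is a singleton, which holds
  at every point for maximally \<open>\<rho>\<close>-co-hypomonotone \<open>T\<close> with \<open>lam > \<rho>\<close>.
\<close>

definition resolvent :: "real \<Rightarrow> ('a::real_vector \<Rightarrow> 'a set) \<Rightarrow> 'a \<Rightarrow> 'a" where
  "resolvent lam T x = the_elem (resolvent_set lam T x)"

text \<open>The second argument is the value (or an estimate) of \<open>F\<close> at \<open>x\<close>.\<close>

definition fb_residual_at :: "real \<Rightarrow> ('a::real_vector \<Rightarrow> 'a set) \<Rightarrow> 'a \<Rightarrow> 'a \<Rightarrow> 'a" where
  "fb_residual_at lam T v x = (1 / lam) *\<^sub>R (x - resolvent lam T (x - lam *\<^sub>R v))"

definition fb_residual ::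
  "real \<Rightarrow> ('a::real_vector \<Rightarrow> 'a) \<Rightarrow> ('a \<Rightarrow> 'a set) \<Rightarrow> 'a \<Rightarrow> 'a" where
  "fb_residual lam F T x = fb_residual_at lam T (F x) x"


section \<open>The iteration and the estimator, along one sample path\<close>

definition vfosa_plus ::
  "real \<Rightarrow> ('a::real_vector \<Rightarrow> 'a set) \<Rightarrow> (nat \<Rightarrow> real) \<Rightarrow> (nat \<Rightarrow> real) \<Rightarrow> real \<Rightarrow> 'a
    \<Rightarrow> (nat \<Rightarrow> 'a) \<Rightarrow> (nat \<Rightarrow> 'a) \<Rightarrow> (nat \<Rightarrow> 'a) \<Rightarrow> bool" where
  "vfosa_plus lam T t \<eta> \<nu> x0 Ft x z \<longleftrightarrow>
     x 0 = x0 \<and> z 0 = x0 \<and>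
     (\<forall>k. let y = ((t k - 1) / t k) *\<^sub>R x k + (1 / t k) *\<^sub>R z k in
            x (Suc k) = y - \<eta> k *\<^sub>R fb_residual_at lam T (Ft k) (x k) \<and>
            z (Suc k) = z k + \<nu> *\<^sub>R (x (Suc k) - y))"

definition batch_mean :: "('x \<Rightarrow> 'a::real_vector) \<Rightarrow> nat \<Rightarrow> (nat \<Rightarrow> 'x) \<Rightarrow> 'a" where
  "batch_mean f m s = (1 / real m) *\<^sub>R (\<Sum>i<m. f (s i))"

text \<open>
  \<open>c k\<close> (for \<open>k \<ge> 1\<close>) says that the snapshot is refreshed at step \<open>k\<close>; \<open>s k\<close> and \<open>S k\<close> are the
  mini-batch and the mega-batch drawn at step \<open>k\<close>, of sizes \<open>b k\<close> and \<open>n k\<close>. The mega-batch mean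
  is evaluated at step \<open>0\<close> and at refreshes only; between refreshes the stored value is reused.
\<close>

fun snapshot :: "(nat \<Rightarrow> bool) \<Rightarrow> (nat \<Rightarrow> 'a) \<Rightarrow> nat \<Rightarrow> 'a" where
  "snapshot c x 0 = x 0"
| "snapshot c x (Suc k) = (if c (Suc k) then x k else snapshot c x k)"

fun snapshot_mean ::
  "('a \<Rightarrow> 'x \<Rightarrow> 'a::real_vector) \<Rightarrow> (nat \<Rightarrow> nat) \<Rightarrow> (nat \<Rightarrow> bool) \<Rightarrow> (nat \<Rightarrow> nat \<Rightarrow> 'x)
    \<Rightarrow> (nat \<Rightarrow> 'a) \<Rightarrow> nat \<Rightarrow> 'a" where
  "snapshot_mean FF n c S x 0 = batch_mean (FF (snapshot c x 0)) (n 0) (S 0)"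
| "snapshot_mean FF n c S x (Suc k) =
     (if c (Suc k) then batch_mean (FF (snapshot c x (Suc k))) (n (Suc k)) (S (Suc k))
      else snapshot_mean FF n c S x k)"

definition lsvrg_estimator ::
  "('a \<Rightarrow> 'x \<Rightarrow> 'a::real_vector) \<Rightarrow> (nat \<Rightarrow> nat) \<Rightarrow> (nat \<Rightarrow> nat) \<Rightarrow> (nat \<Rightarrow> bool)
    \<Rightarrow> (nat \<Rightarrow> nat \<Rightarrow> 'x) \<Rightarrow> (nat \<Rightarrow> nat \<Rightarrow> 'x) \<Rightarrow> (nat \<Rightarrow> 'a) \<Rightarrow> nat \<Rightarrow> 'a" where
  "lsvrg_estimator FF b n c s S x k =
     snapshot_mean FF n c S x k +
     batch_mean (\<lambda>\<xi>. FF (x k) \<xi> - FF (snapshot c x k) \<xi>) (b k) (s k)"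

text \<open>
  Cost of computing \<open>x K\<close>, i.e. of the iterations \<open>0, \<dots>, K - 1\<close>: a mega-batch initially and
  at each refresh, two oracle calls per mini-batch sample, and one resolvent evaluation per
  iteration.
\<close>

definition total_calls ::
  "(nat \<Rightarrow> nat) \<Rightarrow> (nat \<Rightarrow> nat) \<Rightarrow> (nat \<Rightarrow> bool) \<Rightarrow> nat \<Rightarrow> nat" where
  "total_calls b n c K = (\<Sum>k<K. (if k = 0 \<or> c k then n k else 0) + 2 * b k + 1)"


section \<open>The random draws\<close>

datatype draw = Refresh nat | Mini nat nat | Mega nat nat

primrec draw_events ::
  "'w measure \<Rightarrow> 'x measure \<Rightarrow> (nat \<Rightarrow> 'w \<Rightarrow> bool) \<Rightarrow> (nat \<Rightarrow> nat \<Rightarrow> 'w \<Rightarrow> 'x)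
    \<Rightarrow> (nat \<Rightarrow> nat \<Rightarrow> 'w \<Rightarrow> 'x) \<Rightarrow> draw \<Rightarrow> 'w set set" where
  "draw_events M D c s S (Refresh k) = {c k -` A \<inter> space M | A. A \<in> sets (count_space UNIV)}"
| "draw_events M D c s S (Mini k i) = {s k i -` A \<inter> space M | A. A \<in> sets D}"
| "draw_events M D c s S (Mega k j) = {S k j -` A \<inter> space M | A. A \<in> sets D}"

text \<open>
  All draws are mutually independent. The coins and the samples have different value types, so
  this is stated through the generated families of events, with \<open>indep_sets\<close> in place of
  \<open>indep_vars\<close>.
\<close>

definition lsvrg_sampling ::
  "'w measure \<Rightarrow> 'x measure \<Rightarrow> (nat \<Rightarrow> real) \<Rightarrow> (nat \<Rightarrow> nat) \<Rightarrow> (nat \<Rightarrow> nat)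
    \<Rightarrow> (nat \<Rightarrow> 'w \<Rightarrow> bool) \<Rightarrow> (nat \<Rightarrow> nat \<Rightarrow> 'w \<Rightarrow> 'x) \<Rightarrow> (nat \<Rightarrow> nat \<Rightarrow> 'w \<Rightarrow> 'x) \<Rightarrow> bool" where
  "lsvrg_sampling M D p b n c s S \<longleftrightarrow>
     prob_space M \<and>
     (\<forall>k\<ge>1. c k \<in> measurable M (count_space UNIV) \<and>
             measure M {w \<in> space M. c k w} = p k) \<and>
     (\<forall>k. \<forall>i<b k. s k i \<in> measurable M D \<and> distr M D (s k i) = D) \<and>
     (\<forall>k. \<forall>j<n k. S k j \<in> measurable M D \<and> distr M D (S k j) = D) \<and>
     prob_space.indep_sets M (draw_events M D c s S)
       ({Refresh k | k. k \<ge> 1} \<union> {Mini k i | k i. i < b k} \<union> {Mega k j | k j. j < n k})"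

end

theory Submission
  imports Defs
begin

text \<open>
  Write \<open>G\<close> for the forward-backward residual \<open>fb_residual lam F T\<close>, whose zeros are the solutions,
  and \<open>V(x, y)\<close> for the mean square distance of the samples at \<open>x\<close> and \<open>y\<close>. Minty's theorem makes the
  resolvent a function, nonexpansive because \<open>2 \<rho> \<le> lam\<close> (\<open>minty_range\<close>,
  \<open>resolvent_nonexpansive\<close>). Hence replacing \<open>F x\<close> by an estimate moves the residual by no
  more than the estimation error, and \<open>G\<close> is \<open>\<beta>b\<close>-co-coercive with a surplus
  \<open>\<Lambda> V(x, y)\<close> (\<open>fb_residual_cocoercive\<close>).

  The iteration is an accelerated method for the co-coercive map \<open>G\<close>, run with an estimate of it that
  is biased, as the resolvent is nonlinear.
  A potential that controls \<open>t\<^sub>k\<^sup>2 |G x\<^bsup>k+1\<^esup>|\<^sup>2\<close> decreases along every sample path, up to the weighted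
  squared estimation error, and the surplus leaves the weighted moves \<open>V(x\<^bsup>k+1\<^esup>, x\<^sup>k)\<close> on
  the good side (\<open>potential_step\<close>).

  The squared error has mean at most \<open>\<sigma>\<^sup>2 / n\<close> plus \<open>1 / b\<close> times the mean distance \<open>V\<close> of the iterate to
  the snapshot (\<open>err_bound\<close>). That distance contracts at rate \<open>p / 2\<close> and is fed by the moves
  (\<open>drift_step\<close>). The refresh probabilities are designed so that, after weighting, the
  contraction is \<open>1 - \<epsilon>\<close> and the snapshot distances sum to \<open>O(\<epsilon>\<^sup>-\<^sup>2)\<close> times the moves; with
  \<open>b\<close> of order \<open>\<epsilon>\<^sup>-\<^sup>2\<close> the moves on the good side pay for them. So only the mega-batch
  noise remains, and \<open>t\<^sub>K\<^sup>2 E |G x\<^bsup>K+1\<^esup>|\<^sup>2\<close> is at most a constant plus \<open>O(t\<^sub>K\<^sup>3 \<sigma>\<^sup>2 / n)\<close>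
  (\<open>residual_bound\<close>).

  With \<open>n\<close> of order \<open>\<epsilon>\<^sup>-\<^sup>3\<close> and \<open>K\<close> of order \<open>1 / \<epsilon>\<close> this gives accuracy \<open>\<epsilon>\<close>. The mini-batches then
  cost \<open>O(\<epsilon>\<^sup>-\<^sup>3)\<close>, and the expected number of mega-batches is \<open>1 + \<Sum> p\<^sub>k\<close>, at most a constant plus
  \<open>4 ln K\<close>, whence the logarithm (\<open>complexity\<close>).
\<close>

section \<open>Minty's theorem and the resolvent\<close>

text \<open>
  The finite case of Minty's theorem. Every point of a finite monotone set contributes a quadratic in
  \<open>y\<close> with the same leading term, and a point with all these quadratics nonpositive is wanted. A
  minimiser of their maximum works: there \<open>0\<close> is a convex combination of the active gradients, and
  with these weights monotonicity makes the minimal value nonpositive.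
\<close>
lemma monotone_finite_solution:
  fixes P :: "('a::euclidean_space \<times> 'a) set"
  assumes "finite P" "P \<noteq> {}" "c > 0"
    and mono: "\<And>u a v b. (u, a) \<in> P \<Longrightarrow> (v, b) \<in> P \<Longrightarrow> (a - b) \<bullet> (u - v) \<ge> 0"
  shows "\<exists>y. \<forall>(u, a)\<in>P. (a - x + c *\<^sub>R y) \<bullet> (y - u) \<le> 0"
proof -
  define g where "g = (\<lambda>(u::'a, a::'a) y. (a - x + c *\<^sub>R y) \<bullet> (y - u))"
  define \<phi> where "\<phi> = (\<lambda>y. Max ((\<lambda>q. g q y) ` P))"
  define G where "G = (\<lambda>(u::'a, a::'a) y. a - x + (2 * c) *\<^sub>R y - c *\<^sub>R u)"
  have g_expand: "g q (y + s *\<^sub>R d) = g q y + s * (G q y \<bullet> d) + c * s\<^sup>2 * (d \<bullet> d)" for q y s d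
    by (cases q) (simp add: g_def G_def algebra_simps power2_eq_square inner_commute)
  have cont_g: "continuous_on UNIV (g q)" for q
    by (cases q) (auto simp: g_def intro!: continuous_intros)
  have cont: "continuous_on UNIV \<phi>"
  proof -
    have "continuous_on UNIV (\<lambda>y. Max ((\<lambda>q. g q y) ` Q))" if "finite Q" "Q \<noteq> {}" for Q
      using that
    proof (induction Q rule: finite_ne_induct)
      case (insert q Q)
      have "(\<lambda>y. Max ((\<lambda>q. g q y) ` insert q Q)) = (\<lambda>y. max (g q y) (Max ((\<lambda>q. g q y) ` Q)))"
        using insert by (auto simp: fun_eq_iff)
      then show ?case using continuous_on_max[OF cont_g[of q] insert.IH] by (simp only:)
    qed (simp add: cont_g)
    then show ?thesis using assms(1,2) by (simp add: \<phi>_def)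
  qed
  have le_\<phi>: "g q y \<le> \<phi> y" if "q \<in> P" for q y
    using that assms(1) by (auto simp: \<phi>_def)
  obtain q0 where q0: "q0 \<in> P" using assms(2) by blast
  \<comment> \<open>Outside this radius a single quadratic already exceeds the value of the maximum at \<open>0\<close>.\<close>
  define R where "R = (norm (G q0 0) + \<bar>\<phi> 0 - g q0 0\<bar> + 1) / c + 1"
  have R: "R \<ge> 1" using assms(3) by (auto simp: R_def)
  have outside: "\<phi> 0 \<le> \<phi> y" if "norm y > R" for y
  proof -
    let ?n = "norm y"
    have "g q0 y = g q0 0 + G q0 0 \<bullet> y + c * ?n\<^sup>2"
      using g_expand[of q0 0 1 y] by (simp add: power2_norm_eq_inner)
    moreover have "- (norm (G q0 0) * ?n) \<le> G q0 0 \<bullet> y"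
      using Cauchy_Schwarz_ineq2[of "G q0 0" y] by linarith
    moreover have "c * ?n \<ge> norm (G q0 0) + \<bar>\<phi> 0 - g q0 0\<bar>"
    proof -
      have "c * ?n \<ge> c * R" using that assms(3) by simp
      moreover have "c * R = norm (G q0 0) + \<bar>\<phi> 0 - g q0 0\<bar> + 1 + c"
        using assms(3) by (simp add: R_def field_simps)
      ultimately show ?thesis using assms(3) by linarith
    qed
    then have "c * ?n * ?n \<ge> (norm (G q0 0) + \<bar>\<phi> 0 - g q0 0\<bar>) * ?n"
      by (intro mult_right_mono) auto
    moreover have "\<bar>\<phi> 0 - g q0 0\<bar> * ?n \<ge> \<bar>\<phi> 0 - g q0 0\<bar>"
      using that R by (simp add: mult_le_cancel_left1)
    ultimately have "g q0 y \<ge> \<phi> 0" by (simp add: power2_eq_square algebra_simps)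
    then show ?thesis using le_\<phi>[OF q0, of y] by linarith
  qed
  obtain y where y: "y \<in> cball 0 R" "\<And>v. v \<in> cball 0 R \<Longrightarrow> \<phi> y \<le> \<phi> v"
    using continuous_attains_inf[of "cball 0 R" \<phi>] R cont
    by (metis compact_cball cball_eq_empty continuous_on_subset not_less subset_UNIV
        linorder_not_le order_trans zero_le_one)
  have ymin: "\<phi> y \<le> \<phi> v" for v
  proof (cases "norm v \<le> R")
    case True then show ?thesis using y(2)[of v] by simp
  next
    case False
    then have "\<phi> 0 \<le> \<phi> v" using outside by simp
    moreover have "\<phi> y \<le> \<phi> 0" using y(2)[of 0] R by simp
    ultimately show ?thesis by simp
  qed
  define Act where "Act = {q \<in> P. g q y = \<phi> y}"
  have fin: "finite Act" using assms(1) by (simp add: Act_def)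
  \<comment> \<open>Otherwise a separating direction decreases all active quadratics at once.\<close>
  have zero: "0 \<in> convex hull ((\<lambda>q. G q y) ` Act)"
  proof (rule ccontr)
    assume "0 \<notin> convex hull ((\<lambda>q. G q y) ` Act)"
    then obtain d e where de: "e > 0" "\<And>v. v \<in> convex hull ((\<lambda>q. G q y) ` Act) \<Longrightarrow> d \<bullet> v > e"
      using separating_hyperplane_closed_0[of "convex hull ((\<lambda>q. G q y) ` Act)"] fin
      by (metis compact_imp_closed convex_convex_hull finite_imageI finite_imp_compact_convex_hull)
    have "\<forall>\<^sub>F s in at_right 0. g q (y + s *\<^sub>R (- d)) < \<phi> y" if "q \<in> P" for q
    proof (cases "q \<in> Act")
      case True
      then have gd: "G q y \<bullet> d > e"
        using de(2)[of "G q y"] by (simp add: hull_inc inner_commute)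
      have "\<forall>\<^sub>F s in at_right (0::real). s * (c * (d \<bullet> d)) < e"
      proof (rule order_tendstoD)
        show "((\<lambda>s. s * (c * (d \<bullet> d))) \<longlongrightarrow> 0) (at_right 0)" by (auto intro!: tendsto_eq_intros)
      qed (use de in simp)
      moreover have "\<forall>\<^sub>F s in at_right (0::real). s > 0" by (simp add: eventually_at_right_less)
      ultimately show ?thesis
      proof eventually_elim
        case (elim s)
        have "s * (s * (c * (d \<bullet> d))) < s * (G q y \<bullet> d)" using elim gd by simp
        then show ?case using True
          by (simp only: g_expand) (simp add: Act_def power2_eq_square algebra_simps)
      qed
    next
      case False
      then have lt: "g q y < \<phi> y" using that le_\<phi>[OF that, of y] by (auto simp: Act_def)
      have "continuous_on UNIV (\<lambda>s::real. g q (y + s *\<^sub>R (- d)))"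
        using cont_g by (intro continuous_on_compose2[OF cont_g]) (auto intro!: continuous_intros)
      then have "isCont (\<lambda>s::real. g q (y + s *\<^sub>R (- d))) 0"
        by (simp add: continuous_on_eq_continuous_at)
      then have "((\<lambda>s::real. g q (y + s *\<^sub>R (- d))) \<longlongrightarrow> g q y) (at_right 0)"
        unfolding isCont_def by (simp add: filterlim_at_split)
      then show ?thesis using lt by (rule order_tendstoD)
    qed
    then have "\<forall>\<^sub>F s in at_right (0::real). \<forall>q\<in>P. g q (y + s *\<^sub>R (- d)) < \<phi> y"
      using assms(1) by (simp add: eventually_ball_finite_distrib)
    then obtain s where "\<forall>q\<in>P. g q (y + s *\<^sub>R (- d)) < \<phi> y"
      using eventually_happens[of _ "at_right (0::real)"] by auto
    then have "\<phi> (y + s *\<^sub>R (- d)) < \<phi> y" using assms(1,2) by (simp add: \<phi>_def)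
    then show False using ymin[of "y + s *\<^sub>R (- d)"] by simp
  qed
  \<comment> \<open>Distinct active points may share a gradient; one representative of each suffices.\<close>
  obtain B where B: "B \<subseteq> Act" "inj_on (\<lambda>q. G q y) B" "(\<lambda>q. G q y) ` Act = (\<lambda>q. G q y) ` B"
    by (metis subset_image_inj order_refl)
  have finB: "finite B" using B(1) fin finite_subset by blast
  from zero[unfolded B(3)] obtain w where w: "\<And>v. v \<in> (\<lambda>q. G q y) ` B \<Longrightarrow> w v \<ge> 0"
      "sum w ((\<lambda>q. G q y) ` B) = 1" "(\<Sum>v\<in>(\<lambda>q. G q y) ` B. w v *\<^sub>R v) = 0"
    using finB by (auto simp: convex_hull_finite)
  define \<theta> where "\<theta> q = w (G q y)" for q
  have th0: "\<theta> q \<ge> 0" if "q \<in> B" for q using w(1) that by (simp add: \<theta>_def)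
  have th1: "sum \<theta> B = 1" using w(2) B(2) by (simp add: \<theta>_def sum.reindex)
  have thG: "(\<Sum>q\<in>B. \<theta> q *\<^sub>R G q y) = 0" using w(3) B(2) by (simp add: \<theta>_def sum.reindex)
  define um where "um = (\<Sum>q\<in>B. \<theta> q *\<^sub>R fst q)"
  define am where "am = (\<Sum>q\<in>B. \<theta> q *\<^sub>R snd q)"
  define au where "au = (\<Sum>q\<in>B. \<theta> q * (snd q \<bullet> fst q))"
  have bal: "am - x + (2 * c) *\<^sub>R y - c *\<^sub>R um = 0"
  proof -
    have "(\<Sum>q\<in>B. \<theta> q *\<^sub>R G q y) = (\<Sum>q\<in>B. \<theta> q *\<^sub>R snd q + \<theta> q *\<^sub>R ((2 * c) *\<^sub>R y - x) - c *\<^sub>R (\<theta> q *\<^sub>R fst q))"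
      by (intro sum.cong) (auto simp: G_def algebra_simps split: prod.splits)
    also have "\<dots> = am + sum \<theta> B *\<^sub>R ((2 * c) *\<^sub>R y - x) - c *\<^sub>R um"
      by (simp add: am_def um_def sum.distrib sum_subtractf scaleR_sum_left scaleR_sum_right)
    finally show ?thesis using thG th1 by (simp add: algebra_simps)
  qed
  have mono_mean: "am \<bullet> um \<le> au"
  proof -
    have "0 \<le> (\<Sum>p\<in>B. \<Sum>q\<in>B. \<theta> p * \<theta> q * ((snd p - snd q) \<bullet> (fst p - fst q)))"
    proof (intro sum_nonneg mult_nonneg_nonneg th0)
      fix p q assume "p \<in> B" "q \<in> B"
      then show "0 \<le> (snd p - snd q) \<bullet> (fst p - fst q)"
        using B(1) mono[of "fst p" "snd p" "fst q" "snd q"] by (auto simp: Act_def)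
    qed
    also have "\<dots> = (\<Sum>p\<in>B. \<Sum>q\<in>B. \<theta> q * (\<theta> p * (snd p \<bullet> fst p)) - \<theta> p * \<theta> q * (snd p \<bullet> fst q)
        - \<theta> p * \<theta> q * (snd q \<bullet> fst p) + \<theta> p * (\<theta> q * (snd q \<bullet> fst q)))"
      by (intro sum.cong refl) (simp add: algebra_simps)
    also have "\<dots> = sum \<theta> B * au - am \<bullet> um - am \<bullet> um + sum \<theta> B * au"
    proof -
      have 1: "(\<Sum>p\<in>B. \<Sum>q\<in>B. \<theta> q * (\<theta> p * (snd p \<bullet> fst p))) = sum \<theta> B * au"
        by (subst sum.swap) (simp add: au_def sum_product)
      have 2: "(\<Sum>p\<in>B. \<Sum>q\<in>B. \<theta> p * \<theta> q * (snd p \<bullet> fst q)) = am \<bullet> um"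
        by (simp add: am_def um_def inner_sum_left inner_sum_right sum_distrib_left mult.assoc)
           (subst sum.swap, simp add: mult.left_commute)
      have 3: "(\<Sum>p\<in>B. \<Sum>q\<in>B. \<theta> p * \<theta> q * (snd q \<bullet> fst p)) = am \<bullet> um"
        by (subst 2[symmetric], subst sum.swap) (simp add: mult.commute mult.left_commute)
      have 4: "(\<Sum>p\<in>B. \<Sum>q\<in>B. \<theta> p * (\<theta> q * (snd q \<bullet> fst q))) = sum \<theta> B * au"
        by (simp add: au_def sum_product)
      show ?thesis by (simp add: sum.distrib sum_subtractf 1 2 3 4)
    qed
    finally show ?thesis using th1 by simp
  qed
  have "\<phi> y = (\<Sum>q\<in>B. \<theta> q * g q y)"
  proof -
    have "(\<Sum>q\<in>B. \<theta> q * g q y) = (\<Sum>q\<in>B. \<theta> q * \<phi> y)"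
      using B(1) by (intro sum.cong) (auto simp: Act_def)
    also have "\<dots> = \<phi> y" using th1 by (simp flip: sum_distrib_right)
    finally show ?thesis by simp
  qed
  also have "\<dots> = (\<Sum>q\<in>B. \<theta> q * (snd q \<bullet> y) + \<theta> q * ((c *\<^sub>R y - x) \<bullet> y)
      - \<theta> q * (snd q \<bullet> fst q) - \<theta> q * ((c *\<^sub>R y - x) \<bullet> fst q))"
    by (intro sum.cong) (auto simp: g_def algebra_simps split: prod.splits)
  also have "\<dots> = am \<bullet> y + sum \<theta> B * ((c *\<^sub>R y - x) \<bullet> y) - au - (c *\<^sub>R y - x) \<bullet> um"
    by (simp add: sum.distrib sum_subtractf am_def um_def au_def inner_sum_left inner_sum_right
        sum_distrib_right)
  also have "\<dots> \<le> (am - x + c *\<^sub>R y) \<bullet> (y - um)"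
    using mono_mean th1 by (simp add: algebra_simps inner_commute)
  also have "am - x + c *\<^sub>R y = c *\<^sub>R (um - y)"
  proof -
    have "c *\<^sub>R (um - y) - (am - x + c *\<^sub>R y) = - (am - x + (2 * c) *\<^sub>R y - c *\<^sub>R um)"
      by (simp add: algebra_simps flip: scaleR_add_left)
    then show ?thesis using bal by simp
  qed
  also have "c *\<^sub>R (um - y) \<bullet> (y - um) = - (c * (norm (y - um))\<^sup>2)"
    by (simp add: power2_norm_eq_inner algebra_simps)
  also have "\<dots> \<le> 0" using assms(3) by simp
  finally have "\<phi> y \<le> 0" .
  then have "\<forall>q\<in>P. g q y \<le> 0" using le_\<phi> order_trans by blast
  then show ?thesis unfolding g_def by (intro exI[of _ y]) auto
qed

text \<open>
  If \<open>T\<close> is \<open>\<rho>\<close>-co-hypomonotone then \<open>{(u, w + \<rho> u)}\<close>, over the graph points \<open>(w, u)\<close>, is monotone,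
  and \<open>x = w + lam u\<close> reads \<open>x = (w + \<rho> u) + (lam - \<rho>) u\<close>; so this is Minty's theorem for
  \<open>T\<^sup>-\<^sup>1 + \<rho> I\<close>. Each graph point confines the solution \<open>u\<close> to a compact set, finitely many of these sets
  meet, hence all do, and maximality turns a common point into a graph point.
\<close>
lemma minty_range:
  fixes T :: "'a::euclidean_space \<Rightarrow> 'a set"
  assumes T: "maximally_co_hypomonotone \<rho> T" and "lam > \<rho>" "lam > 0"
  shows "\<exists>w. \<exists>u\<in>T w. x = w + lam *\<^sub>R u"
proof -
  define c where "c = lam - \<rho>"
  have c: "c > 0" using assms by (simp add: c_def)
  define h where "h = (\<lambda>(w::'a, u::'a) y. (w + \<rho> *\<^sub>R u - x + c *\<^sub>R y) \<bullet> (y - u))"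
  define S where "S q = {y. h q y \<le> 0}" for q
  have coh: "(u - v) \<bullet> (w - w') \<ge> - \<rho> * (norm (u - v))\<^sup>2" if "u \<in> T w" "v \<in> T w'" for u v w w'
    using T that by (fastforce simp: maximally_co_hypomonotone_def co_hypomonotone_def op_graph_def)
  have comp: "compact (S q)" for q
  proof (cases q)
    case (Pair w u)
    let ?m = "(1 / (2 * c)) *\<^sub>R (x - w - \<rho> *\<^sub>R u + c *\<^sub>R u)"
    have eq: "h q y = c * ((norm (y - ?m))\<^sup>2 - (norm ?m)\<^sup>2) - (w + \<rho> *\<^sub>R u - x) \<bullet> u" for y
      using c by (simp add: Pair h_def power2_norm_eq_inner algebra_simps inner_commute)
    let ?R = "((w + \<rho> *\<^sub>R u - x) \<bullet> u) / c + (norm ?m)\<^sup>2"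
    have "S q \<subseteq> cball ?m (sqrt ?R)"
    proof
      fix y assume "y \<in> S q"
      then have "(norm (y - ?m))\<^sup>2 \<le> ?R" using c by (simp add: S_def eq field_simps)
      then have "norm (y - ?m) \<le> sqrt ?R" by (rule real_le_rsqrt)
      then show "y \<in> cball ?m (sqrt ?R)" by (simp add: dist_norm norm_minus_commute)
    qed
    moreover have "closed (S q)"
      unfolding S_def h_def Pair by (simp, intro closed_Collect_le continuous_intros)
    ultimately show ?thesis using bounded_subset[OF bounded_cball] by (simp add: compact_eq_bounded_closed)
  qed
  have fip: "(\<Inter>q\<in>Q. S q) \<noteq> {}" if "finite Q" "Q \<subseteq> op_graph T" for Q
  proof (cases "Q = {}")
    case False
    have "\<exists>y. \<forall>(u, a)\<in>(\<lambda>(w, u). (u, w + \<rho> *\<^sub>R u)) ` Q. (a - x + c *\<^sub>R y) \<bullet> (y - u) \<le> 0"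
    proof (rule monotone_finite_solution)
      fix u a v b
      assume "(u, a) \<in> (\<lambda>(w, u). (u, w + \<rho> *\<^sub>R u)) ` Q" "(v, b) \<in> (\<lambda>(w, u). (u, w + \<rho> *\<^sub>R u)) ` Q"
      then obtain w w' where "(w, u) \<in> Q" "(w', v) \<in> Q" "a = w + \<rho> *\<^sub>R u" "b = w' + \<rho> *\<^sub>R v"
        by auto
      then show "0 \<le> (a - b) \<bullet> (u - v)"
        using coh[of u w v w'] that
        by (auto simp: op_graph_def power2_norm_eq_inner algebra_simps inner_commute)
    qed (use that False c in auto)
    then obtain y where y: "\<forall>(u, a)\<in>(\<lambda>(w, u). (u, w + \<rho> *\<^sub>R u)) ` Q. (a - x + c *\<^sub>R y) \<bullet> (y - u) \<le> 0" by blast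
    have "y \<in> S q" if "q \<in> Q" for q
      using y that by (cases q) (force simp: S_def h_def)
    then show ?thesis by blast
  qed auto
  have "(\<Inter>q\<in>op_graph T. S q) \<noteq> {}"
  proof (cases "op_graph T = {}")
    case False
    then obtain q0 where q0: "q0 \<in> op_graph T" by blast
    have "S q0 \<inter> (\<Inter>q\<in>op_graph T. S q) \<noteq> {}"
    proof (rule compact_imp_fip_image[OF comp])
      fix I assume "finite I" "I \<subseteq> op_graph T"
      then show "S q0 \<inter> (\<Inter>q\<in>I. S q) \<noteq> {}" using fip[of "insert q0 I"] q0 by auto
    qed (use comp compact_imp_closed in blast)
    then show ?thesis by blast
  qed auto
  then obtain u where u: "\<And>q. q \<in> op_graph T \<Longrightarrow> h q u \<le> 0" by (auto simp: S_def)
  define w where "w = x - lam *\<^sub>R u"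
  define T' where "T' = T(w := insert u (T w))"
  have new: "(u - v) \<bullet> (w - w') \<ge> - \<rho> * (norm (u - v))\<^sup>2" if "v \<in> T w'" for v w'
    using u[of "(w', v)"] that
    by (simp add: op_graph_def h_def w_def c_def power2_norm_eq_inner algebra_simps inner_commute)
  have new': "(v - u) \<bullet> (w' - w) \<ge> - \<rho> * (norm (v - u))\<^sup>2" if "v \<in> T w'" for v w'
    using new[OF that] by (simp add: norm_minus_commute algebra_simps)
  have "(a - b) \<bullet> (v - v') \<ge> - \<rho> * (norm (a - b))\<^sup>2" if "a \<in> T' v" "b \<in> T' v'" for a b v v'
  proof -
    have "a \<in> T v \<or> a = u \<and> v = w" "b \<in> T v' \<or> b = u \<and> v' = w"
      using that by (auto simp: T'_def split: if_splits)
    then show ?thesis using coh[of a v b v'] new[of b v'] new'[of a v] by fastforce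
  qed
  then have "co_hypomonotone \<rho> T'"
    by (auto simp: co_hypomonotone_def op_graph_def)
  moreover have "op_graph T \<subseteq> op_graph T'" by (auto simp: op_graph_def T'_def)
  ultimately have "op_graph T' = op_graph T" using T by (auto simp: maximally_co_hypomonotone_def)
  moreover have "(w, u) \<in> op_graph T'" by (simp add: op_graph_def T'_def)
  ultimately have "u \<in> T w" by (simp add: op_graph_def)
  then show ?thesis by (intro exI[of _ w] bexI[of _ u]) (auto simp: w_def)
qed

section \<open>Co-coercivity of the residual\<close>

context
  fixes T :: "'a::euclidean_space \<Rightarrow> 'a set" and \<rho> lam :: real
  assumes T: "maximally_co_hypomonotone \<rho> T" and \<rho>: "\<rho> \<ge> 0" and lam: "lam > 0" "2 * \<rho> \<le> lam"
begin

lemma co_hypomonotone_graph: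
  "u \<in> T w \<Longrightarrow> v \<in> T w' \<Longrightarrow> (u - v) \<bullet> (w - w') \<ge> - \<rho> * (norm (u - v))\<^sup>2"
  using T by (fastforce simp: maximally_co_hypomonotone_def co_hypomonotone_def op_graph_def)

text \<open>
  Beyond \<open>|w - w'|\<^sup>2\<close>, expanding the square on the right leaves \<open>lam (lam - 2 \<rho>) |u - v|\<^sup>2\<close> at worst, whence the hypothesis
  \<open>2 \<rho> \<le> lam\<close>. It makes the resolvent single-valued and nonexpansive.
\<close>
lemma backward_step_expansive:
  assumes "u \<in> T w" "v \<in> T w'"
  shows "norm (w - w') \<le> norm ((w + lam *\<^sub>R u) - (w' + lam *\<^sub>R v))"
proof -
  define a where "a = u - v"
  define d where "d = w - w'"
  have "(w + lam *\<^sub>R u) - (w' + lam *\<^sub>R v) = d + lam *\<^sub>R a"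
    by (simp add: a_def d_def algebra_simps)
  moreover have "(norm (d + lam *\<^sub>R a))\<^sup>2 = (norm d)\<^sup>2 + 2 * lam * (a \<bullet> d) + lam\<^sup>2 * (norm a)\<^sup>2"
    unfolding power2_norm_eq_inner
    by (simp add: inner_add_left inner_add_right inner_commute power2_eq_square)
  moreover have "lam * (a \<bullet> d) \<ge> lam * (- \<rho> * (norm a)\<^sup>2)"
    using co_hypomonotone_graph[OF assms] lam(1)
    unfolding a_def d_def by (rule mult_left_mono[OF _ less_imp_le])
  moreover have "2 * (lam * (\<rho> * (norm a)\<^sup>2)) \<le> lam\<^sup>2 * (norm a)\<^sup>2"
    using mult_right_mono[of "2 * \<rho>" lam "lam * (norm a)\<^sup>2"] lam
    by (simp add: power2_eq_square mult_ac)
  ultimately have "(norm d)\<^sup>2 \<le> (norm ((w + lam *\<^sub>R u) - (w' + lam *\<^sub>R v)))\<^sup>2"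
    by simp
  then show ?thesis unfolding d_def by (rule power2_le_imp_le) simp
qed

lemma resolvent_eqI:
  assumes "u \<in> T w" "x = w + lam *\<^sub>R u"
  shows "resolvent lam T x = w"
proof -
  have "w' = w" if "v \<in> T w'" "x = w' + lam *\<^sub>R v" for v w'
    using backward_step_expansive[OF that(1) assms(1)] that(2) assms(2) by simp
  then have "resolvent_set lam T x = {w}"
    using assms unfolding resolvent_set_def by blast
  then show ?thesis by (simp add: resolvent_def)
qed

lemma resolvent_inclusion:
  obtains u where "u \<in> T (resolvent lam T x)" "x = resolvent lam T x + lam *\<^sub>R u"
proof -
  have "lam > \<rho>" using lam \<rho> by linarith
  then obtain w u where wu: "u \<in> T w" "x = w + lam *\<^sub>R u"
    using minty_range[OF T \<open>lam > \<rho>\<close> lam(1), of x] by auto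
  from resolvent_eqI[OF wu] wu show ?thesis by (intro that[of u]) simp_all
qed

lemma resolvent_nonexpansive: "dist (resolvent lam T x) (resolvent lam T y) \<le> dist x y"
proof -
  obtain u where u: "u \<in> T (resolvent lam T x)" "x = resolvent lam T x + lam *\<^sub>R u"
    by (rule resolvent_inclusion)
  obtain v where v: "v \<in> T (resolvent lam T y)" "y = resolvent lam T y + lam *\<^sub>R v"
    by (rule resolvent_inclusion)
  from backward_step_expansive[OF u(1) v(1)] show ?thesis
    by (simp only: dist_norm flip: u(2) v(2))
qed

lemma resolvent_measurable [measurable]: "resolvent lam T \<in> borel_measurable borel"
proof (rule borel_measurable_continuous_onI)
  show "continuous_on UNIV (resolvent lam T)"
    unfolding continuous_on_iff
  proof (intro ballI allI impI)
    fix x :: 'a and e :: real assume "0 < e"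
    then show "\<exists>d>0. \<forall>y\<in>UNIV. dist y x < d \<longrightarrow> dist (resolvent lam T y) (resolvent lam T x) < e"
      using resolvent_nonexpansive le_less_trans by (intro exI[of _ e]) blast
  qed
qed

text \<open>
  The graph point behind a forward-backward step; inequalities for the residual come from
  inserting two such points into co-hypomonotonicity.
\<close>
lemma fb_residual_at_inclusion: "fb_residual_at lam T v x - v \<in> T (x - lam *\<^sub>R fb_residual_at lam T v x)"
proof -
  obtain u where u: "u \<in> T (resolvent lam T (x - lam *\<^sub>R v))"
      "x - lam *\<^sub>R v = resolvent lam T (x - lam *\<^sub>R v) + lam *\<^sub>R u"
    by (rule resolvent_inclusion)
  let ?g = "fb_residual_at lam T v x"
  have g: "lam *\<^sub>R ?g = x - resolvent lam T (x - lam *\<^sub>R v)"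
    using lam by (simp add: fb_residual_at_def)
  have "lam *\<^sub>R (?g - v) = (x - lam *\<^sub>R v) - resolvent lam T (x - lam *\<^sub>R v)"
    by (simp add: scaleR_diff_right g)
  also have "\<dots> = lam *\<^sub>R u" by (subst u(2)) simp
  finally have "?g - v = u" using lam by (simp only: scaleR_cancel_left) simp
  moreover have "x - lam *\<^sub>R ?g = resolvent lam T (x - lam *\<^sub>R v)" by (simp add: g)
  ultimately show ?thesis using u(1) by simp
qed

lemma fb_residual_at_lipschitz:
  "norm (fb_residual_at lam T v x - fb_residual_at lam T v' x) \<le> norm (v - v')"
proof -
  let ?J = "\<lambda>v. resolvent lam T (x - lam *\<^sub>R v)"
  have "norm (fb_residual_at lam T v x - fb_residual_at lam T v' x) = (1 / lam) * norm (?J v' - ?J v)"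
    using lam by (simp add: fb_residual_at_def flip: scaleR_diff_right)
  also have "\<dots> \<le> (1 / lam) * norm (lam *\<^sub>R (v - v'))"
    using resolvent_nonexpansive[of "x - lam *\<^sub>R v'" "x - lam *\<^sub>R v"] lam
    by (intro mult_left_mono) (auto simp: dist_norm algebra_simps)
  finally show ?thesis using lam by simp
qed

lemma fb_residual_zero:
  assumes "xs \<in> op_zer (op_sum F T)"
  shows "fb_residual lam F T xs = 0"
proof -
  obtain u where "u \<in> T xs" "0 = F xs + u" using assms by (auto simp: op_zer_def op_sum_def)
  then have "- F xs \<in> T xs" by (simp add: minus_unique)
  then have "resolvent lam T (xs - lam *\<^sub>R F xs) = xs" by (rule resolvent_eqI) simp
  then show ?thesis by (simp add: fb_residual_def fb_residual_at_def)
qed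

text \<open>
  Co-hypomonotonicity at the two graph points gives a quadratic inequality in the differences of
  \<open>F\<close> and of the residual. The share \<open>1 / Lh\<close> of the coercivity of \<open>F\<close> completes the square in the
  difference of \<open>F\<close>, which fixes the constant; the share \<open>1 / L - 1 / Lh\<close> is kept and later pays for
  the variance of the estimator.
\<close>
lemma fb_residual_cocoercive:
  assumes "L > 0" "Lh > L" "Lh * \<rho> < 1"
    and V: "(norm (F x - F y))\<^sup>2 \<le> V" "(F x - F y) \<bullet> (x - y) \<ge> V / L"
  shows "(fb_residual lam F T x - fb_residual lam F T y) \<bullet> (x - y)
     \<ge> (lam * (4 - Lh * lam) - 4 * \<rho>) / (4 * (1 - \<rho> * Lh)) * (norm (fb_residual lam F T x - fb_residual lam F T y))\<^sup>2
        + (Lh - L) / (L * Lh) * V"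
proof -
  define gx where "gx = fb_residual lam F T x"
  define gy where "gy = fb_residual lam F T y"
  define g where "g = gx - gy"
  define f where "f = F x - F y"
  define d where "d = x - y"
  have Lh: "Lh > 0" using assms by simp
  have K: "1 - \<rho> * Lh > 0" using assms by (simp add: mult.commute)
  have "(gx - F x - (gy - F y)) \<bullet> (x - lam *\<^sub>R gx - (y - lam *\<^sub>R gy))
      \<ge> - \<rho> * (norm (gx - F x - (gy - F y)))\<^sup>2"
    unfolding gx_def gy_def fb_residual_def
    by (intro co_hypomonotone_graph fb_residual_at_inclusion)
  moreover have "gx - F x - (gy - F y) = g - f" "x - lam *\<^sub>R gx - (y - lam *\<^sub>R gy) = d - lam *\<^sub>R g"
    by (simp_all add: g_def f_def d_def algebra_simps)
  ultimately have "(g - f) \<bullet> (d - lam *\<^sub>R g) \<ge> - \<rho> * (norm (g - f))\<^sup>2" by simp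
  then have 1: "g \<bullet> d \<ge> f \<bullet> d + (lam - \<rho>) * (g \<bullet> g) - (lam - 2 * \<rho>) * (f \<bullet> g) - \<rho> * (f \<bullet> f)"
    by (simp add: power2_norm_eq_inner algebra_simps inner_commute)
  have 2: "f \<bullet> d \<ge> (f \<bullet> f) / Lh + (Lh - L) / (L * Lh) * V"
  proof -
    have "(f \<bullet> f) / Lh \<le> V / Lh" using V(1) Lh by (simp add: f_def power2_norm_eq_inner divide_right_mono)
    moreover have "V / Lh + (Lh - L) / (L * Lh) * V = V / L" using assms Lh by (simp add: field_simps)
    ultimately show ?thesis using V(2) by (simp add: f_def d_def)
  qed
  define a where "a = (1 - \<rho> * Lh) / Lh"
  have a: "a > 0" using K Lh by (simp add: a_def)
  have a': "1 / Lh - \<rho> = a" using Lh by (simp add: a_def field_simps)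
  define q where "q = lam - 2 * \<rho>"
  have "0 \<le> (norm ((2 * a) *\<^sub>R f - q *\<^sub>R g))\<^sup>2" by simp
  also have "\<dots> = 4 * a * (a * (f \<bullet> f)) - 4 * a * (q * (f \<bullet> g)) + q\<^sup>2 * (g \<bullet> g)"
    unfolding power2_norm_eq_inner
    by (simp add: inner_diff_left inner_diff_right inner_commute power2_eq_square algebra_simps)
  also have "q\<^sup>2 * (g \<bullet> g) = 4 * a * (q\<^sup>2 / (4 * a) * (g \<bullet> g))" using a by simp
  finally have "0 \<le> 4 * a * (a * (f \<bullet> f) - q * (f \<bullet> g) + q\<^sup>2 / (4 * a) * (g \<bullet> g))"
    by (simp only: distrib_left right_diff_distrib)
  then have 3: "a * (f \<bullet> f) - (lam - 2 * \<rho>) * (f \<bullet> g) + (lam - 2 * \<rho>)\<^sup>2 / (4 * a) * (g \<bullet> g) \<ge> 0"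
    unfolding q_def
    using a by (simp add: zero_le_mult_iff)
  have 4: "lam - \<rho> - (lam - 2 * \<rho>)\<^sup>2 / (4 * a) = (lam * (4 - Lh * lam) - 4 * \<rho>) / (4 * (1 - \<rho> * Lh))"
  proof -
    define k where "k = 1 - \<rho> * Lh"
    have "(lam - 2 * \<rho>)\<^sup>2 / (4 * a) = Lh * (lam - 2 * \<rho>)\<^sup>2 / (4 * k)"
      using K Lh by (simp add: a_def k_def)
    moreover have "lam - \<rho> = (lam - \<rho>) * (4 * k) / (4 * k)" using K by (simp add: k_def)
    moreover have "(lam - \<rho>) * (4 * k) - Lh * (lam - 2 * \<rho>)\<^sup>2 = lam * (4 - Lh * lam) - 4 * \<rho>"
      unfolding k_def by (simp add: power2_eq_square algebra_simps)
    ultimately show ?thesis by (metis diff_divide_distrib k_def)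
  qed
  have "a * (f \<bullet> f) = (f \<bullet> f) / Lh - \<rho> * (f \<bullet> f)" by (simp only: a'[symmetric]) (simp add: left_diff_distrib)
  with 1 2 3 have "g \<bullet> d \<ge> (lam - \<rho> - (lam - 2 * \<rho>)\<^sup>2 / (4 * a)) * (g \<bullet> g) + (Lh - L) / (L * Lh) * V"
    unfolding left_diff_distrib by linarith
  then show ?thesis by (simp only: 4) (simp add: g_def d_def gx_def gy_def power2_norm_eq_inner)
qed

end

section \<open>The potential\<close>

text \<open>
  \<open>X\<close> and \<open>Z\<close> are the positions of \<open>x\<^sup>k\<close> and \<open>z\<^sup>k\<close> relative to a solution, \<open>g\<close> is the residual at
  \<open>x\<^sup>k\<close>, and \<open>u = t\<^bsub>k-1\<^esub>\<close>. A step loses \<open>(1 - \<mu>) g \<bullet> (X - Z)\<close> from the first term. The weights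
  of the two squares of positions are such that they lose \<open>\<mu> g \<bullet> (X - Z)\<close> and \<open>g \<bullet> Z\<close>, which
  makes \<open>g \<bullet> X\<close> in total, a nonnegative number. Without the square of \<open>X - Z\<close> the weight of \<open>|Z|\<^sup>2\<close>
  would have to be smaller by the factor \<open>1 - \<mu>\<close>, and the lower bound in \<open>|g|\<^sup>2\<close> would degenerate as \<open>\<mu>\<close>
  approaches \<open>2/3\<close>.
\<close>
definition potential :: "real \<Rightarrow> real \<Rightarrow> real \<Rightarrow> 'a::real_inner \<Rightarrow> 'a \<Rightarrow> 'a \<Rightarrow> real" where
  "potential \<mu> \<beta> u X Z g =
     u * (g \<bullet> (X - Z)) + \<beta> * (u * (u - 1)) * (norm g)\<^sup>2
     + \<mu> * u * (u - \<mu> / 2) / (4 * \<beta> * (1 - \<mu> / 2) * (u - 1)\<^sup>2) * (norm (X - Z))\<^sup>2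
     + (u - \<mu> / 2) / (2 * \<beta> * \<mu> * (u - 1)) * (norm Z)\<^sup>2"

lemma young_absorb:
  fixes a b :: "'a::real_inner"
  assumes "s > 0" "s \<le> S" "c\<^sup>2 \<le> 4 * s * C"
  shows "S * (norm a)\<^sup>2 + c * (a \<bullet> b) + C * (norm b)\<^sup>2 \<ge> 0"
proof -
  have "0 \<le> s * (norm (a + (c / (2 * s)) *\<^sub>R b))\<^sup>2" using assms by simp
  also have "\<dots> = s * (norm a)\<^sup>2 + c * (a \<bullet> b) + c\<^sup>2 / (4 * s) * (norm b)\<^sup>2"
    using assms(1) unfolding power2_norm_eq_inner
    by (simp add: inner_add_left inner_add_right inner_commute field_simps power2_eq_square)
  finally have "0 \<le> s * (norm a)\<^sup>2 + c * (a \<bullet> b) + c\<^sup>2 / (4 * s) * (norm b)\<^sup>2" .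
  moreover have "s * (norm a)\<^sup>2 \<le> S * (norm a)\<^sup>2" using assms(2) by (rule mult_right_mono) simp
  moreover have "c\<^sup>2 / (4 * s) * (norm b)\<^sup>2 \<le> C * (norm b)\<^sup>2"
    using assms by (intro mult_right_mono) (auto simp: divide_le_eq mult_ac)
  ultimately show ?thesis by linarith
qed

context
  fixes \<mu> \<beta> \<beta>b \<nu> t :: real
  assumes \<mu>: "0 < \<mu>" "\<mu> < 2 / 3" and \<beta>: "0 < \<beta>" "\<beta> \<le> (2 - \<mu>) * \<beta>b / (2 + \<mu>)"
    and \<nu>: "\<nu> = \<mu> / 2" and t: "t > 1 + 5 * \<mu>"
begin

lemma cocoercivity_margin: "\<beta>b \<ge> \<beta> * ((2 + \<mu>) / (2 - \<mu>))" "\<beta>b \<ge> \<beta> * (1 + \<mu> + \<mu>\<^sup>2 / 2)" "\<beta>b \<ge> \<beta>"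
proof -
  have p: "2 - \<mu> > 0" "2 + \<mu> > 0" using \<mu> by auto
  then have "\<beta> * (2 + \<mu>) \<le> (2 - \<mu>) * \<beta>b" using \<beta>(2) by (simp add: pos_le_divide_eq)
  then show 1: "\<beta>b \<ge> \<beta> * ((2 + \<mu>) / (2 - \<mu>))" using p by (simp add: divide_le_eq mult.commute)
  have "(1 + \<mu> + \<mu>\<^sup>2 / 2) * (2 - \<mu>) \<le> 2 + \<mu>"
  proof -
    have "\<mu> ^ 3 \<ge> 0" using \<mu> by simp
    moreover have "(1 + \<mu> + \<mu>\<^sup>2 / 2) * (2 - \<mu>) = 2 + \<mu> - \<mu> ^ 3 / 2"
      by (simp add: field_simps power2_eq_square power3_eq_cube)
    ultimately show ?thesis by linarith
  qed
  then have "1 + \<mu> + \<mu>\<^sup>2 / 2 \<le> (2 + \<mu>) / (2 - \<mu>)" using p by (simp add: pos_le_divide_eq)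
  then have "\<beta> * (1 + \<mu> + \<mu>\<^sup>2 / 2) \<le> \<beta> * ((2 + \<mu>) / (2 - \<mu>))" using \<beta>(1) by (intro mult_left_mono) auto
  then show 2: "\<beta>b \<ge> \<beta> * (1 + \<mu> + \<mu>\<^sup>2 / 2)" using 1 by linarith
  have "\<beta> * 1 \<le> \<beta> * (1 + \<mu> + \<mu>\<^sup>2 / 2)" using \<beta>(1) \<mu> by (intro mult_left_mono) auto
  then show "\<beta>b \<ge> \<beta>" using 2 by simp
qed

text \<open>
  The decrease of the weight of \<open>|X - Z|\<^sup>2\<close> in one step, which also shrinks the gap by the factor
  \<open>1 - 1 / t\<close>. This slack and the two that follow absorb the
  products of the estimator error with \<open>X - Z\<close>, with \<open>Z\<close> and with the residual.
\<close>
lemma slack_gap: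
  "\<mu> * (t - \<mu>) * (t - \<mu> - \<nu>) / (4 * \<beta> * (1 - \<nu>) * (t - \<mu> - 1)\<^sup>2) - \<mu> * (t - \<nu>) / (4 * \<beta> * (1 - \<nu>) * t)
    \<ge> \<mu> / (2 * \<beta> * (t - 1))"
proof -
  define k where "k = \<mu> / (4 * \<beta> * (1 - \<nu>))"
  have k: "k > 0" using \<mu> \<beta> \<nu> by (simp add: k_def)
  have pos: "t - \<mu> - 1 > 0" "t - 1 > 0" "t > 0" "t - \<nu> > 0" "1 - \<nu> > 0" "0 < \<nu>" "\<nu> < 1" using \<mu> t \<nu> by auto
  have "t / (t - 1) * ((t - \<nu>) / (t - 1)) \<le> (t - \<mu>) / (t - \<mu> - 1) * ((t - \<mu> - \<nu>) / (t - \<mu> - 1))"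
  proof (rule mult_mono)
    have "t * (t - \<mu> - 1) \<le> (t - \<mu>) * (t - 1)" using \<mu> by (simp add: algebra_simps)
    then show "t / (t - 1) \<le> (t - \<mu>) / (t - \<mu> - 1)" using pos by (simp add: frac_le_eq divide_le_eq pos_le_divide_eq)
    have "(t - \<nu>) * (t - \<mu> - 1) \<le> (t - \<mu> - \<nu>) * (t - 1)"
      using \<mu> pos mult_left_mono[of \<nu> 1 \<mu>] by (simp add: algebra_simps)
    then show "(t - \<nu>) / (t - 1) \<le> (t - \<mu> - \<nu>) / (t - \<mu> - 1)" using pos by (simp add: divide_le_eq pos_le_divide_eq)
  qed (use pos \<mu> in auto)
  moreover have "t / (t - 1) * ((t - \<nu>) / (t - 1)) - (t - \<nu>) / t \<ge> 2 * (1 - \<nu>) / (t - 1)"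
  proof -
    have "t / (t - 1) * ((t - \<nu>) / (t - 1)) - (t - \<nu>) / t = (t - \<nu>) / t * ((t * t - (t - 1) * (t - 1)) / ((t - 1) * (t - 1)))"
    proof -
      have "s / t * ((t * t - P) / P) = t / (t - 1) * (s / (t - 1)) - s / t" if "P = (t - 1) * (t - 1)" for s P
      proof -
        have "(t * t - P) / P = t * t / P - 1" using that pos by (simp add: diff_divide_distrib)
        then have "s / t * ((t * t - P) / P) = s / t * (t * t / P) - s / t" by (simp add: right_diff_distrib)
        moreover have "s / t * (t * t / P) = t / (t - 1) * (s / (t - 1))" using pos that by simp
        ultimately show ?thesis by simp
      qed
      then show ?thesis by simp
    qed
    also have "t * t - (t - 1) * (t - 1) = 2 * t - 1" by (simp add: algebra_simps)
    also have "(t - \<nu>) / t * ((2 * t - 1) / ((t - 1) * (t - 1))) \<ge> (1 - \<nu>) * ((2 * (t - 1)) / ((t - 1) * (t - 1)))"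
    proof (rule mult_mono)
      have "t * (1 - \<nu>) \<le> t - \<nu>" using pos by (simp add: algebra_simps)
      then show "1 - \<nu> \<le> (t - \<nu>) / t" using pos by (simp add: pos_le_divide_eq mult.commute)
    qed (use pos in \<open>auto intro!: divide_right_mono\<close>)
    finally have "(1 - \<nu>) * ((2 * (t - 1)) / ((t - 1) * (t - 1))) \<le> t / (t - 1) * ((t - \<nu>) / (t - 1)) - (t - \<nu>) / t" .
    moreover have "(1 - \<nu>) * ((2 * p) / (p * p)) = 2 * (1 - \<nu>) / p" for p by simp
    ultimately show ?thesis by (simp only:)
  qed
  ultimately have "(t - \<mu>) / (t - \<mu> - 1) * ((t - \<mu> - \<nu>) / (t - \<mu> - 1)) - (t - \<nu>) / t \<ge> 2 * (1 - \<nu>) / (t - 1)"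
    by linarith
  then have "k * ((t - \<mu>) / (t - \<mu> - 1) * ((t - \<mu> - \<nu>) / (t - \<mu> - 1)) - (t - \<nu>) / t) \<ge> k * (2 * (1 - \<nu>) / (t - 1))"
    using k by (intro mult_left_mono) auto
  moreover have "k * (2 * (1 - \<nu>) / (t - 1)) = \<mu> / (2 * \<beta> * (t - 1))"
  proof -
    have "\<mu> / (4 * \<beta> * n) * (2 * n / p) = \<mu> / (2 * \<beta> * p)" if "n \<noteq> 0" for n p using that by simp
    then show ?thesis using pos by (simp only: k_def)
  qed
  moreover have "k * ((t - \<mu>) / (t - \<mu> - 1) * ((t - \<mu> - \<nu>) / (t - \<mu> - 1)) - (t - \<nu>) / t)
      = \<mu> * (t - \<mu>) * (t - \<mu> - \<nu>) / (4 * \<beta> * (1 - \<nu>) * (t - \<mu> - 1)\<^sup>2) - \<mu> * (t - \<nu>) / (4 * \<beta> * (1 - \<nu>) * t)"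
  proof -
    have "\<mu> / (4 * \<beta> * n) * (a / p * (b / p) - c / t) = \<mu> * a * b / (4 * \<beta> * n * p\<^sup>2) - \<mu> * c / (4 * \<beta> * n * t)"
      for n a b c p by (simp add: right_diff_distrib power2_eq_square)
    then show ?thesis by (simp only: k_def)
  qed
  ultimately show ?thesis by simp
qed

lemma slack_anchor:
  "(t - \<mu> - \<nu>) / (2 * \<beta> * \<mu> * (t - \<mu> - 1)) - (t - \<nu>) / (2 * \<beta> * \<mu> * (t - 1))
    \<ge> 1 / (3 * \<beta> * (t * (t - 1)))"
proof -
  have pos: "t - \<mu> - 1 > 0" "t - 1 > 0" "t > 0" "t - \<nu> > 0" "1 - \<nu> > 2/3" using \<mu> t \<nu> by auto
  have "(t - \<mu> - \<nu>) / (t - \<mu> - 1) - (t - \<nu>) / (t - 1) = (1 - \<nu>) * \<mu> / ((t - \<mu> - 1) * (t - 1))"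
    using pos by (simp add: diff_frac_eq) (simp add: algebra_simps)
  moreover have "(1 - \<nu>) * \<mu> / ((t - \<mu> - 1) * (t - 1)) \<ge> (2/3) * \<mu> / (t * (t - 1))"
    using pos \<mu> by (intro frac_le mult_right_mono) auto
  ultimately have "(2/3) * \<mu> / (t * (t - 1)) / (2 * \<beta> * \<mu>)
      \<le> ((t - \<mu> - \<nu>) / (t - \<mu> - 1) - (t - \<nu>) / (t - 1)) / (2 * \<beta> * \<mu>)"
    using \<mu> \<beta> by (intro divide_right_mono) auto
  moreover have "(2/3) * \<mu> / (t * (t - 1)) / (2 * \<beta> * \<mu>) = 1 / (3 * \<beta> * (t * (t - 1)))"
    using \<mu> by simp
  moreover have "((t - \<mu> - \<nu>) / (t - \<mu> - 1) - (t - \<nu>) / (t - 1)) / (2 * \<beta> * \<mu>)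
    = (t - \<mu> - \<nu>) / (2 * \<beta> * \<mu> * (t - \<mu> - 1)) - (t - \<nu>) / (2 * \<beta> * \<mu> * (t - 1))"
    by (simp add: diff_divide_distrib mult.commute)
  ultimately show ?thesis by simp
qed

text \<open>
  The terms in \<open>|X - Z|\<^sup>2\<close> and \<open>|Z|\<^sup>2\<close> of the potential are quadratic in the step; \<open>\<beta>\<close> times this
  number is the total weight with which the square of the step direction enters.
\<close>
definition quad_weight :: real where "quad_weight = (\<mu> * (1 - \<nu>) * t + \<nu> * (t - 1)) / (t - \<nu>)"

lemma quad_weight_le: "0 \<le> quad_weight" "quad_weight \<le> 3 / 2 * \<mu>" "quad_weight \<le> 3/10 * (t * (t - 1))"
proof -
  have pos: "t > 1" "t - \<nu> > 0" "0 < \<nu>" "\<nu> < 1" "t - 1 > 5 * \<mu>" using \<mu> t \<nu> by auto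
  show "0 \<le> quad_weight" using pos \<mu> by (simp add: quad_weight_def)
  have "(1 - \<nu>) * t \<le> t - \<nu>" using pos by (simp add: algebra_simps)
  then have "\<mu> * ((1 - \<nu>) * t) + \<nu> * (t - 1) \<le> \<mu> * (t - \<nu>) + \<nu> * (t - \<nu>)"
    using pos \<mu> by (intro add_mono mult_left_mono) auto
  then have "\<mu> * (1 - \<nu>) * t + \<nu> * (t - 1) \<le> 3 / 2 * \<mu> * (t - \<nu>)"
    by (simp add: \<nu> algebra_simps)
  then show 1: "quad_weight \<le> 3 / 2 * \<mu>" using pos by (simp add: quad_weight_def divide_le_eq)
  have "5 * \<mu> \<le> t * (t - 1)" using mult_mono[of 1 t "5 * \<mu>" "t - 1"] pos \<mu> by simp
  then show "quad_weight \<le> 3/10 * (t * (t - 1))" using 1 by linarith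
qed

lemma cross_weight:
  fixes \<eta> assumes \<eta>: "\<eta> = 2 * \<beta> * (t - 1) / (t - \<nu>)"
  defines "c \<equiv> 2 * \<beta> * (t * (t - 1)) - t * (t - 1) * \<eta> - 2 * \<beta> * quad_weight"
  shows "0 \<le> c" "c \<le> 2 * \<beta> * (t - 1)"
proof -
  have pos: "t > 1" "t - \<nu> > 0" "0 < \<nu>" "\<nu> < 1/3" "t - 1 > 5 * \<mu>" using \<mu> t \<nu> by auto
  have "c = 2 * \<beta> * ((t * (t - 1) * (t - \<nu>) - t * (t - 1) * (t - 1) - (\<mu> * (1 - \<nu>) * t + \<nu> * (t - 1))) / (t - \<nu>))"
    using pos by (simp add: c_def quad_weight_def \<eta> diff_divide_distrib) (simp add: field_simps)
  also have "t * (t - 1) * (t - \<nu>) - t * (t - 1) * (t - 1) - (\<mu> * (1 - \<nu>) * t + \<nu> * (t - 1))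
     = (1 - \<nu>) * t * (t - 1 - \<mu>) - \<nu> * (t - 1)"
    by (simp add: algebra_simps)
  finally have c: "c = 2 * \<beta> * (((1 - \<nu>) * t * (t - 1 - \<mu>) - \<nu> * (t - 1)) / (t - \<nu>))" .
  have "(2/3) * t * (4 * \<mu>) \<le> (1 - \<nu>) * t * (t - 1 - \<mu>)" using pos \<mu> by (intro mult_mono) auto
  moreover have "\<nu> * (t - 1) \<le> \<mu> / 2 * t" using pos \<mu> \<nu> by (intro mult_mono) auto
  moreover have "\<mu> * t \<ge> 0" using pos \<mu> by simp
  moreover have "(2/3) * t * (4 * \<mu>) = 8/3 * (\<mu> * t)" "\<mu> / 2 * t = 1/2 * (\<mu> * t)" by simp_all
  ultimately have "0 \<le> (1 - \<nu>) * t * (t - 1 - \<mu>) - \<nu> * (t - 1)" by linarith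
  then show "0 \<le> c" using c pos \<beta> by simp
  have "(1 - \<nu>) * t \<le> t - \<nu>" using pos by (simp add: algebra_simps)
  then have "(1 - \<nu>) * t * (t - 1 - \<mu>) \<le> (t - \<nu>) * (t - 1)"
    using pos \<mu> by (intro mult_mono) auto
  then have "(1 - \<nu>) * t * (t - 1 - \<mu>) - \<nu> * (t - 1) \<le> (t - 1) * (t - \<nu>)"
    using pos mult_nonneg_nonneg[of \<nu> "t - 1"] mult.commute[of "t - 1" "t - \<nu>"] by linarith
  then have "((1 - \<nu>) * t * (t - 1 - \<mu>) - \<nu> * (t - 1)) / (t - \<nu>) \<le> t - 1"
    using pos by (simp add: divide_le_eq)
  then show "c \<le> 2 * \<beta> * (t - 1)" unfolding c using \<beta> by (intro mult_left_mono) auto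
qed

text \<open>
  For large \<open>t\<close> the slack is about \<open>(2 - 3 \<mu>) \<beta> t\<close>, whence the condition \<open>\<mu> < 2/3\<close>. Only a
  multiple of \<open>\<beta>\<close> is retained here, since the coefficient \<open>2 - 3 \<mu>\<close> has no positive lower bound.
\<close>
lemma slack_residual:
  fixes \<eta> assumes \<eta>: "\<eta> = 2 * \<beta> * (t - 1) / (t - \<nu>)"
  shows "\<beta> / 2 \<le> \<beta>b + \<beta> * ((t - \<mu>) * (t - \<mu> - 1)) - (\<eta> - \<beta>) * (t * (t - 1)) - \<beta> * quad_weight"
proof -
  have pos: "t > 1" "t - \<nu> \<ge> 1" "0 < \<nu>" "\<nu> < 1/3" "t - 1 > 5 * \<mu>" using \<mu> t \<nu> by auto
  have "t * (t - 1) / (t - \<nu>) \<ge> t - 1 + \<nu>\<^sup>2"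
  proof -
    have "(t - 1 + \<nu>\<^sup>2) * (t - \<nu>) = t * (t - 1) - (\<nu> - \<nu>\<^sup>2) * (t - \<nu> - 1)"
      by (simp add: algebra_simps power2_eq_square)
    moreover have "(\<nu> - \<nu>\<^sup>2) * (t - \<nu> - 1) \<ge> 0" using pos by (simp add: power2_eq_square)
    ultimately show ?thesis using pos by (simp add: pos_le_divide_eq)
  qed
  then have "(1 - \<nu>) * (t - 1 + \<nu>\<^sup>2) \<le> (1 - \<nu>) * (t * (t - 1) / (t - \<nu>))"
    using pos by (intro mult_left_mono) auto
  moreover have "(t - 1) / (t - \<nu>) * (t * (t - 1)) = t * (t - 1) - (1 - \<nu>) * (t * (t - 1) / (t - \<nu>))"
    using pos by (simp add: field_simps)
  ultimately have A: "(t - 1) / (t - \<nu>) * (t * (t - 1)) \<le> t * (t - 1) - (1 - \<nu>) * (t - 1 + \<nu>\<^sup>2)" by linarith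
  have "1 / 2 \<le> 1 + \<mu> + \<mu>\<^sup>2 / 2 + (t - \<mu>) * (t - \<mu> - 1) - t * (t - 1) + 2 * ((1 - \<nu>) * (t - 1 + \<nu>\<^sup>2)) - 3 / 2 * \<mu>"
  proof -
    have 1: "(2 - 3 * \<mu>) * (t - 1 - 5 * \<mu>) \<ge> 0" using \<mu> pos by (intro mult_nonneg_nonneg) auto
    have 2: "\<mu>\<^sup>2 \<le> 2 / 3 * \<mu>" using \<mu> by (simp add: power2_eq_square)
    have 3: "\<mu>\<^sup>2 * (2 - \<mu>) / 4 \<ge> 0" using \<mu> by simp
    have eq: "1 + \<mu> + \<mu>\<^sup>2 / 2 + (t - \<mu>) * (t - \<mu> - 1) - t * (t - 1) + 2 * ((1 - \<nu>) * (t - 1 + \<nu>\<^sup>2)) - 3 / 2 * \<mu>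
       = (2 - 3 * \<mu>) * (t - 1 - 5 * \<mu>) + 1 + 17 / 2 * \<mu> - 27 / 2 * \<mu>\<^sup>2 + \<mu>\<^sup>2 * (2 - \<mu>) / 4"
      by (simp add: \<nu> field_simps power2_eq_square power3_eq_cube)
    show ?thesis unfolding eq using 1 2 3 \<mu> by linarith
  qed
  then have "1 / 2 \<le> 1 + \<mu> + \<mu>\<^sup>2 / 2 + (t - \<mu>) * (t - \<mu> - 1) + t * (t - 1) - 2 * ((t - 1) / (t - \<nu>) * (t * (t - 1))) - quad_weight"
    using A quad_weight_le(2) by linarith
  then have "\<beta> * (1 / 2) \<le> \<beta> * (1 + \<mu> + \<mu>\<^sup>2 / 2 + (t - \<mu>) * (t - \<mu> - 1) + t * (t - 1) - 2 * ((t - 1) / (t - \<nu>) * (t * (t - 1))) - quad_weight)"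
    using \<beta>(1) by (simp only: mult_le_cancel_left_pos)
  also have "\<dots> = \<beta> * (1 + \<mu> + \<mu>\<^sup>2 / 2) + \<beta> * ((t - \<mu>) * (t - \<mu> - 1)) - (\<eta> - \<beta>) * (t * (t - 1)) - \<beta> * quad_weight"
    by (simp add: \<eta> algebra_simps)
  finally show ?thesis using cocoercivity_margin(2) by linarith
qed

text \<open>
  Co-coercivity of the residual along one step, multiplied by \<open>t (t - 1)\<close>, telescopes when the
  displacement \<open>X' - X\<close> is expressed through \<open>X - Z\<close> in its product with \<open>g\<close> and through \<open>X' - Z'\<close> in
  its product with \<open>g'\<close>. What remains are a nonnegative quadratic form and products with the
  error \<open>e\<close>; each product is absorbed by its own slack at the price of a multiple of
  \<open>t (t - 1) |e|\<^sup>2\<close>, and \<open>3 \<beta> / \<mu>\<close> bounds the sum of these prices.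
\<close>
lemma potential_step:
  fixes X Z g g' e :: "'a::real_inner"
  assumes \<eta>: "\<eta> = 2 * \<beta> * (t - 1) / (t - \<nu>)"
    and X': "X' = X - (1 / t) *\<^sub>R (X - Z) - \<eta> *\<^sub>R (g + e)"
    and Z': "Z' = Z - (\<nu> * \<eta>) *\<^sub>R (g + e)"
    and coco: "(g' - g) \<bullet> (X' - X) \<ge> \<beta>b * (norm (g' - g))\<^sup>2 + v"
    and coco0: "g \<bullet> X \<ge> \<beta>b * (norm g)\<^sup>2"
  shows "potential \<mu> \<beta> t X' Z' g' + t * (t - 1) * v
    \<le> potential \<mu> \<beta> (t - \<mu>) X Z g + 3 * \<beta> / \<mu> * (t * (t - 1)) * (norm e)\<^sup>2"
proof -
  define W where "W = t * (t - 1)"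
  define D where "D = X - Z"
  define h where "h = g + e"
  define \<delta> where "\<delta> = g' - g"
  have pos: "t > 1" "t - \<nu> > 0" "0 < \<nu>" "\<nu> < 1/3" "t - 1 > 5 * \<mu>" "W > 0" "\<eta> > 0"
    using \<mu> t \<nu> \<beta> by (auto simp: W_def \<eta>)
  have t\<eta>: "(t - \<nu>) * \<eta> = 2 * \<beta> * (t - 1)" using pos by (simp add: \<eta>)
  have D': "X' - Z' = (1 - 1 / t) *\<^sub>R D - ((1 - \<nu>) * \<eta>) *\<^sub>R h"
    by (simp add: X' Z' D_def h_def algebra_simps)
  \<comment> \<open>The displacement through the old gap \<open>D\<close> and through the new gap \<open>X' - Z'\<close>.\<close>
  have d1: "t *\<^sub>R (X' - X) = - D - (t * \<eta>) *\<^sub>R h"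
    using pos by (simp add: X' D_def h_def algebra_simps)
  have d2: "(t - 1) *\<^sub>R (X' - X) = - (X' - Z') - (2 * \<beta> * (t - 1)) *\<^sub>R h"
  proof -
    have "(t - 1) *\<^sub>R (X' - X) = - ((t - 1) * (1 / t)) *\<^sub>R D - ((t - 1) * \<eta>) *\<^sub>R h"
      by (simp add: X' D_def h_def algebra_simps)
    moreover have "(t - 1) * (1 / t) = 1 - 1 / t" using pos by (simp add: field_simps)
    moreover have "(t - 1) * \<eta> = 2 * \<beta> * (t - 1) - (1 - \<nu>) * \<eta>" using t\<eta> by (simp add: algebra_simps)
    moreover have "- a *\<^sub>R D - (b - c) *\<^sub>R h = - (a *\<^sub>R D - c *\<^sub>R h) - b *\<^sub>R h" for a b c
      by (simp add: algebra_simps)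
    ultimately show ?thesis by (simp only: D')
  qed
  have F1: "W * (\<delta> \<bullet> (X' - X)) = (t - 1) * (g \<bullet> D) + W * \<eta> * (g \<bullet> h) - t * (g' \<bullet> (X' - Z')) - 2 * \<beta> * W * (g' \<bullet> h)"
  proof -
    have "W * (g \<bullet> (X' - X)) = (t - 1) * (g \<bullet> (t *\<^sub>R (X' - X)))" by (simp add: W_def)
    also have "\<dots> = - (t - 1) * (g \<bullet> D) - W * \<eta> * (g \<bullet> h)"
      by (simp only: d1 W_def) (simp add: inner_diff_right algebra_simps)
    finally have 1: "W * (g \<bullet> (X' - X)) = - (t - 1) * (g \<bullet> D) - W * \<eta> * (g \<bullet> h)" .
    have "W * (g' \<bullet> (X' - X)) = t * (g' \<bullet> ((t - 1) *\<^sub>R (X' - X)))" by (simp add: W_def)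
    also have "\<dots> = - t * (g' \<bullet> (X' - Z')) - 2 * \<beta> * W * (g' \<bullet> h)"
      by (simp only: d2 W_def inner_diff_right inner_minus_right inner_scaleR_right) (simp add: algebra_simps)
    finally have 2: "W * (g' \<bullet> (X' - X)) = - t * (g' \<bullet> (X' - Z')) - 2 * \<beta> * W * (g' \<bullet> h)" .
    show ?thesis unfolding \<delta>_def inner_diff_left right_diff_distrib 1 2 by (simp add: algebra_simps)
  qed
  define eD where "eD = \<mu> * t * (t - \<nu>) / (4 * \<beta> * (1 - \<nu>) * (t - 1)\<^sup>2)"
  have F2: "eD * (norm (X' - Z'))\<^sup>2 = \<mu> * (t - \<nu>) / (4 * \<beta> * (1 - \<nu>) * t) * (norm D)\<^sup>2 - \<mu> * (D \<bullet> h)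
      + \<beta> * (\<mu> * (1 - \<nu>) * t / (t - \<nu>)) * (norm h)\<^sup>2"
  proof -
    define a where "a = 1 - 1 / t"
    define b where "b = (1 - \<nu>) * \<eta>"
    have a: "a = (t - 1) / t" using pos by (simp add: a_def field_simps)
    have "(norm (X' - Z'))\<^sup>2 = a\<^sup>2 * (norm D)\<^sup>2 - 2 * a * b * (D \<bullet> h) + b\<^sup>2 * (norm h)\<^sup>2"
      unfolding D' a_def[symmetric] b_def[symmetric] power2_norm_eq_inner
      by (simp add: inner_diff_left inner_diff_right inner_commute power2_eq_square algebra_simps)
    then have "eD * (norm (X' - Z'))\<^sup>2 = eD * (a\<^sup>2 * (norm D)\<^sup>2 - 2 * a * b * (D \<bullet> h) + b\<^sup>2 * (norm h)\<^sup>2)" by simp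
    then have "eD * (norm (X' - Z'))\<^sup>2 = eD * a\<^sup>2 * (norm D)\<^sup>2 - eD * (2 * a * b) * (D \<bullet> h) + eD * b\<^sup>2 * (norm h)\<^sup>2"
      by (simp add: algebra_simps)
    moreover have "eD * a\<^sup>2 = \<mu> * (t - \<nu>) / (4 * \<beta> * (1 - \<nu>) * t)"
      using pos by (simp add: eD_def a power_divide power2_eq_square)
    moreover have "eD * (2 * a * b) = \<mu>"
    proof -
      have "\<mu> * t * m / (4 * \<beta> * n * p\<^sup>2) * (2 * (p / t) * (n * (2 * \<beta> * p / m))) = \<mu>"
        if "m \<noteq> 0" "n \<noteq> 0" "p \<noteq> 0" for m n p
        using that pos \<beta> by (simp add: power2_eq_square)
      from this[of "t - \<nu>" "1 - \<nu>" "t - 1"] show ?thesis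
        using pos by (simp add: eD_def a b_def \<eta>)
    qed
    moreover have "eD * b\<^sup>2 = \<beta> * (\<mu> * (1 - \<nu>) * t / (t - \<nu>))"
      using pos \<beta> by (simp add: eD_def b_def \<eta> power2_eq_square)
    ultimately show ?thesis by simp
  qed
  define gZ where "gZ = (t - \<nu>) / (2 * \<beta> * \<mu> * (t - 1))"
  have F3: "gZ * (norm Z')\<^sup>2 = gZ * (norm Z)\<^sup>2 - Z \<bullet> h + \<beta> * (\<nu> * (t - 1) / (t - \<nu>)) * (norm h)\<^sup>2"
  proof -
    define b where "b = \<nu> * \<eta>"
    have "(norm Z')\<^sup>2 = (norm Z)\<^sup>2 - 2 * b * (Z \<bullet> h) + b\<^sup>2 * (norm h)\<^sup>2"
      unfolding Z' h_def[symmetric] b_def[symmetric] power2_norm_eq_inner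
      by (simp add: inner_diff_left inner_diff_right inner_commute power2_eq_square algebra_simps)
    then have "gZ * (norm Z')\<^sup>2 = gZ * ((norm Z)\<^sup>2 - 2 * b * (Z \<bullet> h) + b\<^sup>2 * (norm h)\<^sup>2)" by simp
    then have "gZ * (norm Z')\<^sup>2 = gZ * (norm Z)\<^sup>2 - gZ * (2 * b) * (Z \<bullet> h) + gZ * b\<^sup>2 * (norm h)\<^sup>2"
      by (simp add: algebra_simps)
    moreover have "gZ * (2 * b) = 1" using pos \<beta> \<mu> by (simp add: gZ_def b_def \<eta> \<nu>)
    moreover have "gZ * b\<^sup>2 = \<beta> * (\<nu> * (t - 1) / (t - \<nu>))"
    proof -
      have "m / (2 * \<beta> * \<mu> * p) * (\<nu> * (2 * \<beta> * p / m))\<^sup>2 = \<beta> * (\<nu> * p / m)" if "m \<noteq> 0" "p \<noteq> 0" for m p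
        using that \<beta> \<mu> by (simp add: \<nu> power2_eq_square)
      from this[of "t - \<nu>" "t - 1"] show ?thesis using pos by (simp add: gZ_def b_def \<eta>)
    qed
    ultimately show ?thesis by simp
  qed
  have F23: "eD * (norm (X' - Z'))\<^sup>2 + gZ * (norm Z')\<^sup>2 =
      \<mu> * (t - \<nu>) / (4 * \<beta> * (1 - \<nu>) * t) * (norm D)\<^sup>2 - \<mu> * (D \<bullet> h) + gZ * (norm Z)\<^sup>2 - Z \<bullet> h
      + \<beta> * quad_weight * (norm h)\<^sup>2"
    unfolding F2 F3 by (simp add: quad_weight_def add_divide_distrib distrib_left distrib_right)
  have P': "potential \<mu> \<beta> t X' Z' g' = t * (g' \<bullet> (X' - Z')) + \<beta> * W * (norm g')\<^sup>2
      + (eD * (norm (X' - Z'))\<^sup>2 + gZ * (norm Z')\<^sup>2)"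
    by (simp add: potential_def W_def eD_def gZ_def \<nu>)
  define eD0 where "eD0 = \<mu> * (t - \<mu>) * (t - \<mu> - \<nu>) / (4 * \<beta> * (1 - \<nu>) * (t - \<mu> - 1)\<^sup>2)"
  define gZ0 where "gZ0 = (t - \<mu> - \<nu>) / (2 * \<beta> * \<mu> * (t - \<mu> - 1))"
  define a0 where "a0 = (t - \<mu>) * (t - \<mu> - 1)"
  have P: "potential \<mu> \<beta> (t - \<mu>) X Z g = (t - \<mu>) * (g \<bullet> D) + \<beta> * a0 * (norm g)\<^sup>2
      + eD0 * (norm D)\<^sup>2 + gZ0 * (norm Z)\<^sup>2"
    by (simp add: potential_def a0_def eD0_def gZ0_def D_def \<nu>)
  define sD where "sD = eD0 - \<mu> * (t - \<nu>) / (4 * \<beta> * (1 - \<nu>) * t)"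
  define sZ where "sZ = gZ0 - gZ"
  define sG where "sG = \<beta>b + \<beta> * a0 - (\<eta> - \<beta>) * W - \<beta> * quad_weight"
  define c where "c = 2 * \<beta> * W - W * \<eta> - 2 * \<beta> * quad_weight"
  have YG: "sG * (norm g)\<^sup>2 + c * (g \<bullet> e) + 2 * \<beta> * W * (norm e)\<^sup>2 \<ge> 0"
  proof (rule young_absorb[of "\<beta> / 2"])
    show "\<beta> / 2 \<le> sG" using slack_residual[OF \<eta>] by (simp add: sG_def a0_def W_def)
    have "c\<^sup>2 \<le> (2 * \<beta> * (t - 1))\<^sup>2"
      using cross_weight[OF \<eta>] by (intro power_mono) (auto simp: c_def W_def)
    also have "\<dots> = 4 * \<beta>\<^sup>2 * ((t - 1) * (t - 1))" by (simp add: power2_eq_square)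
    also have "\<dots> \<le> 4 * \<beta>\<^sup>2 * W"
      unfolding W_def using pos by (intro mult_left_mono mult_right_mono) auto
    also have "\<dots> = 4 * (\<beta> / 2) * (2 * \<beta> * W)" by (simp add: power2_eq_square)
    finally show "c\<^sup>2 \<le> 4 * (\<beta> / 2) * (2 * \<beta> * W)" .
  qed (use \<beta> in simp)
  have YZ: "sZ * (norm Z)\<^sup>2 + 1 * (Z \<bullet> e) + 3 / 4 * \<beta> * W * (norm e)\<^sup>2 \<ge> 0"
    by (rule young_absorb[of "1 / (3 * \<beta> * W)"])
      (use slack_anchor pos \<beta> in \<open>auto simp: sZ_def gZ0_def gZ_def W_def\<close>)
  have YD: "sD * (norm D)\<^sup>2 + \<mu> * (D \<bullet> e) + \<mu> * \<beta> * (t - 1) / 2 * (norm e)\<^sup>2 \<ge> 0"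
    by (rule young_absorb[of "\<mu> / (2 * \<beta> * (t - 1))"])
      (use slack_gap pos \<beta> \<mu> in \<open>auto simp: sD_def eD0_def power2_eq_square\<close>)
  have Y\<delta>: "(\<beta>b - \<beta>) * (norm \<delta>)\<^sup>2 + 2 * \<beta> * (\<delta> \<bullet> e) + \<beta> * ((2 - \<mu>) / (2 * \<mu>)) * (norm e)\<^sup>2 \<ge> 0"
  proof (rule young_absorb[of "\<beta> * (2 * \<mu> / (2 - \<mu>))"])
    have "(2 + \<mu>) / (2 - \<mu>) = 1 + 2 * \<mu> / (2 - \<mu>)" using \<mu> by (simp add: field_simps)
    then show "\<beta> * (2 * \<mu> / (2 - \<mu>)) \<le> \<beta>b - \<beta>" using cocoercivity_margin(1) by (simp add: algebra_simps)
  qed (use \<beta> \<mu> in \<open>auto simp: power2_eq_square\<close>)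
  have Y\<delta>W: "W * ((\<beta>b - \<beta>) * (norm \<delta>)\<^sup>2 + 2 * \<beta> * (\<delta> \<bullet> e) + \<beta> * ((2 - \<mu>) / (2 * \<mu>)) * (norm e)\<^sup>2) \<ge> 0"
    using Y\<delta> pos by simp
  have cocoW: "W * (\<delta> \<bullet> (X' - X)) \<ge> W * (\<beta>b * (norm \<delta>)\<^sup>2 + v)"
    using coco pos by (simp add: \<delta>_def)
  have gX: "g \<bullet> X = g \<bullet> D + Z \<bullet> g" by (simp add: D_def inner_diff_right inner_commute)
  have hh: "(norm h)\<^sup>2 = (norm g)\<^sup>2 + 2 * (g \<bullet> e) + (norm e)\<^sup>2"
    unfolding h_def power2_norm_eq_inner by (simp add: inner_add_left inner_add_right inner_commute)
  have gg': "(norm g')\<^sup>2 = (norm g)\<^sup>2 + 2 * (\<delta> \<bullet> g) + (norm \<delta>)\<^sup>2"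
    unfolding \<delta>_def power2_norm_eq_inner by (simp add: inner_diff_left inner_diff_right inner_commute)
  have g'h: "g' \<bullet> h = (norm g)\<^sup>2 + g \<bullet> e + \<delta> \<bullet> g + \<delta> \<bullet> e"
    unfolding \<delta>_def h_def power2_norm_eq_inner by (simp add: inner_diff_left inner_diff_right inner_add_right inner_commute)
  have gh: "g \<bullet> h = (norm g)\<^sup>2 + g \<bullet> e" "D \<bullet> h = g \<bullet> D + D \<bullet> e" "Z \<bullet> h = Z \<bullet> g + Z \<bullet> e"
    unfolding h_def power2_norm_eq_inner by (simp_all add: inner_add_right inner_commute)
  have total: "W * \<beta> * ((2 - \<mu>) / (2 * \<mu>)) + \<mu> * \<beta> * (t - 1) / 2 + 3 / 4 * \<beta> * W + 2 * \<beta> * W + \<beta> * quad_weight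
     \<le> 3 * \<beta> / \<mu> * W"
  proof -
    have "\<mu> * (t - 1) \<le> \<mu> * W" using pos \<mu> by (simp add: W_def)
    then have "(2 - \<mu>) / (2 * \<mu>) * W + \<mu> * (t - 1) / 2 + 3 / 4 * W + 2 * W + quad_weight
       \<le> ((2 - \<mu>) / (2 * \<mu>) + \<mu> / 2 + 3 / 4 + 2 + 3 / 10) * W"
      using quad_weight_le(3) by (simp add: W_def[symmetric] distrib_right)
    also have "\<dots> \<le> 3 / \<mu> * W"
    proof (rule mult_right_mono)
      have "1 / \<mu> \<ge> 3 / 2" using \<mu> by (simp add: pos_le_divide_eq)
      moreover have "(2 - \<mu>) / (2 * \<mu>) = 1 / \<mu> - 1 / 2" using \<mu> by (simp add: diff_divide_distrib)
      moreover have "3 / \<mu> = 3 * (1 / \<mu>)" by simp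
      ultimately show "(2 - \<mu>) / (2 * \<mu>) + \<mu> / 2 + 3 / 4 + 2 + 3 / 10 \<le> 3 / \<mu>"
        using \<mu> by linarith
    qed (use pos in simp)
    finally have "\<beta> * ((2 - \<mu>) / (2 * \<mu>) * W + \<mu> * (t - 1) / 2 + 3 / 4 * W + 2 * W + quad_weight) \<le> \<beta> * (3 / \<mu> * W)"
      using \<beta>(1) by (intro mult_left_mono) auto
    moreover have "\<beta> * (p * W + \<mu> * (t - 1) / 2 + 3 / 4 * W + 2 * W + quad_weight)
        = W * \<beta> * p + \<mu> * \<beta> * (t - 1) / 2 + 3 / 4 * \<beta> * W + 2 * \<beta> * W + \<beta> * quad_weight" for p
      by (simp add: distrib_left mult_ac)
    moreover have "\<beta> * (3 / \<mu> * W) = 3 * \<beta> / \<mu> * W" by simp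
    ultimately show ?thesis by (simp only:)
  qed
  have totale: "(W * \<beta> * ((2 - \<mu>) / (2 * \<mu>)) + \<mu> * \<beta> * (t - 1) / 2 + 3 / 4 * \<beta> * W + 2 * \<beta> * W + \<beta> * quad_weight) * (norm e)\<^sup>2
     \<le> 3 * \<beta> / \<mu> * W * (norm e)\<^sup>2"
    by (rule mult_right_mono[OF total]) simp
  have step1: "potential \<mu> \<beta> (t - \<mu>) X Z g - potential \<mu> \<beta> t X' Z' g' - W * v
     = (W * (\<delta> \<bullet> (X' - X)) - W * (\<beta>b * (norm \<delta>)\<^sup>2 + v)) + (g \<bullet> X - \<beta>b * (norm g)\<^sup>2)
       + (sG * (norm g)\<^sup>2 + c * (g \<bullet> e) + 2 * \<beta> * W * (norm e)\<^sup>2)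
       + (sZ * (norm Z)\<^sup>2 + 1 * (Z \<bullet> e) + 3 / 4 * \<beta> * W * (norm e)\<^sup>2)
       + (sD * (norm D)\<^sup>2 + \<mu> * (D \<bullet> e) + \<mu> * \<beta> * (t - 1) / 2 * (norm e)\<^sup>2)
       + W * ((\<beta>b - \<beta>) * (norm \<delta>)\<^sup>2 + 2 * \<beta> * (\<delta> \<bullet> e) + \<beta> * ((2 - \<mu>) / (2 * \<mu>)) * (norm e)\<^sup>2)
       - (W * \<beta> * ((2 - \<mu>) / (2 * \<mu>)) + \<mu> * \<beta> * (t - 1) / 2 + 3 / 4 * \<beta> * W + 2 * \<beta> * W + \<beta> * quad_weight) * (norm e)\<^sup>2"
    unfolding P P' F23 F1 gX hh gg' g'h gh sG_def c_def sZ_def sD_def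
    by (simp add: algebra_simps)
  show ?thesis
    using step1 YG YZ YD Y\<delta>W cocoW totale coco0 unfolding W_def[symmetric] by linarith
qed

text \<open>
  Co-coercivity adds \<open>t g \<bullet> X\<close> to the term in \<open>t (t - 1) |g|\<^sup>2\<close>, completing it to \<open>\<beta> t\<^sup>2 |g|\<^sup>2\<close>.
  Young's inequality for \<open>g \<bullet> Z\<close> spends the weight of \<open>|Z|\<^sup>2\<close> and a fraction \<open>\<nu>\<close> of that.
\<close>
lemma potential_lower:
  fixes X Z g :: "'a::real_inner"
  assumes coco0: "g \<bullet> X \<ge> \<beta>b * (norm g)\<^sup>2"
  shows "\<beta> * (1 - \<nu>) * t\<^sup>2 * (norm g)\<^sup>2 \<le> potential \<mu> \<beta> t X Z g"
proof -
  have pos: "t > 1" "t - \<nu> > 0" "0 < \<nu>" "\<nu> < 1/3" using \<mu> t \<nu> by auto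
  let ?gZ = "(t - \<nu>) / (2 * \<beta> * \<mu> * (t - 1))"
  have Y: "?gZ * (norm Z)\<^sup>2 + (- t) * (Z \<bullet> g) + \<beta> * \<nu> * t\<^sup>2 * (norm g)\<^sup>2 \<ge> 0"
  proof (rule young_absorb[of ?gZ])
    have "1 \<le> (t - \<nu>) / (t - 1)" using pos by (simp add: pos_le_divide_eq)
    then have "t\<^sup>2 * 1 \<le> t\<^sup>2 * ((t - \<nu>) / (t - 1))" by (intro mult_left_mono) auto
    also have "\<dots> = 4 * ?gZ * (\<beta> * \<nu> * t\<^sup>2)"
    proof -
      have eq: "4 * (s / (2 * \<beta> * \<mu> * p)) * (\<beta> * \<nu> * q) = q * (s / p)" for s p q
        using \<beta> \<mu> by (simp add: \<nu>)
      show ?thesis by (rule eq[symmetric])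
    qed
    finally show "(- t)\<^sup>2 \<le> 4 * ?gZ * (\<beta> * \<nu> * t\<^sup>2)" by simp
  qed (use pos \<mu> \<beta> in auto)
  have "t * (g \<bullet> X) \<ge> t * (\<beta> * (norm g)\<^sup>2)"
  proof (rule mult_left_mono)
    have "\<beta> * (norm g)\<^sup>2 \<le> \<beta>b * (norm g)\<^sup>2" using cocoercivity_margin(3) by (rule mult_right_mono) simp
    then show "\<beta> * (norm g)\<^sup>2 \<le> g \<bullet> X" using coco0 by linarith
  qed (use pos in simp)
  moreover have "\<mu> * t * (t - \<nu>) / (4 * \<beta> * (1 - \<nu>) * (t - 1)\<^sup>2) * (norm (X - Z))\<^sup>2 \<ge> 0"
    using pos \<mu> \<beta> by (intro mult_nonneg_nonneg divide_nonneg_nonneg) auto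
  moreover have "potential \<mu> \<beta> t X Z g = t * (g \<bullet> X) - t * (Z \<bullet> g) + \<beta> * (t * (t - 1)) * (norm g)\<^sup>2
     + \<mu> * t * (t - \<nu>) / (4 * \<beta> * (1 - \<nu>) * (t - 1)\<^sup>2) * (norm (X - Z))\<^sup>2 + ?gZ * (norm Z)\<^sup>2"
    by (simp add: potential_def \<nu> inner_diff_right inner_commute right_diff_distrib)
  moreover have "\<beta> * (1 - \<nu>) * t\<^sup>2 * (norm g)\<^sup>2 = t * (\<beta> * (norm g)\<^sup>2) + \<beta> * (t * (t - 1)) * (norm g)\<^sup>2
      - \<beta> * \<nu> * t\<^sup>2 * (norm g)\<^sup>2"
    by (simp add: algebra_simps power2_eq_square)
  ultimately show ?thesis using Y by simp
qed

text \<open>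
  The potential starts with \<open>t - \<mu>\<close> in place of \<open>t\<close>; as \<open>t - 1 > 5 \<mu>\<close>, this changes the weight of
  \<open>|X|\<^sup>2\<close> by a factor of at most \<open>5/4\<close>.
\<close>
lemma potential_initial:
  fixes X g :: "'a::real_inner"
  shows "potential \<mu> \<beta> (t - \<mu>) X X g
    \<le> 5 / 4 * \<beta> * (t\<^sup>2 * (norm g)\<^sup>2 + (t - \<nu>) / (2 * \<beta>\<^sup>2 * \<mu> * (t - 1)) * (norm X)\<^sup>2)"
proof -
  have pos: "t > 1" "t - \<mu> > 1" "t - \<nu> > 0" "0 < \<nu>" "\<nu> < 1/3" "t - 1 > 5 * \<mu>" using \<mu> t \<nu> by auto
  have "(t - \<mu>) * (t - \<mu> - 1) \<le> t * t" using pos \<mu> by (intro mult_mono) auto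
  also have "t * t \<le> 5 / 4 * t\<^sup>2" by (simp add: power2_eq_square)
  finally have "(t - \<mu>) * (t - \<mu> - 1) \<le> 5 / 4 * t\<^sup>2" .
  then have 1: "\<beta> * ((t - \<mu>) * (t - \<mu> - 1)) * (norm g)\<^sup>2 \<le> \<beta> * (5 / 4 * t\<^sup>2) * (norm g)\<^sup>2"
    using \<beta> by (intro mult_right_mono mult_left_mono) auto
  have "(t - \<mu> - \<nu>) / (t - \<mu> - 1) \<le> (t - \<nu>) / (4 / 5 * (t - 1))"
    using pos \<mu> by (intro frac_le) auto
  moreover have "s / (4 / 5 * p) = 5 / 4 * (s / p)" for s p :: real by simp
  ultimately have "(t - \<mu> - \<nu>) / (t - \<mu> - 1) \<le> 5 / 4 * ((t - \<nu>) / (t - 1))" by (simp only:)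
  then have "(t - \<mu> - \<nu>) / (t - \<mu> - 1) / (2 * \<beta> * \<mu>) \<le> 5 / 4 * ((t - \<nu>) / (t - 1)) / (2 * \<beta> * \<mu>)"
    using \<beta> \<mu> by (intro divide_right_mono) auto
  then have "(t - \<mu> - \<nu>) / (2 * \<beta> * \<mu> * (t - \<mu> - 1)) \<le> 5 / 4 * \<beta> * ((t - \<nu>) / (2 * \<beta>\<^sup>2 * \<mu> * (t - 1)))"
    using \<beta> by (simp add: power2_eq_square mult_ac)
  then have "(t - \<mu> - \<nu>) / (2 * \<beta> * \<mu> * (t - \<mu> - 1)) * (norm X)\<^sup>2
      \<le> 5 / 4 * \<beta> * ((t - \<nu>) / (2 * \<beta>\<^sup>2 * \<mu> * (t - 1))) * (norm X)\<^sup>2"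
    by (rule mult_right_mono) simp
  moreover have "potential \<mu> \<beta> (t - \<mu>) X X g = \<beta> * ((t - \<mu>) * (t - \<mu> - 1)) * (norm g)\<^sup>2
      + (t - \<mu> - \<nu>) / (2 * \<beta> * \<mu> * (t - \<mu> - 1)) * (norm X)\<^sup>2"
    by (simp add: potential_def \<nu>)
  moreover have "5 / 4 * \<beta> * (q * G + p * N) = \<beta> * (5 / 4 * q) * G + 5 / 4 * \<beta> * p * N" for p q G N
    by (simp add: algebra_simps)
  ultimately show ?thesis using 1 by (simp only: add_mono)
qed

end

section \<open>Mean square distances and batch means\<close>

lemma weighted_norm_triangle:
  fixes a b :: "'a::real_inner"
  assumes "k > 0"
  shows "(norm (a + b))\<^sup>2 \<le> (1 + 1 / k) * (norm a)\<^sup>2 + (1 + k) * (norm b)\<^sup>2"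
proof -
  have "0 \<le> (1 / k) * (norm (a - k *\<^sub>R b))\<^sup>2" using assms by simp
  also have "\<dots> = (1 / k) * (norm a)\<^sup>2 - 2 * (a \<bullet> b) + k * (norm b)\<^sup>2"
    using assms unfolding power2_norm_eq_inner
    by (simp add: inner_diff_left inner_diff_right inner_commute field_simps)
  finally show ?thesis
    unfolding power2_norm_eq_inner
    by (simp add: inner_add_left inner_add_right inner_commute distrib_right)
qed

locale stochastic_map =
  fixes D :: "'x measure" and FF :: "'a::euclidean_space \<Rightarrow> 'x \<Rightarrow> 'a" and F :: "'a \<Rightarrow> 'a" and \<sigma> :: real
  assumes prob_D: "prob_space D"
    and sample_measurable: "(\<lambda>(x, \<xi>). FF x \<xi>) \<in> borel_measurable (borel \<Otimes>\<^sub>M D)"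
    and sample_integrable: "\<And>x. integrable D (FF x)"
    and sample_mean: "\<And>x. F x = (LINT \<xi>|D. FF x \<xi>)"
    and sample_square_integrable: "\<And>x. integrable D (\<lambda>\<xi>. (norm (FF x \<xi> - F x))\<^sup>2)"
    and sample_variance: "\<And>x. (LINT \<xi>|D. (norm (FF x \<xi> - F x))\<^sup>2) \<le> \<sigma>\<^sup>2"
begin

sublocale D: prob_space D by (rule prob_D)

lemma FF_pair_measurable [measurable]: "case_prod FF \<in> borel_measurable (borel \<Otimes>\<^sub>M D)"
  using sample_measurable by (simp add: case_prod_unfold)

lemma FF_measurable [measurable]: "FF x \<in> borel_measurable D"
  by measurable

lemma F_measurable [measurable]: "F \<in> borel_measurable borel"
  unfolding sample_mean[abs_def] by measurable

text \<open>
  The mean square distance of the samples at two points, a squared seminorm distance that dominates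
  \<open>|F x - F y|\<^sup>2\<close>. The variance of the estimator, and the extra term in the co-coercivity of the
  residual, are both measured by it.
\<close>
definition msd :: "'a \<Rightarrow> 'a \<Rightarrow> real" where
  "msd x y = (LINT \<xi>|D. (norm (FF x \<xi> - FF y \<xi>))\<^sup>2)"

lemma msd_compose [measurable (raw)]:
  assumes [measurable]: "f \<in> borel_measurable N" "g \<in> borel_measurable N"
  shows "(\<lambda>w. msd (f w) (g w)) \<in> borel_measurable N"
  unfolding msd_def by measurable

lemma difference_square_integrable: "integrable D (\<lambda>\<xi>. (norm (FF x \<xi> - FF y \<xi>))\<^sup>2)"
proof (rule Bochner_Integration.integrable_bound)
  show "integrable D (\<lambda>\<xi>. 4 * (norm (FF x \<xi> - F x))\<^sup>2 + 4 * (norm (FF y \<xi> - F y))\<^sup>2 + 4 * (norm (F x - F y))\<^sup>2)"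
    using sample_square_integrable by (intro Bochner_Integration.integrable_add integrable_mult_right) auto
  have "(norm (FF x \<xi> - FF y \<xi>))\<^sup>2 \<le> 4 * (norm (FF x \<xi> - F x))\<^sup>2 + 4 * (norm (FF y \<xi> - F y))\<^sup>2 + 4 * (norm (F x - F y))\<^sup>2" for \<xi>
  proof -
    let ?a = "FF x \<xi> - F x" and ?b = "F y - FF y \<xi>" and ?c = "F x - F y"
    have "(norm (?a + (?b + ?c)))\<^sup>2 \<le> 2 * (norm ?a)\<^sup>2 + 2 * (norm (?b + ?c))\<^sup>2"
      using weighted_norm_triangle[of 1 ?a "?b + ?c"] by simp
    moreover have "(norm (?b + ?c))\<^sup>2 \<le> 2 * (norm ?b)\<^sup>2 + 2 * (norm ?c)\<^sup>2"
      using weighted_norm_triangle[of 1 ?b ?c] by simp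
    moreover have "?a + (?b + ?c) = FF x \<xi> - FF y \<xi>" by simp
    moreover have "norm ?b = norm (FF y \<xi> - F y)" by (rule norm_minus_commute)
    ultimately show ?thesis using zero_le_power2[of "norm ?a"] by (simp only:)
  qed
  then show "AE \<xi> in D. norm ((norm (FF x \<xi> - FF y \<xi>))\<^sup>2) \<le> norm (4 * (norm (FF x \<xi> - F x))\<^sup>2 + 4 * (norm (FF y \<xi> - F y))\<^sup>2 + 4 * (norm (F x - F y))\<^sup>2)"
    by (auto intro!: AE_I2)
qed measurable

lemma msd_nonneg: "msd x y \<ge> 0"
  unfolding msd_def by (intro Bochner_Integration.integral_nonneg) simp

lemma msd_self [simp]: "msd x x = 0"
  by (simp add: msd_def)

lemma msd_triangle:
  assumes "k > 0"
  shows "msd x z \<le> (1 + 1 / k) * msd x y + (1 + k) * msd y z"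
proof -
  have "msd x z \<le> (LINT \<xi>|D. (1 + 1 / k) * (norm (FF x \<xi> - FF y \<xi>))\<^sup>2 + (1 + k) * (norm (FF y \<xi> - FF z \<xi>))\<^sup>2)"
    unfolding msd_def
  proof (rule integral_mono)
    fix \<xi>
    show "(norm (FF x \<xi> - FF z \<xi>))\<^sup>2 \<le> (1 + 1 / k) * (norm (FF x \<xi> - FF y \<xi>))\<^sup>2 + (1 + k) * (norm (FF y \<xi> - FF z \<xi>))\<^sup>2"
      using weighted_norm_triangle[OF assms, of "FF x \<xi> - FF y \<xi>" "FF y \<xi> - FF z \<xi>"] by simp
  qed (intro difference_square_integrable Bochner_Integration.integrable_add integrable_mult_right)+
  also have "\<dots> = (1 + 1 / k) * msd x y + (1 + k) * msd y z"
    unfolding msd_def using difference_square_integrable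
    by (subst Bochner_Integration.integral_add) (auto intro!: integrable_mult_right)
  finally show ?thesis .
qed

definition centred :: "'a \<times> 'a \<Rightarrow> 'x \<Rightarrow> 'a" where
  "centred q \<xi> = FF (fst q) \<xi> - FF (snd q) \<xi> - (F (fst q) - F (snd q))"

lemma centred_moments:
  shows "(LINT \<xi>|D. centred q \<xi>) = 0"
    and "integrable D (\<lambda>\<xi>. (norm (centred q \<xi>))\<^sup>2)"
    and "(LINT \<xi>|D. (norm (centred q \<xi>))\<^sup>2) = msd (fst q) (snd q) - (norm (F (fst q) - F (snd q)))\<^sup>2"
proof -
  let ?d = "\<lambda>\<xi>. FF (fst q) \<xi> - FF (snd q) \<xi>"
  let ?m = "F (fst q) - F (snd q)"
  have int: "integrable D ?d" using sample_integrable by (intro Bochner_Integration.integrable_diff)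
  have mean: "(LINT \<xi>|D. ?d \<xi>) = ?m" using sample_integrable by (simp add: sample_mean)
  show "(LINT \<xi>|D. centred q \<xi>) = 0"
    unfolding centred_def using int mean by (simp add: D.prob_space)
  have exp: "(norm (centred q \<xi>))\<^sup>2 = (norm (?d \<xi>))\<^sup>2 - 2 * (?d \<xi> \<bullet> ?m) + (norm ?m)\<^sup>2" for \<xi>
    unfolding centred_def power2_norm_eq_inner by (simp add: inner_diff_left inner_diff_right inner_commute)
  have i1: "integrable D (\<lambda>\<xi>. (norm (?d \<xi>))\<^sup>2)" by (rule difference_square_integrable)
  have i2: "integrable D (\<lambda>\<xi>. 2 * (?d \<xi> \<bullet> ?m))" using int by auto
  show "integrable D (\<lambda>\<xi>. (norm (centred q \<xi>))\<^sup>2)"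
    unfolding exp using i1 i2 by auto
  have "(LINT \<xi>|D. (norm (centred q \<xi>))\<^sup>2) = (LINT \<xi>|D. (norm (?d \<xi>))\<^sup>2) - (LINT \<xi>|D. 2 * (?d \<xi> \<bullet> ?m)) + (norm ?m)\<^sup>2"
    unfolding exp using i1 i2 by (simp add: D.prob_space)
  also have "(LINT \<xi>|D. 2 * (?d \<xi> \<bullet> ?m)) = 2 * ((LINT \<xi>|D. ?d \<xi>) \<bullet> ?m)"
    using integral_inner_left[OF int, of ?m] by simp
  finally show "(LINT \<xi>|D. (norm (centred q \<xi>))\<^sup>2) = msd (fst q) (snd q) - (norm ?m)\<^sup>2"
    unfolding mean msd_def by (simp add: power2_norm_eq_inner)
qed

lemma mean_difference_le_msd: "(norm (F x - F y))\<^sup>2 \<le> msd x y"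
proof -
  have "0 \<le> (LINT \<xi>|D. (norm (centred (x, y) \<xi>))\<^sup>2)" by (intro Bochner_Integration.integral_nonneg) simp
  then show ?thesis using centred_moments(3)[of "(x, y)"] by simp
qed

end

text \<open>
  The products of two different samples have mean zero, coordinate by coordinate, so the shifted
  batch mean has the variance of one sample divided by the batch size.
\<close>
lemma (in prob_space) batch_mean_second_moment:
  fixes s :: "nat \<Rightarrow> 'a \<Rightarrow> 'x" and h :: "'x \<Rightarrow> 'b::euclidean_space"
  assumes "prob_space D" and m: "m \<ge> 1"
    and law: "\<And>i. i < m \<Longrightarrow> s i \<in> measurable M D" "\<And>i. i < m \<Longrightarrow> distr M D (s i) = D"
    and indep: "\<And>i j. i < m \<Longrightarrow> j < m \<Longrightarrow> i \<noteq> j \<Longrightarrow> indep_var D (s i) D (s j)"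
    and h [measurable]: "h \<in> borel_measurable D" and h0: "(LINT \<xi>|D. h \<xi>) = 0"
    and h2: "integrable D (\<lambda>\<xi>. (norm (h \<xi>))\<^sup>2)"
  shows "integrable M (\<lambda>w. (norm (u + batch_mean h m (\<lambda>i. s i w)))\<^sup>2)"
    and "(LINT w|M. (norm (u + batch_mean h m (\<lambda>i. s i w)))\<^sup>2)
      = (norm u)\<^sup>2 + (1 / real m) * (LINT \<xi>|D. (norm (h \<xi>))\<^sup>2)"
proof -
  interpret D: prob_space D by fact
  have h1: "integrable D h"
  proof (rule Bochner_Integration.integrable_bound)
    show "integrable D (\<lambda>\<xi>. 1 + (norm (h \<xi>))\<^sup>2)" using h2 by simp
    have "norm (h \<xi>) \<le> 1 + (norm (h \<xi>))\<^sup>2" for \<xi>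
    proof -
      have "2 * norm (h \<xi>) \<le> 1 + (norm (h \<xi>))\<^sup>2"
        using zero_le_power2[of "norm (h \<xi>) - 1"] by (simp add: power2_diff)
      then show ?thesis using norm_ge_zero[of "h \<xi>"] by linarith
    qed
    then show "AE \<xi> in D. norm (h \<xi>) \<le> norm (1 + (norm (h \<xi>))\<^sup>2)" by (auto intro!: AE_I2)
  qed measurable
  have transfer: "integrable M (\<lambda>w. f (s i w))" "(LINT w|M. f (s i w)) = (LINT \<xi>|D. f \<xi>)"
    if "i < m" "integrable D f" for i and f :: "'x \<Rightarrow> 'c::{banach, second_countable_topology}"
  proof -
    have f: "f \<in> borel_measurable D" using that(2) by (rule borel_measurable_integrable)
    show "integrable M (\<lambda>w. f (s i w))"
      using integrable_distr[OF law(1)[OF that(1)], of f] that by (simp add: law(2))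
    show "(LINT w|M. f (s i w)) = (LINT \<xi>|D. f \<xi>)"
      using integral_distr[OF law(1)[OF that(1)] f] by (simp add: law(2) that)
  qed
  have cross: "integrable M (\<lambda>w. h (s i w) \<bullet> h (s j w)) \<and>
      (LINT w|M. h (s i w) \<bullet> h (s j w)) = (if i = j then LINT \<xi>|D. (norm (h \<xi>))\<^sup>2 else 0)"
    if ij: "i < m" "j < m" for i j
  proof (cases "i = j")
    case True
    then show ?thesis using transfer[OF ij(1) h2] by (simp add: power2_norm_eq_inner)
  next
    case False
    have comp: "integrable M (\<lambda>w. (h (s i w) \<bullet> e) * (h (s j w) \<bullet> e))"
      "(LINT w|M. (h (s i w) \<bullet> e) * (h (s j w) \<bullet> e)) = 0" for e
    proof -
      have ind: "indep_var borel ((\<lambda>\<xi>. h \<xi> \<bullet> e) \<circ> s i) borel ((\<lambda>\<xi>. h \<xi> \<bullet> e) \<circ> s j)"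
        by (rule indep_var_compose[OF indep[OF ij False]]) measurable
      have he: "integrable D (\<lambda>\<xi>. h \<xi> \<bullet> e)" using h1 by simp
      have he0: "(LINT \<xi>|D. h \<xi> \<bullet> e) = 0" using integral_inner_left[OF h1, of e] h0 by simp
      note ind' = ind[unfolded comp_def]
      show "integrable M (\<lambda>w. (h (s i w) \<bullet> e) * (h (s j w) \<bullet> e))"
        by (rule indep_var_integrable[OF ind']) (use transfer(1)[OF _ he] ij in auto)
      show "(LINT w|M. (h (s i w) \<bullet> e) * (h (s j w) \<bullet> e)) = 0"
        by (subst indep_var_lebesgue_integral[OF ind']) (use transfer[OF _ he] ij he0 in auto)
    qed
    have eq: "h (s i w) \<bullet> h (s j w) = (\<Sum>e\<in>Basis. (h (s i w) \<bullet> e) * (h (s j w) \<bullet> e))" for w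
      by (rule euclidean_inner)
    show ?thesis unfolding eq using comp False by simp
  qed
  have lin: "integrable M (\<lambda>w. u \<bullet> h (s i w))" "(LINT w|M. u \<bullet> h (s i w)) = 0" if "i < m" for i
  proof -
    have he: "integrable D (\<lambda>\<xi>. u \<bullet> h \<xi>)" using h1 by simp
    have he0: "(LINT \<xi>|D. u \<bullet> h \<xi>) = 0" using integral_inner_right[OF h1, of u] h0 by simp
    show "integrable M (\<lambda>w. u \<bullet> h (s i w))" "(LINT w|M. u \<bullet> h (s i w)) = 0"
      using transfer[OF that he] he0 by auto
  qed
  define c where "c = 1 / real m"
  have expand: "(norm (u + batch_mean h m (\<lambda>i. s i w)))\<^sup>2 =
      (norm u)\<^sup>2 + 2 * c * (\<Sum>i<m. u \<bullet> h (s i w)) + c\<^sup>2 * (\<Sum>i<m. \<Sum>j<m. h (s i w) \<bullet> h (s j w))" for w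
    unfolding batch_mean_def power2_norm_eq_inner c_def[symmetric]
    by (simp add: inner_add_left inner_add_right inner_commute inner_sum_left inner_sum_right power2_eq_square
        algebra_simps sum_distrib_left)
  have i1: "integrable M (\<lambda>w. 2 * c * (\<Sum>i<m. u \<bullet> h (s i w)))"
    using lin by (intro integrable_mult_right Bochner_Integration.integrable_sum) auto
  have i2: "integrable M (\<lambda>w. c\<^sup>2 * (\<Sum>i<m. \<Sum>j<m. h (s i w) \<bullet> h (s j w)))"
    using cross by (intro integrable_mult_right Bochner_Integration.integrable_sum) auto
  show "integrable M (\<lambda>w. (norm (u + batch_mean h m (\<lambda>i. s i w)))\<^sup>2)"
    unfolding expand using i1 i2 by (intro Bochner_Integration.integrable_add) auto
  have "(LINT w|M. (norm (u + batch_mean h m (\<lambda>i. s i w)))\<^sup>2) = (norm u)\<^sup>2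
      + (LINT w|M. 2 * c * (\<Sum>i<m. u \<bullet> h (s i w))) + (LINT w|M. c\<^sup>2 * (\<Sum>i<m. \<Sum>j<m. h (s i w) \<bullet> h (s j w)))"
    unfolding expand using i1 i2 by (simp add: prob_space)
  also have "(LINT w|M. 2 * c * (\<Sum>i<m. u \<bullet> h (s i w))) = 0"
    using lin by (simp add: Bochner_Integration.integral_sum)
  also have "(LINT w|M. c\<^sup>2 * (\<Sum>i<m. \<Sum>j<m. h (s i w) \<bullet> h (s j w)))
      = c\<^sup>2 * (\<Sum>i<m. \<Sum>j<m. if i = j then LINT \<xi>|D. (norm (h \<xi>))\<^sup>2 else 0)"
  proof -
    have "(LINT w|M. (\<Sum>i<m. \<Sum>j<m. h (s i w) \<bullet> h (s j w))) = (\<Sum>i<m. LINT w|M. (\<Sum>j<m. h (s i w) \<bullet> h (s j w)))"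
      using cross by (intro Bochner_Integration.integral_sum Bochner_Integration.integrable_sum) auto
    also have "\<dots> = (\<Sum>i<m. \<Sum>j<m. LINT w|M. h (s i w) \<bullet> h (s j w))"
      using cross by (intro sum.cong Bochner_Integration.integral_sum) auto
    also have "\<dots> = (\<Sum>i<m. \<Sum>j<m. if i = j then LINT \<xi>|D. (norm (h \<xi>))\<^sup>2 else 0)"
      using cross by (intro sum.cong) auto
    finally show ?thesis by simp
  qed
  also have "(\<Sum>i<m. \<Sum>j<m. if i = j then LINT \<xi>|D. (norm (h \<xi>))\<^sup>2 else 0) = real m * (LINT \<xi>|D. (norm (h \<xi>))\<^sup>2)"
    by simp
  also have "c\<^sup>2 * (real m * (LINT \<xi>|D. (norm (h \<xi>))\<^sup>2)) = (1 / real m) * (LINT \<xi>|D. (norm (h \<xi>))\<^sup>2)"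
    using m by (simp add: c_def power2_eq_square)
  finally show "(LINT w|M. (norm (u + batch_mean h m (\<lambda>i. s i w)))\<^sup>2)
      = (norm u)\<^sup>2 + (1 / real m) * (LINT \<xi>|D. (norm (h \<xi>))\<^sup>2)" by simp
qed

section \<open>Independence of the draws\<close>

text \<open>
  The \<open>\<sigma>\<close>-algebra of the events decided by the draws in \<open>I\<close>, as a measure so that
  measurability with respect to it can be stated.
\<close>
definition generated :: "'w measure \<Rightarrow> 'x measure \<Rightarrow> (nat \<Rightarrow> 'w \<Rightarrow> bool) \<Rightarrow> (nat \<Rightarrow> nat \<Rightarrow> 'w \<Rightarrow> 'x)
    \<Rightarrow> (nat \<Rightarrow> nat \<Rightarrow> 'w \<Rightarrow> 'x) \<Rightarrow> draw set \<Rightarrow> 'w measure" where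
  "generated M D c s S I = sigma (space M) (\<Union>d\<in>I. draw_events M D c s S d)"

lemma Int_stable_preimages: "Int_stable {X -` A \<inter> \<Omega> | A. A \<in> sets N}"
proof (rule Int_stableI)
  fix a b assume "a \<in> {X -` A \<inter> \<Omega> | A. A \<in> sets N}" "b \<in> {X -` A \<inter> \<Omega> | A. A \<in> sets N}"
  then obtain A B where "a = X -` A \<inter> \<Omega>" "b = X -` B \<inter> \<Omega>" "A \<in> sets N" "B \<in> sets N" by blast
  then show "a \<inter> b \<in> {X -` A \<inter> \<Omega> | A. A \<in> sets N}"
    by (intro CollectI exI[of _ "A \<inter> B"]) auto
qed

text \<open>
  Independence is stated by the product rule for events, because \<open>indep_var\<close> would force \<open>X\<close> and \<open>Y\<close>
  to have the same value type.
\<close>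
lemma (in prob_space) nn_integral_product_law:
  assumes X [measurable]: "X \<in> measurable M N1" and Y [measurable]: "Y \<in> measurable M N2"
    and product: "\<And>A B. A \<in> sets N1 \<Longrightarrow> B \<in> sets N2 \<Longrightarrow>
      prob ((X -` A \<inter> space M) \<inter> (Y -` B \<inter> space M)) = prob (X -` A \<inter> space M) * prob (Y -` B \<inter> space M)"
    and g: "g \<in> borel_measurable (N1 \<Otimes>\<^sub>M N2)"
  shows "(\<integral>\<^sup>+w. g (X w, Y w) \<partial>M) = (\<integral>\<^sup>+w. (\<integral>\<^sup>+w'. g (X w, Y w') \<partial>M) \<partial>M)"
proof -
  interpret X: prob_space "distr M N1 X" by (rule prob_space_distr) (rule X)
  interpret Y: prob_space "distr M N2 Y" by (rule prob_space_distr) (rule Y)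
  have law: "distr M N1 X \<Otimes>\<^sub>M distr M N2 Y = distr M (N1 \<Otimes>\<^sub>M N2) (\<lambda>w. (X w, Y w))"
  proof (rule pair_measure_eqI)
    show "sigma_finite_measure (distr M N1 X)" "sigma_finite_measure (distr M N2 Y)" by unfold_locales
    fix A B assume "A \<in> sets (distr M N1 X)" "B \<in> sets (distr M N2 Y)"
    then have AB: "A \<in> sets N1" "B \<in> sets N2" by auto
    have "(\<lambda>w. (X w, Y w)) -` (A \<times> B) \<inter> space M = (X -` A \<inter> space M) \<inter> (Y -` B \<inter> space M)" by auto
    then show "emeasure (distr M N1 X) A * emeasure (distr M N2 Y) B
        = emeasure (distr M (N1 \<Otimes>\<^sub>M N2) (\<lambda>w. (X w, Y w))) (A \<times> B)"
      using AB product[OF AB] by (simp add: emeasure_distr emeasure_eq_measure ennreal_mult)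
  qed (simp cong: sets_pair_measure_cong)
  have g': "g \<in> borel_measurable (distr M N1 X \<Otimes>\<^sub>M distr M N2 Y)"
    using g by (simp cong: measurable_cong_sets)
  have "(\<integral>\<^sup>+w. g (X w, Y w) \<partial>M) = (\<integral>\<^sup>+q. g q \<partial>distr M (N1 \<Otimes>\<^sub>M N2) (\<lambda>w. (X w, Y w)))"
    using g by (subst nn_integral_distr) auto
  also have "\<dots> = (\<integral>\<^sup>+x. (\<integral>\<^sup>+y. g (x, y) \<partial>distr M N2 Y) \<partial>distr M N1 X)"
    unfolding law[symmetric] using Y.nn_integral_fst[OF g'] by simp
  also have "\<dots> = (\<integral>\<^sup>+w. (\<integral>\<^sup>+y. g (X w, y) \<partial>distr M N2 Y) \<partial>M)"
  proof -
    have "(\<lambda>x. \<integral>\<^sup>+ y. g (x, y) \<partial>distr M N2 Y) \<in> borel_measurable (distr M N1 X)"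
      using Y.borel_measurable_nn_integral_fst[OF g'] .
    from nn_integral_distr[OF X this] show ?thesis .
  qed
  also have "\<dots> = (\<integral>\<^sup>+w. (\<integral>\<^sup>+w'. g (X w, Y w') \<partial>M) \<partial>M)"
  proof (rule nn_integral_cong)
    fix w assume "w \<in> space M"
    then have "(\<lambda>y. g (X w, y)) \<in> borel_measurable N2"
      using g measurable_space[OF X] by (auto intro: measurable_compose[OF measurable_Pair1'])
    then show "(\<integral>\<^sup>+y. g (X w, y) \<partial>distr M N2 Y) = (\<integral>\<^sup>+w'. g (X w, Y w') \<partial>M)"
      by (intro nn_integral_distr[OF Y]) simp
  qed
  finally show ?thesis .
qed

locale sampling =
  fixes M :: "'w measure" and D :: "'x measure" and p :: "nat \<Rightarrow> real" and b n :: "nat \<Rightarrow> nat"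
    and c :: "nat \<Rightarrow> 'w \<Rightarrow> bool" and s S :: "nat \<Rightarrow> nat \<Rightarrow> 'w \<Rightarrow> 'x"
  assumes sampling: "lsvrg_sampling M D p b n c s S"
begin

sublocale prob_space M using sampling by (simp add: lsvrg_sampling_def)

abbreviation "\<G> \<equiv> generated M D c s S"

definition draws :: "draw set" where
  "draws = {Refresh k | k. k \<ge> 1} \<union> {Mini k i | k i. i < b k} \<union> {Mega k j | k j. j < n k}"

lemma coin: "k \<ge> 1 \<Longrightarrow> c k \<in> measurable M (count_space UNIV)" "k \<ge> 1 \<Longrightarrow> prob {w \<in> space M. c k w} = p k"
  using sampling unfolding lsvrg_sampling_def by blast+

lemma mini: "i < b k \<Longrightarrow> s k i \<in> measurable M D" "i < b k \<Longrightarrow> distr M D (s k i) = D"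
  using sampling unfolding lsvrg_sampling_def by blast+

lemma mega: "j < n k \<Longrightarrow> S k j \<in> measurable M D" "j < n k \<Longrightarrow> distr M D (S k j) = D"
  using sampling unfolding lsvrg_sampling_def by blast+

lemma indep_draws: "indep_sets (draw_events M D c s S) draws"
  using sampling by (simp add: lsvrg_sampling_def draws_def)

lemma draw_events_subset: "d \<in> draws \<Longrightarrow> draw_events M D c s S d \<subseteq> sets M"
  using indep_draws by (auto simp: indep_sets_def)

lemma draw_events_space: "draw_events M D c s S d \<subseteq> Pow (space M)"
  by (cases d) auto

lemma space_generated [simp]: "space (\<G> I) = space M"
  by (simp add: generated_def space_measure_of_conv)

lemma sets_generated: "sets (\<G> I) = sigma_sets (space M) (\<Union>d\<in>I. draw_events M D c s S d)"
  unfolding generated_def using draw_events_space by (intro sets_measure_of) blast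

lemma generated_mono:
  assumes "I \<subseteq> J" "f \<in> measurable (\<G> I) N" shows "f \<in> measurable (\<G> J) N"
proof -
  have "sets (\<G> I) \<subseteq> sets (\<G> J)"
    unfolding sets_generated using assms(1) by (intro sigma_sets_mono') auto
  then show ?thesis using assms(2) by (auto simp: measurable_def)
qed

lemma generated_measurable:
  assumes "I \<subseteq> draws" "f \<in> measurable (\<G> I) N" shows "f \<in> measurable M N"
proof -
  have "sets (\<G> I) \<subseteq> sets M"
    unfolding sets_generated using assms(1) draw_events_subset by (intro sets.sigma_sets_subset) blast
  then show ?thesis using assms(2) by (auto simp: measurable_def)
qed

lemma draw_event_generated: "d \<in> I \<Longrightarrow> A \<in> draw_events M D c s S d \<Longrightarrow> A \<in> sets (\<G> I)"
  unfolding sets_generated by (auto intro: sigma_sets.Basic)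

lemma coin_generated: "Refresh k \<in> I \<Longrightarrow> c k \<in> measurable (\<G> I) (count_space UNIV)"
proof (rule measurableI)
  fix A assume "Refresh k \<in> I"
  moreover have "c k -` A \<inter> space M \<in> draw_events M D c s S (Refresh k)" by (simp, blast)
  ultimately show "c k -` A \<inter> space (\<G> I) \<in> sets (\<G> I)" by (simp only: space_generated draw_event_generated)
qed simp

lemma mini_generated: "Mini k i \<in> I \<Longrightarrow> i < b k \<Longrightarrow> s k i \<in> measurable (\<G> I) D"
proof (rule measurableI)
  fix A assume "Mini k i \<in> I" and A: "A \<in> sets D"
  moreover have "s k i -` A \<inter> space M \<in> draw_events M D c s S (Mini k i)" using A by (simp, blast)
  ultimately show "s k i -` A \<inter> space (\<G> I) \<in> sets (\<G> I)" by (simp only: space_generated draw_event_generated)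
qed (use measurable_space[OF mini(1)] in simp)

lemma mega_generated: "Mega k i \<in> I \<Longrightarrow> i < n k \<Longrightarrow> S k i \<in> measurable (\<G> I) D"
proof (rule measurableI)
  fix A assume "Mega k i \<in> I" and A: "A \<in> sets D"
  moreover have "S k i -` A \<inter> space M \<in> draw_events M D c s S (Mega k i)" using A by (simp, blast)
  ultimately show "S k i -` A \<inter> space (\<G> I) \<in> sets (\<G> I)" by (simp only: space_generated draw_event_generated)
qed (use measurable_space[OF mega(1)] in simp)

text \<open>
  Everything random in the algorithm is a function of draws; this is the single place where
  their mutual independence enters.
\<close>
lemma indep_set_generated:
  assumes "I \<subseteq> draws" "J \<subseteq> draws" "I \<inter> J = {}"
  shows "indep_set (sets (\<G> I)) (sets (\<G> J))"
proof -
  let ?E = "draw_events M D c s S"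
  let ?\<sigma> = "\<lambda>I. sigma_sets (space M) (\<Union>d\<in>I. ?E d)"
  have "indep_sets (\<lambda>j. sigma_sets (space M) (\<Union>i\<in>case_bool I J j. ?E i)) UNIV"
  proof (rule indep_sets_collect_sigma)
    have "(\<Union>j. case_bool I J j) = I \<union> J" by (auto simp: UNIV_bool)
    then show "indep_sets ?E (\<Union>j. case_bool I J j)"
      using indep_sets_mono_index[OF _ indep_draws] assms(1,2) by simp
    show "Int_stable (?E d)" for d
      by (cases d) (simp_all only: draw_events.simps Int_stable_preimages)
    show "disjoint_family (case_bool I J)"
      using assms(3) by (auto simp: disjoint_family_on_def split: bool.split)
  qed
  moreover have "(\<lambda>j. sigma_sets (space M) (\<Union>i\<in>case_bool I J j. ?E i))
      = case_bool (sets (\<G> I)) (sets (\<G> J))"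
    by (rule ext) (simp add: sets_generated split: bool.split)
  ultimately show ?thesis unfolding indep_set_def by simp
qed

lemma indep_generated:
  assumes "I \<subseteq> draws" "J \<subseteq> draws" "I \<inter> J = {}"
    and X: "X \<in> measurable (\<G> I) N1" and Y: "Y \<in> measurable (\<G> J) N2"
  shows "indep_var N1 X N2 Y"
proof -
  have sub: "sigma_sets (space M) {Z -` A \<inter> space M | A. A \<in> sets N} \<subseteq> sets (\<G> K)"
    if "Z \<in> measurable (\<G> K) N" for Z N K
  proof -
    have "{Z -` A \<inter> space M | A. A \<in> sets N} \<subseteq> sets (\<G> K)"
      using measurable_sets[OF that] by auto
    then show ?thesis
      using sets.sigma_sets_subset[of "{Z -` A \<inter> space M | A. A \<in> sets N}" "\<G> K"] by simp
  qed
  show ?thesis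
    unfolding indep_var_eq
  proof (intro conjI)
    show "random_variable N1 X" "random_variable N2 Y"
      using generated_measurable assms by blast+
    show "indep_set (sigma_sets (space M) {X -` A \<inter> space M |A. A \<in> sets N1})
        (sigma_sets (space M) {Y -` A \<inter> space M |A. A \<in> sets N2})"
      using indep_set_generated[OF assms(1-3)] sub[OF X] sub[OF Y] unfolding indep_set_def
      by (elim indep_sets_mono_sets) (auto split: bool.split)
  qed
qed

lemma nn_integral_generated:
  assumes IJ: "I \<subseteq> draws" "J \<subseteq> draws" "I \<inter> J = {}"
    and X: "X \<in> measurable (\<G> I) N1" and Y: "Y \<in> measurable (\<G> J) N2"
    and g: "g \<in> borel_measurable (N1 \<Otimes>\<^sub>M N2)"
  shows "(\<integral>\<^sup>+w. g (X w, Y w) \<partial>M) = (\<integral>\<^sup>+w. (\<integral>\<^sup>+w'. g (X w, Y w') \<partial>M) \<partial>M)"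
proof (rule nn_integral_product_law[OF _ _ _ g])
  show Xm: "X \<in> measurable M N1" using generated_measurable[OF IJ(1) X] .
  show Ym: "Y \<in> measurable M N2" using generated_measurable[OF IJ(2) Y] .
  fix A B assume "A \<in> sets N1" "B \<in> sets N2"
  then show "prob ((X -` A \<inter> space M) \<inter> (Y -` B \<inter> space M)) = prob (X -` A \<inter> space M) * prob (Y -` B \<inter> space M)"
    using measurable_sets[OF X] measurable_sets[OF Y]
    by (intro indep_setD[OF indep_set_generated[OF IJ]]) auto
qed

text \<open>
  A coin is independent of every \<open>R\<close> computed without it, so a refresh scales the expectation of \<open>R\<close>.
\<close>
lemma coin_expectation:
  fixes R :: "'w \<Rightarrow> real"
  assumes "k \<ge> 1" "J \<subseteq> draws" "Refresh k \<notin> J" "R \<in> borel_measurable (\<G> J)" "integrable M R"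
  shows "integrable M (\<lambda>w. if c k w then R w else 0)"
    and "(LINT w|M. (if c k w then R w else 0)) = p k * (LINT w|M. R w)"
    and "integrable M (\<lambda>w. if c k w then 0 else R w)"
    and "(LINT w|M. (if c k w then 0 else R w)) = (1 - p k) * (LINT w|M. R w)"
proof -
  let ?i = "\<lambda>w. if c k w then 1 else 0 :: real"
  have ci: "?i \<in> borel_measurable (\<G> {Refresh k})"
    by (rule measurable_compose[OF coin_generated[of k], where g = "\<lambda>x. if x then 1 else 0"]) simp_all
  have dk: "{Refresh k} \<subseteq> draws" using assms(1) by (auto simp: draws_def)
  have ind: "indep_var borel ?i borel R"
    by (rule indep_generated[OF dk assms(2) _ ci assms(4)]) (use assms(3) in auto)
  have i_int: "integrable M ?i"
    by (rule integrable_const_bound[of _ 1]) (use generated_measurable[OF dk ci] in auto)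
  have "(LINT w|M. ?i w) = (LINT w|M. indicator {w \<in> space M. c k w} w)"
    by (intro Bochner_Integration.integral_cong) (simp_all add: indicator_def)
  also have "\<dots> = p k"
    unfolding coin(2)[OF assms(1), symmetric] by (simp add: Int_absorb2)
  finally have i_exp: "(LINT w|M. ?i w) = p k" .
  have eq: "(if c k w then R w else 0) = ?i w * R w" for w by simp
  show 1: "integrable M (\<lambda>w. if c k w then R w else 0)"
    unfolding eq by (rule indep_var_integrable[OF ind i_int assms(5)])
  show 2: "(LINT w|M. (if c k w then R w else 0)) = p k * (LINT w|M. R w)"
    unfolding eq using indep_var_lebesgue_integral[OF ind i_int assms(5)] i_exp by simp
  have eq': "(if c k w then 0 else R w) = R w - (if c k w then R w else 0)" for w by simp
  show "integrable M (\<lambda>w. if c k w then 0 else R w)"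
    unfolding eq' using 1 assms(5) by simp
  show "(LINT w|M. (if c k w then 0 else R w)) = (1 - p k) * (LINT w|M. R w)"
    unfolding eq' using 1 2 assms(5) by (simp add: left_diff_distrib)
qed

text \<open>
  A batch that is independent of the shift \<open>u\<close> and of the parameter \<open>a\<close>: by Fubini these can be frozen
  while the batch is averaged, so no cross term appears. The mini-batch is used with \<open>u\<close> the
  error of the stored mega-batch mean, the mega-batch with \<open>u = 0\<close>.
\<close>
lemma fresh_batch_second_moment:
  fixes u :: "'w \<Rightarrow> 'v::euclidean_space" and a :: "'w \<Rightarrow> 'q::second_countable_topology"
    and h :: "'q \<Rightarrow> 'x \<Rightarrow> 'v"
  assumes prob_D: "prob_space D" and m: "m \<ge> 1"
    and law: "\<And>i. i < m \<Longrightarrow> Y i \<in> measurable M D" "\<And>i. i < m \<Longrightarrow> distr M D (Y i) = D"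
    and dY: "\<And>i. i < m \<Longrightarrow> d i \<in> draws" "inj_on d {..<m}" "\<And>i. i < m \<Longrightarrow> Y i \<in> measurable (\<G> {d i}) D"
    and I: "I \<subseteq> draws" "\<And>i. i < m \<Longrightarrow> d i \<notin> I"
    and u: "u \<in> borel_measurable (\<G> I)" and a: "a \<in> borel_measurable (\<G> I)"
    and h [measurable]: "case_prod h \<in> borel_measurable (borel \<Otimes>\<^sub>M D)"
    and h0: "\<And>q. (LINT \<xi>|D. h q \<xi>) = 0" and h2: "\<And>q. integrable D (\<lambda>\<xi>. (norm (h q \<xi>))\<^sup>2)"
    and B: "\<And>w. w \<in> space M \<Longrightarrow> (LINT \<xi>|D. (norm (h (a w) \<xi>))\<^sup>2) \<le> B w"
    and ui: "integrable M (\<lambda>w. (norm (u w))\<^sup>2)" and Bi: "integrable M B"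
  shows "integrable M (\<lambda>w. (norm (u w + batch_mean (h (a w)) m (\<lambda>i. Y i w)))\<^sup>2)"
    and "(LINT w|M. (norm (u w + batch_mean (h (a w)) m (\<lambda>i. Y i w)))\<^sup>2)
       \<le> (LINT w|M. (norm (u w))\<^sup>2) + (1 / real m) * (LINT w|M. B w)"
proof -
  interpret D: prob_space D by (rule prob_D)
  let ?P = "Pi\<^sub>M {..<m} (\<lambda>_. D)"
  define Z where "Z w = (\<lambda>i\<in>{..<m}. Y i w)" for w
  define g where "g = (\<lambda>(x::'v \<times> 'q, y). ennreal ((norm (fst x + (1 / real m) *\<^sub>R (\<Sum>i<m. h (snd x) (y i))))\<^sup>2))"
  have g [measurable]: "g \<in> borel_measurable ((borel \<Otimes>\<^sub>M borel) \<Otimes>\<^sub>M ?P)"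
    unfolding g_def case_prod_unfold by measurable
  have Z: "Z \<in> measurable (\<G> (d ` {..<m})) ?P"
    unfolding Z_def
  proof (rule measurable_restrict)
    fix i assume "i \<in> {..<m}"
    then show "Y i \<in> measurable (\<G> (d ` {..<m})) D" by (intro generated_mono[OF _ dY(3)]) auto
  qed
  have X: "(\<lambda>w. (u w, a w)) \<in> measurable (\<G> I) (borel \<Otimes>\<^sub>M borel)"
    using u a by measurable
  have fub: "(\<integral>\<^sup>+w. g ((u w, a w), Z w) \<partial>M) = (\<integral>\<^sup>+w. (\<integral>\<^sup>+w'. g ((u w, a w), Z w') \<partial>M) \<partial>M)"
    by (rule nn_integral_generated[OF I(1) _ _ X Z g]) (use dY(1) I(2) in auto)
  have um [measurable]: "u \<in> borel_measurable M" and am [measurable]: "a \<in> borel_measurable M"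
    using generated_measurable[OF I(1)] u a by auto
  have Ym: "Y i \<in> measurable M D" if "i < m" for i using law(1)[OF that] .
  have gZ: "g ((v, q), Z w) = ennreal ((norm (v + batch_mean (h q) m (\<lambda>i. Y i w)))\<^sup>2)" for v q w
    by (simp add: g_def Z_def batch_mean_def)
  have inner: "(\<integral>\<^sup>+w'. g ((v, q), Z w') \<partial>M)
      = ennreal ((norm v)\<^sup>2 + (1 / real m) * (LINT \<xi>|D. (norm (h q \<xi>))\<^sup>2))" for v q
  proof -
    have hq: "h q \<in> borel_measurable D" using measurable_Pair2[OF h, of q] by simp
    have pair: "indep_var D (Y i) D (Y j)" if "i < m" "j < m" "i \<noteq> j" for i j
      using dY that by (intro indep_generated[of "{d i}" "{d j}"]) (auto dest: inj_onD)
    note sm = batch_mean_second_moment[OF prob_D m law pair hq h0 h2, where u = v]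
    show ?thesis unfolding gZ
      by (subst nn_integral_eq_integral[OF sm(1)]) (simp_all add: sm(2))
  qed
  have meas: "(\<lambda>w. (norm (u w + batch_mean (h (a w)) m (\<lambda>i. Y i w)))\<^sup>2) \<in> borel_measurable M"
    unfolding batch_mean_def using Ym by measurable
  have B0: "B w \<ge> 0" if "w \<in> space M" for w
    using B[OF that] by (rule order_trans[rotated]) (intro Bochner_Integration.integral_nonneg, simp)
  have "(\<integral>\<^sup>+w. ennreal ((norm (u w + batch_mean (h (a w)) m (\<lambda>i. Y i w)))\<^sup>2) \<partial>M)
      = (\<integral>\<^sup>+w. ennreal ((norm (u w))\<^sup>2 + (1 / real m) * (LINT \<xi>|D. (norm (h (a w) \<xi>))\<^sup>2)) \<partial>M)"
    using fub unfolding inner unfolding gZ .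
  also have "\<dots> \<le> (\<integral>\<^sup>+w. ennreal ((norm (u w))\<^sup>2 + (1 / real m) * B w) \<partial>M)"
    using B by (intro nn_integral_mono ennreal_leI add_left_mono mult_left_mono) auto
  also have "\<dots> = ennreal ((LINT w|M. (norm (u w))\<^sup>2) + (1 / real m) * (LINT w|M. B w))"
  proof (subst nn_integral_eq_integral)
    show "AE w in M. 0 \<le> (norm (u w))\<^sup>2 + (1 / real m) * B w"
      using B0 by (auto intro!: AE_I2)
  qed (use ui Bi in auto)
  finally have le: "(\<integral>\<^sup>+w. ennreal ((norm (u w + batch_mean (h (a w)) m (\<lambda>i. Y i w)))\<^sup>2) \<partial>M)
      \<le> ennreal ((LINT w|M. (norm (u w))\<^sup>2) + (1 / real m) * (LINT w|M. B w))" .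
  show int: "integrable M (\<lambda>w. (norm (u w + batch_mean (h (a w)) m (\<lambda>i. Y i w)))\<^sup>2)"
    using le_less_trans[OF le ennreal_less_top] by (intro integrableI_bounded[OF meas]) simp
  have "0 \<le> (LINT w|M. B w)" using B0 by (intro integral_nonneg_AE AE_I2)
  then show "(LINT w|M. (norm (u w + batch_mean (h (a w)) m (\<lambda>i. Y i w)))\<^sup>2)
       \<le> (LINT w|M. (norm (u w))\<^sup>2) + (1 / real m) * (LINT w|M. B w)"
    using le unfolding nn_integral_eq_integral[OF int AE_I2[OF zero_le_power2]]
    by (subst (asm) ennreal_le_iff) (auto intro!: add_nonneg_nonneg Bochner_Integration.integral_nonneg)
qed

end

section \<open>Estimation error along the iteration\<close>

text \<open>
  One run of the algorithm at accuracy \<open>\<epsilon>\<close>, with constant batch sizes \<open>nb\<close> and \<open>nn\<close>. The bound on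
  \<open>nb\<close> asks for half of the prescribed size, to leave room for the rounding.
\<close>
locale vfosa_run =
  stochastic_map D FF F \<sigma> + sampling M D p b n c s S
  for D :: "'x measure" and FF :: "'a::euclidean_space \<Rightarrow> 'x \<Rightarrow> 'a" and F \<sigma>
    and M :: "'w measure" and p b n c s S +
  fixes T :: "'a \<Rightarrow> 'a set" and x0 xs :: 'a and \<rho> L Lh lam \<mu> \<beta> \<beta>b r \<epsilon> :: real
    and nb nn :: nat and x z :: "nat \<Rightarrow> 'w \<Rightarrow> 'a" and t \<eta> :: "nat \<Rightarrow> real"
  assumes \<rho>: "\<rho> \<ge> 0" and T: "maximally_co_hypomonotone \<rho> T"
    and L: "L > 0" "Lh > L" "Lh * \<rho> < 1"
    and coercive: "\<And>x y. (F x - F y) \<bullet> (x - y) \<ge> (1 / L) * msd x y"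
    and zero: "xs \<in> op_zer (op_sum F T)"
    and lam: "lam > 0" "2 * \<rho> \<le> lam"
    and \<beta>b: "\<beta>b = (lam * (4 - Lh * lam) - 4 * \<rho>) / (4 * (1 - \<rho> * Lh))"
    and \<mu>: "0 < \<mu>" "\<mu> < 2 / 3" and \<beta>: "0 < \<beta>" "\<beta> \<le> (2 - \<mu>) * \<beta>b / (2 + \<mu>)"
    and r: "r > 5 + 1 / \<mu>" and \<epsilon>: "\<epsilon> > 0"
    and t: "\<And>k. t k = \<mu> * (real k + r)"
    and \<eta>: "\<And>k. \<eta> k = 2 * \<beta> * (t k - 1) / (t k - \<mu> / 2)"
    and p: "\<And>k. p (Suc k) = 2 * \<epsilon> + 4 * \<mu> / (t k - 1)"
    and b: "\<And>k. b k = nb" "nb \<ge> 1" "real nb \<ge> 5 * \<beta> / (\<mu> * ((Lh - L) / (L * Lh))) / \<epsilon>\<^sup>2"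
    and n: "\<And>k. n k = nn" "nn \<ge> 1"
    and run: "\<And>w. w \<in> space M \<Longrightarrow> vfosa_plus lam T t \<eta> (\<mu> / 2) x0
               (lsvrg_estimator FF b n (\<lambda>k. c k w) (\<lambda>k i. s k i w) (\<lambda>k j. S k j w) (\<lambda>k. x k w))
               (\<lambda>k. x k w) (\<lambda>k. z k w)"
begin

abbreviation "snap k w \<equiv> snapshot (\<lambda>k. c k w) (\<lambda>k. x k w) k"
abbreviation "stored k w \<equiv> snapshot_mean FF n (\<lambda>k. c k w) (\<lambda>k j. S k j w) (\<lambda>k. x k w) k"
abbreviation "est k w \<equiv> lsvrg_estimator FF b n (\<lambda>k. c k w) (\<lambda>k i. s k i w) (\<lambda>k j. S k j w) (\<lambda>k. x k w) k"
abbreviation "G \<equiv> fb_residual lam F T"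
abbreviation "Gt k w \<equiv> fb_residual_at lam T (est k w) (x k w)"
text \<open>
  The weight of the co-coercivity inequality of step \<open>k\<close> in the summation.
\<close>
definition W :: "nat \<Rightarrow> real" where "W k = t k * (t k - 1)"
abbreviation "\<Lambda> \<equiv> (Lh - L) / (L * Lh)"
abbreviation "err k w \<equiv> (norm (est k w - F (x k w)))\<^sup>2"
abbreviation "drift k w \<equiv> msd (x k w) (snap k w)"
abbreviation "move k w \<equiv> msd (x (Suc k) w) (x k w)"
abbreviation "anchor k w \<equiv> (norm (stored k w - F (snap k w)))\<^sup>2"

lemma initial: "w \<in> space M \<Longrightarrow> x 0 w = x0" "w \<in> space M \<Longrightarrow> z 0 w = x0"
  using run by (auto simp: vfosa_plus_def)

lemma iterate:
  assumes "w \<in> space M"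
  shows "x (Suc k) w = x k w - (1 / t k) *\<^sub>R (x k w - z k w) - \<eta> k *\<^sub>R Gt k w"
    and "z (Suc k) w = z k w - (\<mu> / 2 * \<eta> k) *\<^sub>R Gt k w"
proof -
  have "t k \<noteq> 0" using \<mu> r unfolding t by (smt (verit) divide_pos_pos mult_pos_pos of_nat_0_le_iff)
  define y where "y = ((t k - 1) / t k) *\<^sub>R x k w + (1 / t k) *\<^sub>R z k w"
  have y: "y = x k w - (1 / t k) *\<^sub>R (x k w - z k w)"
    using \<open>t k \<noteq> 0\<close> by (simp add: y_def diff_divide_distrib algebra_simps)
  have "x (Suc k) w = y - \<eta> k *\<^sub>R Gt k w" "z (Suc k) w = z k w + (\<mu> / 2) *\<^sub>R (x (Suc k) w - y)"
    using run[OF assms] unfolding vfosa_plus_def Let_def y_def by blast+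
  then show "x (Suc k) w = x k w - (1 / t k) *\<^sub>R (x k w - z k w) - \<eta> k *\<^sub>R Gt k w"
    "z (Suc k) w = z k w - (\<mu> / 2 * \<eta> k) *\<^sub>R Gt k w"
    by (simp_all add: y)
qed

lemma t_large: "t k > 1 + 5 * \<mu>"
proof -
  have "\<mu> * r > \<mu> * (5 + 1 / \<mu>)" using r \<mu> by simp
  also have "\<mu> * (5 + 1 / \<mu>) = 1 + 5 * \<mu>" using \<mu> by (simp add: distrib_left)
  finally show ?thesis using \<mu> unfolding t distrib_left by (simp add: add_strict_increasing2)
qed

lemma t_Suc: "t (Suc k) = t k + \<mu>"
  by (simp add: t algebra_simps)

lemma W_pos: "W k > 0"
  using t_large[of k] \<mu> by (simp add: W_def)

lemma W_nonneg: "W k \<ge> 0"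
  using W_pos less_imp_le by blast

lemma \<Lambda>_pos: "\<Lambda> > 0"
  using L by simp

lemma msd_coercive: "(F u - F v) \<bullet> (u - v) \<ge> msd u v / L"
  using coercive[of u v] by simp

lemma G_cocoercive:
  "(G u - G v) \<bullet> (u - v) \<ge> \<beta>b * (norm (G u - G v))\<^sup>2 + \<Lambda> * msd u v"
  unfolding \<beta>b by (rule fb_residual_cocoercive[OF T \<rho> lam L mean_difference_le_msd msd_coercive])

lemma G_xs: "G xs = 0"
  by (rule fb_residual_zero[OF T \<rho> lam zero])

text \<open>
  The draws made before step \<open>k\<close>, which determine \<open>x\<^sup>k\<close> and \<open>z\<^sup>k\<close>; \<open>present\<close> adds the coin and the
  mega-batch of step \<open>k\<close>, which determine the snapshot and its stored mean, and leaves out the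
  mini-batch of step \<open>k\<close>, which is therefore independent of all these.
\<close>
definition past :: "nat \<Rightarrow> draw set" where
  "past k = {d \<in> draws. case d of Refresh j \<Rightarrow> j < k | Mini j i \<Rightarrow> j < k | Mega j i \<Rightarrow> j < k}"

definition present :: "nat \<Rightarrow> draw set" where
  "present k = {d \<in> draws. case d of Refresh j \<Rightarrow> j \<le> k | Mini j i \<Rightarrow> j < k | Mega j i \<Rightarrow> j \<le> k}"

lemma stages: "past k \<subseteq> present k" "present k \<subseteq> past (Suc k)" "past k \<subseteq> draws" "present k \<subseteq> draws"
  by (auto simp: past_def present_def split: draw.splits)

lemma draws_mem: "Refresh (Suc k) \<in> draws" "i < b k \<Longrightarrow> Mini k i \<in> draws" "i < n k \<Longrightarrow> Mega k i \<in> draws"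
  by (auto simp: draws_def)

lemma fb_residual_at_measurable:
  assumes "f \<in> borel_measurable N" "g \<in> borel_measurable N"
  shows "(\<lambda>w. fb_residual_at lam T (f w) (g w)) \<in> borel_measurable N"
proof -
  have [measurable]: "resolvent lam T \<in> borel_measurable borel"
    by (rule resolvent_measurable[OF T \<rho> lam])
  note assms[measurable]
  show ?thesis unfolding fb_residual_at_def by measurable
qed

lemma G_measurable [measurable]: "G \<in> borel_measurable borel"
  unfolding fb_residual_def by (rule fb_residual_at_measurable) measurable

lemma batch_measurable:
  assumes f: "f \<in> borel_measurable N" and g: "g \<in> borel_measurable N"
    and Y: "\<And>i. i < m \<Longrightarrow> Y i \<in> measurable N D"
  shows "(\<lambda>w. batch_mean (FF (f w)) m (\<lambda>i. Y i w)) \<in> borel_measurable N"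
    and "(\<lambda>w. batch_mean (\<lambda>\<xi>. FF (f w) \<xi> - FF (g w) \<xi>) m (\<lambda>i. Y i w)) \<in> borel_measurable N"
proof -
  note f [measurable] g [measurable]
  have 1 [measurable]: "(\<lambda>w. FF (f w) (Y i w)) \<in> borel_measurable N" if "i < m" for i
    using Y[OF that] by measurable
  have 2 [measurable]: "(\<lambda>w. FF (g w) (Y i w)) \<in> borel_measurable N" if "i < m" for i
    using Y[OF that] by measurable
  show "(\<lambda>w. batch_mean (FF (f w)) m (\<lambda>i. Y i w)) \<in> borel_measurable N"
    "(\<lambda>w. batch_mean (\<lambda>\<xi>. FF (f w) \<xi> - FF (g w) \<xi>) m (\<lambda>i. Y i w)) \<in> borel_measurable N"
    unfolding batch_mean_def using 1 2 by measurable
qed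

lemma iterates_adapted:
  "x k \<in> borel_measurable (\<G> (past k)) \<and> z k \<in> borel_measurable (\<G> (past k))
   \<and> snap k \<in> borel_measurable (\<G> (present k)) \<and> stored k \<in> borel_measurable (\<G> (present k))"
proof (induction k)
  case 0
  have const: "f \<in> borel_measurable (\<G> I)" if "\<And>w. w \<in> space M \<Longrightarrow> f w = x0" for f I
    using measurable_cong[of "\<G> I" f "\<lambda>_. x0" borel] that by simp
  have S0: "S 0 j \<in> measurable (\<G> (present 0)) D" if "j < n 0" for j
    by (rule mega_generated) (use that draws_mem in \<open>auto simp: present_def\<close>)
  have "stored 0 \<in> borel_measurable (\<G> (present 0))"
    using batch_measurable(1)[OF const const S0, of "x 0" "x 0" "n 0"] initial by simp
  then show ?case using const initial by simp
next
  case (Suc k)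
  let ?I = "past (Suc k)" and ?J = "present (Suc k)"
  have xk: "x k \<in> borel_measurable (\<G> ?I)" "z k \<in> borel_measurable (\<G> ?I)"
    "snap k \<in> borel_measurable (\<G> ?I)" "stored k \<in> borel_measurable (\<G> ?I)"
    using Suc generated_mono stages by blast+
  have sk: "s k i \<in> measurable (\<G> ?I) D" if "i < b k" for i
    by (rule mini_generated) (use that draws_mem in \<open>auto simp: past_def\<close>)
  have ek: "est k \<in> borel_measurable (\<G> ?I)"
    unfolding lsvrg_estimator_def
    using batch_measurable(2)[OF xk(1) xk(3) sk, of "b k"] xk(4) by measurable
  note Gk = fb_residual_at_measurable[OF ek xk(1)]
  have "(\<lambda>w. x k w - (1 / t k) *\<^sub>R (x k w - z k w) - \<eta> k *\<^sub>R Gt k w) \<in> borel_measurable (\<G> ?I)"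
    "(\<lambda>w. z k w - (\<mu> / 2 * \<eta> k) *\<^sub>R Gt k w) \<in> borel_measurable (\<G> ?I)"
    using Gk xk(1,2) by measurable
  then have xS: "x (Suc k) \<in> borel_measurable (\<G> ?I)" and zS: "z (Suc k) \<in> borel_measurable (\<G> ?I)"
    using measurable_cong[of "\<G> ?I" "x (Suc k)" "\<lambda>w. x k w - (1 / t k) *\<^sub>R (x k w - z k w) - \<eta> k *\<^sub>R Gt k w" borel]
      measurable_cong[of "\<G> ?I" "z (Suc k)" "\<lambda>w. z k w - (\<mu> / 2 * \<eta> k) *\<^sub>R Gt k w" borel]
    by (simp_all add: iterate)
  have J: "f \<in> borel_measurable (\<G> ?J)" if "f \<in> borel_measurable (\<G> ?I)" for f :: "'w \<Rightarrow> 'a"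
    using that generated_mono stages by blast
  have cS [measurable]: "c (Suc k) \<in> measurable (\<G> ?J) (count_space UNIV)"
    by (rule coin_generated) (use draws_mem in \<open>auto simp: present_def\<close>)
  have SS: "S (Suc k) j \<in> measurable (\<G> ?J) D" if "j < n (Suc k)" for j
    by (rule mega_generated) (use that draws_mem in \<open>auto simp: present_def\<close>)
  note [measurable] = J[OF xk(1)] J[OF xk(3)] J[OF xk(4)]
  have snapS: "snap (Suc k) \<in> borel_measurable (\<G> ?J)" by simp measurable
  have "stored (Suc k) \<in> borel_measurable (\<G> ?J)"
    unfolding snapshot_mean.simps
    by (rule measurable_If[OF batch_measurable(1)[OF snapS snapS SS] J[OF xk(4)] predE[OF cS]])
  with xS zS snapS show ?case by blast
qed

lemma x_adapted: "x k \<in> borel_measurable (\<G> (past k))" using iterates_adapted by blast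
lemma x_present: "x k \<in> borel_measurable (\<G> (present k))"
  using generated_mono[OF stages(1) x_adapted] .
lemma snap_adapted: "snap k \<in> borel_measurable (\<G> (present k))" using iterates_adapted by blast
lemma stored_adapted: "stored k \<in> borel_measurable (\<G> (present k))" using iterates_adapted by blast

lemma present_past: "f \<in> measurable (\<G> (present k)) N \<Longrightarrow> f \<in> measurable (\<G> (past (Suc k))) N"
  using generated_mono[OF stages(2)] .

lemma process_measurable [measurable]:
  "x k \<in> borel_measurable M" "snap k \<in> borel_measurable M" "stored k \<in> borel_measurable M"
  using x_adapted snap_adapted stored_adapted generated_measurable stages by blast+

lemma p_bounds: "0 < p (Suc k)" "p (Suc k) \<le> 1"
proof -
  have "4 * \<mu> / (t k - 1) > 0" using \<mu> t_large[of k] by simp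
  then show "0 < p (Suc k)" using \<epsilon> by (simp add: p)
  show "p (Suc k) \<le> 1" using coin(2)[of "Suc k"] prob_le_1[of "{w \<in> space M. c (Suc k) w}"] by simp
qed

lemma mega_noise:
  assumes I: "I \<subseteq> draws" "\<And>j. Mega k j \<notin> I" and a: "a \<in> borel_measurable (\<G> I)"
  shows "integrable M (\<lambda>w. (norm (batch_mean (FF (a w)) (n k) (\<lambda>j. S k j w) - F (a w)))\<^sup>2)"
    and "(LINT w|M. (norm (batch_mean (FF (a w)) (n k) (\<lambda>j. S k j w) - F (a w)))\<^sup>2) \<le> \<sigma>\<^sup>2 / nn"
proof -
  have m: "n k \<ge> 1" using n by simp
  have eq: "batch_mean (FF q) (n k) y - F q = 0 + batch_mean (\<lambda>\<xi>. FF q \<xi> - F q) (n k) y" for q y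
    using m by (simp add: batch_mean_def sum_subtractf scaleR_diff_right sum_constant_scaleR)
  have h: "case_prod (\<lambda>q \<xi>. FF q \<xi> - F q) \<in> borel_measurable (borel \<Otimes>\<^sub>M D)" by measurable
  have h0: "(LINT \<xi>|D. FF q \<xi> - F q) = 0" for q
    using sample_integrable by (simp add: D.prob_space sample_mean)
  have inj: "inj_on (Mega k) {..<n k}" by (simp add: inj_on_def)
  have gen: "S k i \<in> measurable (\<G> {Mega k i}) D" if "i < n k" for i
    using mega_generated that by simp
  note B = fresh_batch_second_moment[where u = "\<lambda>_. 0::'a" and a = a and I = I and d = "Mega k"
      and Y = "S k" and m = "n k" and h = "\<lambda>q \<xi>. FF q \<xi> - F q" and B = "\<lambda>_. \<sigma>\<^sup>2",
      OF prob_D m mega(1) mega(2) draws_mem(3) inj gen I(1) I(2) _ a h h0 sample_square_integrable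
         sample_variance]
  show "integrable M (\<lambda>w. (norm (batch_mean (FF (a w)) (n k) (\<lambda>j. S k j w) - F (a w)))\<^sup>2)"
    unfolding eq using B(1) by simp
  show "(LINT w|M. (norm (batch_mean (FF (a w)) (n k) (\<lambda>j. S k j w) - F (a w)))\<^sup>2) \<le> \<sigma>\<^sup>2 / nn"
    unfolding eq using B(2) by (simp add: prob_space n)
qed

text \<open>
  The stored mean is not fresh: between refreshes it is correlated with the iterates. Its error
  is bounded nevertheless, since at every step it is either replaced by a fresh
  error of variance at most \<open>\<sigma>\<^sup>2 / nn\<close> or kept, and the coin that decides is independent of both.
\<close>
lemma anchor_noise: "integrable M (anchor k) \<and> (LINT w|M. anchor k w) \<le> \<sigma>\<^sup>2 / nn"
proof (induction k)
  case 0
  show ?case using mega_noise[OF stages(3) _ x_adapted, of 0 0] by (simp add: past_def)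
next
  case (Suc k)
  let ?R = "\<lambda>w. (norm (batch_mean (FF (x k w)) (n (Suc k)) (\<lambda>j. S (Suc k) j w) - F (x k w)))\<^sup>2"
  let ?J = "past (Suc k) \<union> Mega (Suc k) ` {..<n (Suc k)}"
  have J: "?J \<subseteq> draws" "Refresh (Suc k) \<notin> ?J"
    using stages(3) draws_mem(3) by (auto simp: past_def)
  have xJ [measurable]: "x k \<in> borel_measurable (\<G> ?J)"
    using present_past[OF x_present] by (rule generated_mono[rotated]) simp
  have SJ: "S (Suc k) j \<in> measurable (\<G> ?J) D" if "j < n (Suc k)" for j
    by (rule mega_generated) (use that in auto)
  have RJ: "?R \<in> borel_measurable (\<G> ?J)"
    using batch_measurable(1)[OF xJ xJ SJ, of "n (Suc k)"] by measurable
  have R: "integrable M ?R" "(LINT w|M. ?R w) \<le> \<sigma>\<^sup>2 / nn"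
    using mega_noise[OF stages(3) _ present_past[OF x_present], of "Suc k" k] by (simp_all add: past_def)
  have A [measurable]: "anchor k \<in> borel_measurable (\<G> (past (Suc k)))"
    using present_past[OF snap_adapted] present_past[OF stored_adapted] by measurable
  have k1: "1 \<le> Suc k" by simp
  have nA: "Refresh (Suc k) \<notin> past (Suc k)" by (simp add: past_def)
  note cR = coin_expectation(1,2)[OF k1 J RJ R(1)]
  note cA = coin_expectation(3,4)[OF k1 stages(3) nA A conjunct1[OF Suc]]
  have eq: "anchor (Suc k) = (\<lambda>w. (if c (Suc k) w then ?R w else 0) + (if c (Suc k) w then 0 else anchor k w))"
    by auto
  have "p (Suc k) * (LINT w|M. ?R w) + (1 - p (Suc k)) * (LINT w|M. anchor k w)
     \<le> p (Suc k) * (\<sigma>\<^sup>2 / nn) + (1 - p (Suc k)) * (\<sigma>\<^sup>2 / nn)"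
    using R Suc p_bounds[of k] by (intro add_mono mult_left_mono) auto
  then have le: "p (Suc k) * (LINT w|M. ?R w) + (1 - p (Suc k)) * (LINT w|M. anchor k w) \<le> \<sigma>\<^sup>2 / nn"
    unfolding distrib_right[symmetric] by simp
  show ?case
    unfolding eq using cR cA le by (subst Bochner_Integration.integral_add) auto
qed

text \<open>
  The mini-batch correction is centred given the iterate, the snapshot and the stored mean, so
  the two sources of error add in mean square.
\<close>
lemma err_bound:
  assumes "integrable M (drift k)"
  shows "integrable M (err k) \<and> (LINT w|M. err k w) \<le> \<sigma>\<^sup>2 / nn + (LINT w|M. drift k w) / nb"
proof -
  have m: "b k \<ge> 1" using b by simp
  let ?a = "\<lambda>w. (x k w, snap k w)"
  let ?u = "\<lambda>w. stored k w - F (snap k w)"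
  have eq: "est k w - F (x k w) = ?u w + batch_mean (centred (?a w)) (b k) (\<lambda>i. s k i w)" for w
    using m by (simp add: lsvrg_estimator_def batch_mean_def centred_def[abs_def] sum_subtractf
        scaleR_diff_right sum_constant_scaleR)
  note [measurable] = x_present[of k] snap_adapted[of k] stored_adapted[of k]
  have a: "?a \<in> borel_measurable (\<G> (present k))" by measurable
  have u: "?u \<in> borel_measurable (\<G> (present k))" by measurable
  have h: "case_prod centred \<in> borel_measurable (borel \<Otimes>\<^sub>M D)"
    unfolding centred_def[abs_def] by (simp add: borel_prod[symmetric]) measurable
  have inj: "inj_on (Mini k) {..<b k}" by (simp add: inj_on_def)
  have gen: "s k i \<in> measurable (\<G> {Mini k i}) D" if "i < b k" for i
    using mini_generated that by simp
  have H: "(LINT \<xi>|D. (norm (centred (?a w) \<xi>))\<^sup>2) \<le> drift k w" for w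
    by (simp add: centred_moments(3))
  have notI: "Mini k i \<notin> present k" for i by (simp add: present_def)
  note B = fresh_batch_second_moment[where u = ?u and a = ?a and I = "present k" and d = "Mini k"
      and Y = "s k" and m = "b k" and h = centred and B = "drift k",
      OF prob_D m mini(1) mini(2) draws_mem(2) inj gen stages(4) notI u a h centred_moments(1,2)
         H conjunct1[OF anchor_noise] assms]
  show ?thesis
    unfolding eq using B anchor_noise[of k] by (auto simp: b)
qed

text \<open>
  The distance to the snapshot contracts: after a refresh it is a single move, otherwise the weighted
  triangle inequality with parameter \<open>p / 2\<close> turns the factor \<open>1 - p\<close> into
  \<open>1 - p / 2\<close>.
\<close>
lemma drift_step:
  assumes "integrable M (drift k)" "integrable M (move k)"
  shows "integrable M (drift (Suc k)) \<and> (LINT w|M. drift (Suc k) w)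
     \<le> (1 - p (Suc k) / 2) * (LINT w|M. drift k w) + 2 / p (Suc k) * (LINT w|M. move k w)"
proof -
  define q where "q = p (Suc k)"
  have q: "0 < q" "q \<le> 1" using p_bounds by (simp_all add: q_def)
  let ?V = "\<lambda>w. msd (x (Suc k) w) (snap k w)"
  note [measurable] = x_adapted[of "Suc k"] present_past[OF x_present[of k]] present_past[OF snap_adapted[of k]]
  have tri: "?V w \<le> (1 + 2 / q) * move k w + (1 + q / 2) * drift k w" for w
    using msd_triangle[of "q / 2" "x (Suc k) w" "snap k w" "x k w"] q by simp
  have Vi: "integrable M ?V"
  proof (rule Bochner_Integration.integrable_bound)
    show "integrable M (\<lambda>w. (1 + 2 / q) * move k w + (1 + q / 2) * drift k w)" using assms by auto
    show "AE w in M. norm (?V w) \<le> norm ((1 + 2 / q) * move k w + (1 + q / 2) * drift k w)"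
      using msd_nonneg by (auto intro!: AE_I2 order_trans[OF tri abs_ge_self])
  qed measurable
  have k1: "1 \<le> Suc k" by simp
  have nA: "Refresh (Suc k) \<notin> past (Suc k)" by (simp add: past_def)
  have mm: "move k \<in> borel_measurable (\<G> (past (Suc k)))" "?V \<in> borel_measurable (\<G> (past (Suc k)))"
    by measurable
  note cM = coin_expectation(1,2)[OF k1 stages(3) nA mm(1) assms(2), folded q_def]
  note cV = coin_expectation(3,4)[OF k1 stages(3) nA mm(2) Vi, folded q_def]
  have eq: "drift (Suc k) = (\<lambda>w. (if c (Suc k) w then move k w else 0) + (if c (Suc k) w then 0 else ?V w))"
    by auto
  define m where "m = (LINT w|M. move k w)"
  define d where "d = (LINT w|M. drift k w)"
  have m0: "m \<ge> 0" "d \<ge> 0" unfolding m_def d_def by (intro Bochner_Integration.integral_nonneg msd_nonneg)+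
  have "(LINT w|M. ?V w) \<le> (LINT w|M. (1 + 2 / q) * move k w + (1 + q / 2) * drift k w)"
    using tri Vi assms by (intro integral_mono) auto
  also have "\<dots> = (1 + 2 / q) * m + (1 + q / 2) * d" using assms by (simp add: m_def d_def)
  finally have "q * m + (1 - q) * (LINT w|M. ?V w) \<le> q * m + (1 - q) * ((1 + 2 / q) * m + (1 + q / 2) * d)"
    using q by (intro add_left_mono mult_left_mono) auto
  also have "\<dots> = (2 / q - 1) * m + (1 - q / 2 - q\<^sup>2 / 2) * d"
    using q by (simp add: field_simps power2_eq_square)
  also have "\<dots> \<le> (2 / q) * m + (1 - q / 2) * d"
    using m0 by (intro add_mono mult_right_mono) auto
  finally have le: "q * m + (1 - q) * (LINT w|M. ?V w) \<le> (1 - q / 2) * d + 2 / q * m" by simp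
  show ?thesis
    unfolding eq q_def[symmetric] using cM cV le unfolding m_def d_def
    by (subst Bochner_Integration.integral_add) auto
qed

end

section \<open>Accumulated error and residual bound\<close>

lemma geometric_weighted_sum:
  fixes y u :: "nat \<Rightarrow> real"
  assumes "\<epsilon> > 0" "\<epsilon> \<le> 1" "y 0 = 0" and y: "\<And>k. y k \<ge> 0"
    and step: "\<And>k. y (Suc k) \<le> (1 - \<epsilon>) * y k + u k"
    and u: "\<And>k. u k \<ge> 0"
  shows "\<epsilon> * (\<Sum>k<K. y k) \<le> (\<Sum>k<K. u k)"
proof (cases K)
  case (Suc j)
  have "\<epsilon> * (\<Sum>k<Suc j. y k) + (1 - \<epsilon>) * y j \<le> (\<Sum>k<j. u k)" for j
  proof (induction j)
    case (Suc j)
    then show ?case using step[of j] by (simp add: algebra_simps)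
  qed (use assms(3) in simp)
  from this[of j] have "\<epsilon> * (\<Sum>k<Suc j. y k) \<le> (\<Sum>k<j. u k)"
    using mult_nonneg_nonneg[of "1 - \<epsilon>" "y j"] y[of j] assms(2) by linarith
  then show ?thesis using u[of j] by (simp add: Suc)
qed simp

lemma norm_mono_nonneg: "0 \<le> v \<Longrightarrow> v \<le> u \<Longrightarrow> norm v \<le> norm u" for u v :: real
  by simp

context vfosa_run
begin

abbreviation "pot k w \<equiv> potential \<mu> \<beta> (t k - \<mu>) (x k w - xs) (z k w - xs) (G (x k w))"

lemma potential_path_step:
  assumes w: "w \<in> space M"
  shows "pot (Suc k) w + \<Lambda> * (W k * move k w) \<le> pot k w + 3 * \<beta> / \<mu> * (W k * err k w)"
proof -
  define e where "e = Gt k w - G (x k w)"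
  have Gt: "Gt k w = G (x k w) + e" by (simp add: e_def)
  have X: "x (Suc k) w - xs = (x k w - xs) - (1 / t k) *\<^sub>R ((x k w - xs) - (z k w - xs)) - \<eta> k *\<^sub>R (G (x k w) + e)"
    unfolding iterate(1)[OF w] Gt by (simp add: algebra_simps)
  have Z: "z (Suc k) w - xs = (z k w - xs) - (\<mu> / 2 * \<eta> k) *\<^sub>R (G (x k w) + e)"
    unfolding iterate(2)[OF w] Gt by (simp add: algebra_simps)
  have c1: "(G (x (Suc k) w) - G (x k w)) \<bullet> ((x (Suc k) w - xs) - (x k w - xs))
      \<ge> \<beta>b * (norm (G (x (Suc k) w) - G (x k w)))\<^sup>2 + \<Lambda> * move k w"
    using G_cocoercive[of "x (Suc k) w" "x k w"] by simp
  have c2: "G (x k w) \<bullet> (x k w - xs) \<ge> \<beta>b * (norm (G (x k w)))\<^sup>2"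
    using G_cocoercive[of "x k w" xs] mult_nonneg_nonneg[OF less_imp_le[OF \<Lambda>_pos] msd_nonneg[of "x k w" xs]]
    by (simp add: G_xs)
  have "potential \<mu> \<beta> (t k) (x (Suc k) w - xs) (z (Suc k) w - xs) (G (x (Suc k) w)) + t k * (t k - 1) * (\<Lambda> * move k w)
      \<le> pot k w + 3 * \<beta> / \<mu> * (t k * (t k - 1)) * (norm e)\<^sup>2"
    by (rule potential_step[OF \<mu> \<beta> refl t_large \<eta> X Z c1 c2])
  moreover have "(norm e)\<^sup>2 \<le> err k w"
    unfolding e_def fb_residual_def
    by (intro power_mono fb_residual_at_lipschitz[OF T \<rho> lam]) simp
  then have "3 * \<beta> / \<mu> * (t k * (t k - 1)) * (norm e)\<^sup>2 \<le> 3 * \<beta> / \<mu> * (t k * (t k - 1)) * err k w"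
    using W_nonneg[of k] \<mu> \<beta> unfolding W_def by (intro mult_left_mono mult_nonneg_nonneg[of "3 * \<beta> / \<mu>"]) auto
  ultimately have "potential \<mu> \<beta> (t k) (x (Suc k) w - xs) (z (Suc k) w - xs) (G (x (Suc k) w)) + W k * (\<Lambda> * move k w)
      \<le> pot k w + 3 * \<beta> / \<mu> * W k * err k w" unfolding W_def by linarith
  moreover have "W k * (\<Lambda> * move k w) = \<Lambda> * (W k * move k w)" by (simp only: mult.left_commute)
  ultimately show ?thesis by (simp only: t_Suc add_diff_cancel_right' mult.assoc)
qed

definition energy0 :: real where
  "energy0 = (t 0)\<^sup>2 * (norm (G x0))\<^sup>2 + (t 0 - \<mu> / 2) / (2 * \<beta>\<^sup>2 * \<mu> * (t 0 - 1)) * (norm (x0 - xs))\<^sup>2"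

lemma potential_path:
  assumes w: "w \<in> space M"
  shows "\<beta> * (1 - \<mu> / 2) * (t K)\<^sup>2 * (norm (G (x (Suc K) w)))\<^sup>2 + \<Lambda> * (\<Sum>k\<le>K. W k * move k w)
     \<le> 5 / 4 * \<beta> * energy0 + 3 * \<beta> / \<mu> * (\<Sum>k\<le>K. W k * err k w)"
proof -
  have "pot (Suc K) w + \<Lambda> * (\<Sum>k\<le>K. W k * move k w) \<le> pot 0 w + 3 * \<beta> / \<mu> * (\<Sum>k\<le>K. W k * err k w)"
  proof (induction K)
    case 0 then show ?case using potential_path_step[OF w, of 0] by simp
  next
    case (Suc K) then show ?case using potential_path_step[OF w, of "Suc K"]
      by (simp only: sum.atMost_Suc distrib_left)
  qed
  moreover have "pot 0 w \<le> 5 / 4 * \<beta> * energy0"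
    unfolding energy0_def initial[OF w] by (rule potential_initial[OF \<mu> \<beta> refl t_large])
  moreover have "\<beta> * (1 - \<mu> / 2) * (t K)\<^sup>2 * (norm (G (x (Suc K) w)))\<^sup>2 \<le> pot (Suc K) w"
  proof -
    have "G (x (Suc K) w) \<bullet> (x (Suc K) w - xs) \<ge> \<beta>b * (norm (G (x (Suc K) w)))\<^sup>2"
      using G_cocoercive[of "x (Suc K) w" xs]
        mult_nonneg_nonneg[OF less_imp_le[OF \<Lambda>_pos] msd_nonneg[of "x (Suc K) w" xs]]
      by (simp add: G_xs)
    from potential_lower[OF \<mu> \<beta> refl t_large this] show ?thesis by (simp add: t_Suc)
  qed
  ultimately show ?thesis by linarith
qed

lemma move_integrable:
  assumes "\<And>j. j \<le> k \<Longrightarrow> integrable M (err j)"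
  shows "integrable M (move k)"
proof (rule Bochner_Integration.integrable_bound)
  let ?B = "\<lambda>w. (5 / 4 * \<beta> * energy0 + 3 * \<beta> / \<mu> * (\<Sum>j\<le>k. W j * err j w)) / (\<Lambda> * W k)"
  show "integrable M ?B"
    using assms by (intro integrable_divide Bochner_Integration.integrable_add integrable_mult_right
        Bochner_Integration.integrable_sum) auto
  have "move k w \<le> ?B w" if w: "w \<in> space M" for w
  proof -
    have "W k * move k w \<le> (\<Sum>j\<le>k. W j * move j w)"
      using W_nonneg msd_nonneg
      by (intro member_le_sum[of k _ "\<lambda>j. W j * move j w"] mult_nonneg_nonneg) auto
    then have "\<Lambda> * (W k * move k w) \<le> \<Lambda> * (\<Sum>j\<le>k. W j * move j w)"
      using \<Lambda>_pos by (intro mult_left_mono) auto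
    moreover have "0 \<le> \<beta> * (1 - \<mu> / 2) * (t k)\<^sup>2 * (norm (G (x (Suc k) w)))\<^sup>2"
      using \<mu> \<beta> by simp
    ultimately have "\<Lambda> * (W k * move k w) \<le> 5 / 4 * \<beta> * energy0 + 3 * \<beta> / \<mu> * (\<Sum>j\<le>k. W j * err j w)"
      using potential_path[OF w, of k] by linarith
    moreover have "0 < \<Lambda> * W k" using \<Lambda>_pos W_pos by (rule mult_pos_pos)
    ultimately show ?thesis by (simp only: pos_le_divide_eq mult_ac)
  qed
  then show "AE w in M. norm (move k w) \<le> norm (?B w)"
    using msd_nonneg by (intro AE_I2 norm_mono_nonneg)
qed measurable

text \<open>
  Square integrability is not assumed of the iterates; it propagates along the recursion drift,
  error, move, the last by the pathwise potential inequality.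
\<close>
lemma all_integrable: "integrable M (drift k) \<and> integrable M (err k) \<and> integrable M (move k)"
proof (induction k rule: less_induct)
  case (less k)
  have d: "integrable M (drift k)"
  proof (cases k)
    case 0 then show ?thesis by simp
  next
    case (Suc j) then show ?thesis using less[of j] drift_step[of j] by simp
  qed
  have e: "integrable M (err k)" using err_bound[OF d] by blast
  have "integrable M (move k)"
  proof (rule move_integrable)
    fix j assume "j \<le> k"
    then show "integrable M (err j)" using less[of j] e by (cases "j = k") simp_all
  qed
  with d e show ?case by blast
qed

text \<open>
  The summand \<open>4 \<mu> / (t k - 1)\<close> of the refresh probability offsets the growth of the weights, and
  the summand \<open>2 \<epsilon>\<close> leaves the contraction factor \<open>1 - \<epsilon>\<close>.
\<close>
lemma weight_recursion:
  "W (Suc k) * (1 - p (Suc k) / 2) \<le> (1 - \<epsilon>) * W k"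
  "W (Suc k) * (2 / p (Suc k)) \<le> 36 / 25 / \<epsilon> * W k"
proof -
  define v where "v = t k"
  define a where "a = \<mu> / (v - 1)"
  have v: "v > 1" "v - 1 > 5 * \<mu>" using t_large[of k] \<mu> by (auto simp: v_def)
  have a: "0 \<le> a" "a \<le> 1 / 5" using v \<mu> by (auto simp: a_def divide_le_eq)
  have WS: "W (Suc k) = (v + \<mu>) * (v - 1 + \<mu>)" by (simp add: W_def t_Suc v_def)
  have am: "v - 1 + \<mu> = (v - 1) * (1 + a)" using v by (simp add: a_def distrib_left)
  have "\<mu> \<le> v * a" using v \<mu> by (simp add: a_def le_divide_eq)
  then have "v + \<mu> \<le> v * (1 + a)" by (simp add: distrib_left)
  then have "(v + \<mu>) * (v - 1 + \<mu>) \<le> v * (1 + a) * ((v - 1) * (1 + a))"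
    unfolding am using v a by (intro mult_right_mono) auto
  then have W: "W (Suc k) \<le> (1 + a)\<^sup>2 * W k" by (simp add: WS W_def[of k] v_def power2_eq_square mult_ac)
  have pk: "p (Suc k) / 2 = \<epsilon> + 2 * a" by (simp add: p a_def v_def)
  have e1: "\<epsilon> \<le> 1" "\<epsilon> + 2 * a \<le> 1" using p_bounds(2)[of k] pk a by auto
  have "W (Suc k) * (1 - p (Suc k) / 2) \<le> (1 + a)\<^sup>2 * W k * (1 - p (Suc k) / 2)"
    using W e1 pk by (intro mult_right_mono) auto
  also have "\<dots> \<le> (1 - \<epsilon>) * W k"
  proof -
    have "(1 + a)\<^sup>2 * (1 - 2 * a) = 1 - 3 * a\<^sup>2 - 2 * a ^ 3"
      by (simp add: power2_eq_square power3_eq_cube algebra_simps)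
    then have 1: "(1 + a)\<^sup>2 * (1 - 2 * a) \<le> 1"
      using a zero_le_power[of a 3] zero_le_power2[of a] by linarith
    have "1 - \<epsilon> - 2 * a \<le> (1 - \<epsilon>) * (1 - 2 * a)"
      using \<epsilon> a by (simp add: algebra_simps)
    then have "(1 + a)\<^sup>2 * (1 - \<epsilon> - 2 * a) \<le> (1 + a)\<^sup>2 * ((1 - \<epsilon>) * (1 - 2 * a))"
      by (intro mult_left_mono) auto
    also have "\<dots> = (1 - \<epsilon>) * ((1 + a)\<^sup>2 * (1 - 2 * a))" by (simp add: mult_ac)
    also have "\<dots> \<le> (1 - \<epsilon>) * 1" using 1 e1 by (intro mult_left_mono) auto
    finally have "(1 + a)\<^sup>2 * (1 - \<epsilon> - 2 * a) * W k \<le> (1 - \<epsilon>) * W k"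
      using W_nonneg[of k] by (intro mult_right_mono) auto
    then show ?thesis by (simp add: pk mult_ac diff_diff_eq)
  qed
  finally show "W (Suc k) * (1 - p (Suc k) / 2) \<le> (1 - \<epsilon>) * W k" .
  have "(1 + a)\<^sup>2 \<le> (6 / 5)\<^sup>2" using a by (intro power_mono) auto
  then have "(1 + a)\<^sup>2 * W k \<le> 36 / 25 * W k"
    using W_nonneg[of k] by (intro mult_right_mono) (simp_all add: power2_eq_square)
  then have "W (Suc k) \<le> 36 / 25 * W k" using W by linarith
  moreover have "2 / p (Suc k) \<le> 1 / \<epsilon>"
  proof -
    have "2 * \<epsilon> \<le> p (Suc k)" using pk a by simp
    then have "2 / p (Suc k) \<le> 2 / (2 * \<epsilon>)" using \<epsilon> by (intro divide_left_mono) auto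
    then show ?thesis by simp
  qed
  ultimately have "W (Suc k) * (2 / p (Suc k)) \<le> 36 / 25 * W k * (1 / \<epsilon>)"
    using W_pos[of k] p_bounds(1)[of k] by (intro mult_mono) auto
  then show "W (Suc k) * (2 / p (Suc k)) \<le> 36 / 25 / \<epsilon> * W k" by simp
qed

lemma weighted_drift:
  "(\<Sum>k\<le>K. W k * (LINT w|M. drift k w)) \<le> 36 / 25 / \<epsilon>\<^sup>2 * (\<Sum>k\<le>K. W k * (LINT w|M. move k w))"
proof -
  define d where "d k = (LINT w|M. drift k w)" for k
  define m where "m k = (LINT w|M. move k w)" for k
  have nn: "d k \<ge> 0" "m k \<ge> 0" for k
    unfolding d_def m_def by (intro Bochner_Integration.integral_nonneg msd_nonneg)+
  have d0: "d 0 = 0" by (simp add: d_def)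
  have "\<epsilon> * (\<Sum>k<Suc K. W k * d k) \<le> (\<Sum>k<Suc K. 36 / 25 / \<epsilon> * (W k * m k))"
  proof (rule geometric_weighted_sum)
    show "\<epsilon> \<le> 1"
    proof -
      have "4 * \<mu> / (t 0 - 1) \<ge> 0" using \<mu> t_large[of 0] by simp
      then show ?thesis using p_bounds(2)[of 0] \<epsilon> by (simp add: p)
    qed
    fix k
    show "0 \<le> W k * d k" "0 \<le> 36 / 25 / \<epsilon> * (W k * m k)"
      using W_nonneg nn \<epsilon> by (intro mult_nonneg_nonneg, auto)+
    have "d (Suc k) \<le> (1 - p (Suc k) / 2) * d k + 2 / p (Suc k) * m k"
      using drift_step[of k] all_integrable[of k] by (simp add: d_def m_def)
    then have "W (Suc k) * d (Suc k) \<le> W (Suc k) * ((1 - p (Suc k) / 2) * d k + 2 / p (Suc k) * m k)"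
      by (rule mult_left_mono[OF _ W_nonneg])
    also have "\<dots> = W (Suc k) * (1 - p (Suc k) / 2) * d k + W (Suc k) * (2 / p (Suc k)) * m k"
      by (simp only: distrib_left mult.assoc)
    also have "\<dots> \<le> (1 - \<epsilon>) * W k * d k + 36 / 25 / \<epsilon> * W k * m k"
      using weight_recursion nn by (intro add_mono mult_right_mono) auto
    finally show "W (Suc k) * d (Suc k) \<le> (1 - \<epsilon>) * (W k * d k) + 36 / 25 / \<epsilon> * (W k * m k)"
      by (simp only: mult.assoc)
  qed (use \<epsilon> d0 in auto)
  then have "(\<Sum>k\<le>K. W k * d k) * \<epsilon> \<le> 36 / 25 / \<epsilon> * (\<Sum>k\<le>K. W k * m k)"
    by (simp only: lessThan_Suc_atMost sum_distrib_left[symmetric] mult.commute[of \<epsilon>])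
  then have "(\<Sum>k\<le>K. W k * d k) \<le> (36 / 25 / \<epsilon> * (\<Sum>k\<le>K. W k * m k)) / \<epsilon>"
    using \<epsilon> by (simp only: pos_le_divide_eq)
  then show ?thesis by (simp add: d_def m_def power2_eq_square)
qed

text \<open>
  The weighted drift is at most \<open>36 / (25 \<epsilon>\<^sup>2)\<close> times the weighted moves. With a mini-batch of order
  \<open>\<epsilon>\<^sup>-\<^sup>2\<close> its contribution to the error is swallowed by the moves on the left of the
  potential inequality, and only the mega-batch noise survives.
\<close>
theorem residual_bound:
  shows "integrable M (\<lambda>w. (norm (G (x (Suc K) w)))\<^sup>2)"
    and "(1 - \<mu> / 2) * (t K)\<^sup>2 * (LINT w|M. (norm (G (x (Suc K) w)))\<^sup>2)
      \<le> 5 / 4 * energy0 + 3 / \<mu> * (\<Sum>k\<le>K. W k) * (\<sigma>\<^sup>2 / nn)"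
proof -
  let ?k = "\<beta> * (1 - \<mu> / 2) * (t K)\<^sup>2"
  let ?B = "\<lambda>w. 5 / 4 * \<beta> * energy0 + 3 * \<beta> / \<mu> * (\<Sum>k\<le>K. W k * err k w)"
  let ?N = "\<lambda>w. (norm (G (x (Suc K) w)))\<^sup>2"
  have tK: "t K > 0" using t_large[of K] \<mu> by linarith
  have k: "?k > 0" using tK \<mu> \<beta> by simp
  have Mi: "integrable M (move k)" and Ei: "integrable M (err k)" for k
    using all_integrable[of k] by simp_all
  have ei: "integrable M (\<lambda>w. 3 * \<beta> / \<mu> * (\<Sum>k\<le>K. W k * err k w))"
    by (rule integrable_mult_right[OF Bochner_Integration.integrable_sum[OF integrable_mult_right[OF Ei]]])
  have Bi: "integrable M ?B"
    by (rule Bochner_Integration.integrable_add[OF _ ei]) simp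
  have mi: "integrable M (\<lambda>w. \<Lambda> * (\<Sum>k\<le>K. W k * move k w))"
    by (rule integrable_mult_right[OF Bochner_Integration.integrable_sum[OF integrable_mult_right[OF Mi]]])
  have mn: "\<Lambda> * (\<Sum>k\<le>K. W k * move k w) \<ge> 0" for w
    by (rule mult_nonneg_nonneg[OF less_imp_le[OF \<Lambda>_pos] sum_nonneg[OF mult_nonneg_nonneg[OF W_nonneg msd_nonneg]]])
  have path: "?k * ?N w + \<Lambda> * (\<Sum>k\<le>K. W k * move k w) \<le> ?B w" if "w \<in> space M" for w
    by (rule potential_path[OF that])
  show Ni: "integrable M ?N"
  proof (rule Bochner_Integration.integrable_bound)
    show "integrable M (\<lambda>w. ?B w / ?k)" using Bi by (rule integrable_divide)
    have "?N w \<le> ?B w / ?k" if "w \<in> space M" for w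
    proof -
      have drop: "v \<le> u" if "v + l \<le> u" "0 \<le> l" for u v l :: real using that by linarith
      from drop[OF path[OF that] mn] show ?thesis
        by (subst pos_le_divide_eq[OF k], subst mult.commute)
    qed
    then show "AE w in M. norm (?N w) \<le> norm (?B w / ?k)"
      by (intro AE_I2 norm_mono_nonneg) simp_all
  qed measurable
  define m where "m k = (LINT w|M. move k w)" for k
  define d where "d k = (LINT w|M. drift k w)" for k
  define e where "e k = (LINT w|M. err k w)" for k
  have mE: "(LINT w|M. \<Lambda> * (\<Sum>k\<le>K. W k * move k w)) = \<Lambda> * (\<Sum>k\<le>K. W k * m k)"
  proof -
    have "(LINT w|M. (\<Sum>k\<le>K. W k * move k w)) = (\<Sum>k\<le>K. (LINT w|M. W k * move k w))"
      by (rule Bochner_Integration.integral_sum[OF integrable_mult_right[OF Mi]])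
    then show ?thesis unfolding m_def by (simp only: integral_mult_right_zero)
  qed
  have eE: "(LINT w|M. 3 * \<beta> / \<mu> * (\<Sum>k\<le>K. W k * err k w)) = 3 * \<beta> / \<mu> * (\<Sum>k\<le>K. W k * e k)"
  proof -
    have "(LINT w|M. (\<Sum>k\<le>K. W k * err k w)) = (\<Sum>k\<le>K. (LINT w|M. W k * err k w))"
      by (rule Bochner_Integration.integral_sum[OF integrable_mult_right[OF Ei]])
    then show ?thesis unfolding e_def by (simp only: integral_mult_right_zero)
  qed
  have "(LINT w|M. ?k * ?N w) + (LINT w|M. \<Lambda> * (\<Sum>k\<le>K. W k * move k w))
      = (LINT w|M. ?k * ?N w + \<Lambda> * (\<Sum>k\<le>K. W k * move k w))"
    by (rule Bochner_Integration.integral_add[OF integrable_mult_right[OF Ni] mi, symmetric])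
  also have "\<dots> \<le> (LINT w|M. ?B w)"
    by (rule integral_mono[OF Bochner_Integration.integrable_add[OF integrable_mult_right[OF Ni] mi] Bi path])
  also have "\<dots> = (LINT w|M. 5 / 4 * \<beta> * energy0) + (LINT w|M. 3 * \<beta> / \<mu> * (\<Sum>k\<le>K. W k * err k w))"
    by (rule Bochner_Integration.integral_add[OF _ ei]) simp
  also have "(LINT w|M. 5 / 4 * \<beta> * energy0) = 5 / 4 * \<beta> * energy0" by (simp add: prob_space)
  finally have 1: "?k * (LINT w|M. ?N w) + \<Lambda> * (\<Sum>k\<le>K. W k * m k)
      \<le> 5 / 4 * \<beta> * energy0 + 3 * \<beta> / \<mu> * (\<Sum>k\<le>K. W k * e k)"
    unfolding mE eE unfolding integral_mult_right_zero .
  have "(\<Sum>k\<le>K. W k * e k) \<le> (\<Sum>k\<le>K. W k * (\<sigma>\<^sup>2 / nn) + W k * d k / nb)"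
  proof (rule sum_mono)
    fix k
    have "W k * e k \<le> W k * (\<sigma>\<^sup>2 / nn + d k / nb)"
      using err_bound[of k] all_integrable[of k] W_nonneg[of k]
      by (intro mult_left_mono) (auto simp: e_def d_def)
    then show "W k * e k \<le> W k * (\<sigma>\<^sup>2 / nn) + W k * d k / nb" by (simp only: distrib_left times_divide_eq_right)
  qed
  also have "\<dots> = (\<Sum>k\<le>K. W k) * (\<sigma>\<^sup>2 / nn) + (\<Sum>k\<le>K. W k * d k) / nb"
    by (simp only: sum.distrib sum_distrib_right sum_divide_distrib)
  also have "\<dots> \<le> (\<Sum>k\<le>K. W k) * (\<sigma>\<^sup>2 / nn) + 36 / 25 / \<epsilon>\<^sup>2 * (\<Sum>k\<le>K. W k * m k) / nb"
    using weighted_drift[of K] by (intro add_left_mono divide_right_mono) (auto simp: d_def m_def)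
  finally have "3 * \<beta> / \<mu> * (\<Sum>k\<le>K. W k * e k) \<le>
      3 * \<beta> / \<mu> * ((\<Sum>k\<le>K. W k) * (\<sigma>\<^sup>2 / nn) + 36 / 25 / \<epsilon>\<^sup>2 * (\<Sum>k\<le>K. W k * m k) / nb)"
    using \<mu> \<beta> by (intro mult_left_mono) auto
  also have "\<dots> = 3 * \<beta> / \<mu> * ((\<Sum>k\<le>K. W k) * (\<sigma>\<^sup>2 / nn)) + 3 * \<beta> / \<mu> * (36 / 25 / \<epsilon>\<^sup>2 / nb) * (\<Sum>k\<le>K. W k * m k)"
    by (simp add: distrib_left)
  also have "\<dots> \<le> 3 * \<beta> / \<mu> * ((\<Sum>k\<le>K. W k) * (\<sigma>\<^sup>2 / nn)) + \<Lambda> * (\<Sum>k\<le>K. W k * m k)"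
  proof (intro add_left_mono mult_right_mono sum_nonneg mult_nonneg_nonneg W_nonneg)
    have nb: "real nb > 0" using b(2) by simp
    have "5 * \<beta> / \<mu> / (N * e) \<le> l" if "5 * \<beta> / (\<mu> * l) / e \<le> N" "N > 0" "e > 0" "l > 0" for N e l
    proof -
      have "5 * \<beta> / (\<mu> * l) \<le> N * e" using that(1,3) by (simp only: pos_divide_le_eq)
      then have "5 * \<beta> / \<mu> / l \<le> N * e" by simp
      then have "5 * \<beta> / \<mu> \<le> N * e * l" using that by (simp only: pos_divide_le_eq)
      then have "5 * \<beta> / \<mu> \<le> l * (N * e)" by (simp only: mult.commute)
      moreover have "N * e > 0" using that by simp
      ultimately show ?thesis by (simp only: pos_divide_le_eq)
    qed
    from this[OF b(3) nb zero_less_power[OF \<epsilon>] \<Lambda>_pos] have le: "5 * \<beta> / \<mu> / (nb * \<epsilon>\<^sup>2) \<le> \<Lambda>" .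
    have "3 * \<beta> / \<mu> * (36 / 25 / e / N) \<le> 5 * \<beta> / \<mu> / (N * e)" if "N * e > 0" for e N :: real
    proof -
      have eqs: "3 * \<beta> / \<mu> * (36 / 25 / e / N) = 108 / 25 * (\<beta> / \<mu> / (N * e))"
        "5 * \<beta> / \<mu> / (N * e) = 5 * (\<beta> / \<mu> / (N * e))" by simp_all
      have "0 \<le> \<beta> / \<mu> / (N * e)" using that \<mu> \<beta> by simp
      then show ?thesis unfolding eqs by (intro mult_right_mono) auto
    qed
    from order_trans[OF this[OF mult_pos_pos[OF nb zero_less_power[OF \<epsilon>]]] le]
    show "3 * \<beta> / \<mu> * (36 / 25 / \<epsilon>\<^sup>2 / nb) \<le> \<Lambda>" .
    show "0 \<le> m k" for k unfolding m_def by (intro Bochner_Integration.integral_nonneg msd_nonneg)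
  qed
  finally have 2: "3 * \<beta> / \<mu> * (\<Sum>k\<le>K. W k * e k)
      \<le> 3 * \<beta> / \<mu> * ((\<Sum>k\<le>K. W k) * (\<sigma>\<^sup>2 / nn)) + \<Lambda> * (\<Sum>k\<le>K. W k * m k)" .
  have cancel: "a \<le> u + v" if "a + l \<le> u + q" "q \<le> v + l" for a l u v q :: real
    using that by linarith
  have factor: "\<beta> * (5 / 4 * u + 3 / \<mu> * v * q) = 5 / 4 * \<beta> * u + 3 * \<beta> / \<mu> * (v * q)" for u v q
    by (simp add: distrib_left)
  have "\<beta> * ((1 - \<mu> / 2) * (t K)\<^sup>2 * (LINT w|M. ?N w)) \<le> \<beta> * (5 / 4 * energy0 + 3 / \<mu> * (\<Sum>k\<le>K. W k) * (\<sigma>\<^sup>2 / nn))"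
    using cancel[OF 1 2] unfolding factor by (simp only: mult.assoc)
  then show "(1 - \<mu> / 2) * (t K)\<^sup>2 * (LINT w|M. ?N w) \<le> 5 / 4 * energy0 + 3 / \<mu> * (\<Sum>k\<le>K. W k) * (\<sigma>\<^sup>2 / nn)"
    by (rule mult_left_le_imp_le[OF _ \<beta>(1)])
qed

text \<open>
  Comparison with the integral of \<open>t\<^sup>2\<close>: \<open>t\<^sup>3\<close> increases by at least \<open>3 \<mu> W\<close> per step.
\<close>
lemma weight_sum: "(\<Sum>k\<le>K. W k) \<le> (t K) ^ 3 / (3 * \<mu>)"
proof -
  have cube: "W k * (3 * \<mu>) \<le> (t k) ^ 3 - (t k - \<mu>) ^ 3" for k
  proof -
    have "(t k) ^ 3 - (t k - \<mu>) ^ 3 - W k * (3 * \<mu>) = 3 * \<mu> * (t k * (1 - \<mu>)) + \<mu> ^ 3"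
      by (simp add: W_def power3_eq_cube algebra_simps)
    moreover have "3 * \<mu> * (t k * (1 - \<mu>)) + \<mu> ^ 3 \<ge> 0"
      using t_large[of k] \<mu> by (intro add_nonneg_nonneg mult_nonneg_nonneg zero_le_power) auto
    ultimately show ?thesis by linarith
  qed
  have "(\<Sum>k\<le>K. W k) * (3 * \<mu>) \<le> (t K) ^ 3"
  proof (induction K)
    case 0
    have "(t 0 - \<mu>) ^ 3 \<ge> 0" using t_large[of 0] \<mu> by (intro zero_le_power) linarith
    then have "W 0 * (3 * \<mu>) \<le> (t 0) ^ 3" using cube[of 0] by linarith
    then show ?case by simp
  next
    case (Suc K)
    have "t (Suc K) - \<mu> = t K" by (simp add: t_Suc)
    then show ?case using Suc cube[of "Suc K"] by (simp only: sum.atMost_Suc distrib_right)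
  qed
  then show ?thesis using \<mu> by (simp add: pos_le_divide_eq)
qed

end

section \<open>Expected number of calls\<close>

context sampling
begin

lemma expected_calls:
  "integrable M (\<lambda>w. real (total_calls b n (\<lambda>k. c k w) K))"
  "(LINT w|M. real (total_calls b n (\<lambda>k. c k w) K))
     = (\<Sum>k<K. (if k = 0 then real (n k) else p k * real (n k)) + 2 * real (b k) + 1)"
proof -
  have eq: "real (total_calls b n (\<lambda>k. c k w) K)
      = (\<Sum>k<K. (if k = 0 \<or> c k w then real (n k) else 0) + (2 * real (b k) + 1))" for w
    unfolding total_calls_def by (simp add: if_distrib[of real] algebra_simps cong: if_cong)
  have refresh: "integrable M (\<lambda>w. if k = 0 \<or> c k w then real (n k) else 0)"
    "(LINT w|M. (if k = 0 \<or> c k w then real (n k) else 0)) = (if k = 0 then real (n k) else p k * real (n k))" for k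
  proof -
    have "integrable M (\<lambda>w. if k = 0 \<or> c k w then real (n k) else 0) \<and>
      (LINT w|M. (if k = 0 \<or> c k w then real (n k) else 0)) = (if k = 0 then real (n k) else p k * real (n k))"
    proof (cases "k = 0")
      case False
      then have "k \<ge> 1" by simp
      have "Refresh k \<notin> {}" by simp
      from coin_expectation(1,2)[OF \<open>k \<ge> 1\<close> empty_subsetI this measurable_const integrable_const,
          of "real (n k)"] False
      show ?thesis by (simp add: prob_space)
    qed (simp add: prob_space)
    then show "integrable M (\<lambda>w. if k = 0 \<or> c k w then real (n k) else 0)"
      "(LINT w|M. (if k = 0 \<or> c k w then real (n k) else 0)) = (if k = 0 then real (n k) else p k * real (n k))"
      by blast+
  qed
  have term_int: "integrable M (\<lambda>w. (if k = 0 \<or> c k w then real (n k) else 0) + (2 * real (b k) + 1))" for k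
    by (rule Bochner_Integration.integrable_add[OF refresh(1)]) simp
  have term_exp: "(LINT w|M. (if k = 0 \<or> c k w then real (n k) else 0) + (2 * real (b k) + 1))
      = (if k = 0 then real (n k) else p k * real (n k)) + (2 * real (b k) + 1)" for k
    by (subst Bochner_Integration.integral_add[OF refresh(1)]) (simp_all add: refresh(2) prob_space)
  show "integrable M (\<lambda>w. real (total_calls b n (\<lambda>k. c k w) K))"
    unfolding eq by (rule Bochner_Integration.integrable_sum[OF term_int])
  show "(LINT w|M. real (total_calls b n (\<lambda>k. c k w) K))
     = (\<Sum>k<K. (if k = 0 then real (n k) else p k * real (n k)) + 2 * real (b k) + 1)"
    unfolding eq Bochner_Integration.integral_sum[OF term_int] term_exp by (simp add: add.assoc)
qed

end

lemma sum_reciprocal_le_ln: "(\<Sum>k = 1..<Suc K. 1 / (real k + 1)) \<le> ln (real (Suc K))"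
proof (induction K)
  case (Suc K)
  let ?m = "real (Suc K)"
  have "ln (?m / (?m + 1)) \<le> ?m / (?m + 1) - 1" by (intro ln_le_minus_one) simp
  moreover have "ln (?m / (?m + 1)) = ln ?m - ln (?m + 1)" by (simp add: ln_div)
  moreover have "?m / (?m + 1) - 1 = - (1 / (?m + 1))" by (simp add: divide_simps)
  ultimately have "1 / (?m + 1) \<le> ln (?m + 1) - ln ?m" by linarith
  moreover have "(\<Sum>k = 1..<Suc (Suc K). 1 / (real k + 1)) = (\<Sum>k = 1..<Suc K. 1 / (real k + 1)) + 1 / (?m + 1)"
    by simp
  moreover have "ln (real (Suc (Suc K))) = ln (?m + 1)" by (simp add: add.commute)
  ultimately show ?case using Suc by linarith
qed simp

text \<open>
  Rounding down, with a minimum of one sample, loses at most a factor of two.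
\<close>
lemma batch_size_bounds:
  fixes y :: real assumes "y \<ge> 0"
  shows "y / 2 \<le> real (max 1 (nat \<lfloor>y\<rfloor>))" "real (max 1 (nat \<lfloor>y\<rfloor>)) \<le> 1 + y"
proof -
  have "real (nat \<lfloor>y\<rfloor>) = of_int \<lfloor>y\<rfloor>" using assms by simp
  then have "y - 1 < real (nat \<lfloor>y\<rfloor>)" "real (nat \<lfloor>y\<rfloor>) \<le> y" by linarith+
  moreover have "real (max 1 (nat \<lfloor>y\<rfloor>)) = max 1 (real (nat \<lfloor>y\<rfloor>))" by (simp add: of_nat_max)
  ultimately show "y / 2 \<le> real (max 1 (nat \<lfloor>y\<rfloor>))" "real (max 1 (nat \<lfloor>y\<rfloor>)) \<le> 1 + y"
    using assms by linarith+
qed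

context vfosa_run
begin

text \<open>
  The residual bound is a deterministic part of order \<open>t\<^sup>-\<^sup>2\<close> plus a noise part that grows
  linearly in \<open>t\<close>, so the run has to stop in time: at the first index where \<open>t\<close> reaches
  \<open>2 Q / \<epsilon>\<close>, the deterministic part is at most \<open>5/16\<close> and the noise at most \<open>1/5\<close> of
  \<open>\<epsilon>\<^sup>2\<close>, up to the factor \<open>1 - \<mu> / 2\<close>. This is \<open>O(1 / \<epsilon>)\<close> steps. The refresh
  probabilities sum to \<open>O(1 + ln (1 / \<epsilon>))\<close> over them, and this is where the logarithm comes from.
\<close>
lemma complexity:
  assumes \<epsilon>1: "\<epsilon> \<le> 1" and \<Psi>: "\<Psi> \<ge> 0" "energy0 = \<Psi>\<^sup>2" and Q: "Q = max \<Psi> (\<mu>\<^sup>2 / (2 * sqrt 2))"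
    and noise: "\<sigma>\<^sup>2 / nn \<le> \<epsilon> ^ 3 * \<mu>\<^sup>2 / (12 * sqrt 2 * Q)"
    and nn: "real nn \<le> (1 + cn) / \<epsilon> ^ 3" "cn \<ge> 0" and nb: "real nb \<le> (1 + cb) / \<epsilon>\<^sup>2" "cb \<ge> 0"
    and \<kappa>: "\<kappa> = 12 / 5 * Q / \<mu>"
  shows "\<exists>K. integrable M (\<lambda>w. (norm (G (x K w)))\<^sup>2) \<and> (LINT w|M. (norm (G (x K w)))\<^sup>2) \<le> \<epsilon>\<^sup>2 \<and>
      integrable M (\<lambda>w. real (total_calls b n (\<lambda>k. c k w) K)) \<and>
      (LINT w|M. real (total_calls b n (\<lambda>k. c k w) K))
         \<le> ((1 + cn) * (5 + 6 * \<kappa>) + \<kappa> * (2 * cb + 3)) * (1 / \<epsilon> ^ 3 + 1 / \<epsilon> ^ 3 * ln (1 / \<epsilon>))"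
proof -
  have "0 < \<mu>\<^sup>2 / (2 * sqrt 2)" using \<mu> by simp
  then have Qpos: "Q > 0" "\<Psi> \<le> Q" by (simp_all add: Q less_max_iff_disj)
  have \<kappa>pos: "\<kappa> > 0" using Qpos \<mu> by (simp add: \<kappa>)
  have ln0: "ln (1 / \<epsilon>) \<ge> 0" using \<epsilon> \<epsilon>1 by simp
  define C where "C = (1 + cn) * (5 + 6 * \<kappa>) + \<kappa> * (2 * cb + 3)"
  define \<tau> where "\<tau> = 2 * Q / \<epsilon>"
  have \<tau>: "\<tau> > 0" "\<tau> * \<epsilon> = 2 * Q" using Qpos \<epsilon> by (simp_all add: \<tau>_def)
  have tpos: "t k > 0" for k using t_large[of k] \<mu> by linarith
  show ?thesis
  proof (cases "t 0 \<ge> \<tau>")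
    \<comment> \<open>The starting point is already good enough and costs nothing.\<close>
    case True
    have "(LINT w|M. (norm (G (x 0 w)))\<^sup>2) = (LINT w|M. (norm (G x0))\<^sup>2)"
      by (intro Bochner_Integration.integral_cong) (simp_all add: initial)
    also have "\<dots> = (norm (G x0))\<^sup>2" by (simp add: prob_space)
    also have "\<dots> \<le> \<epsilon>\<^sup>2"
    proof -
      have "(t 0 - \<mu> / 2) / (2 * \<beta>\<^sup>2 * \<mu> * (t 0 - 1)) * (norm (x0 - xs))\<^sup>2 \<ge> 0"
        using t_large[of 0] \<mu> by (intro mult_nonneg_nonneg divide_nonneg_nonneg) auto
      then have "(t 0 * norm (G x0))\<^sup>2 \<le> \<Psi>\<^sup>2"
        using \<Psi>(2) unfolding energy0_def power_mult_distrib by linarith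
      then have "t 0 * norm (G x0) \<le> Q" using \<Psi>(1) Qpos power2_le_imp_le by (meson order_trans)
      moreover have "\<tau> * norm (G x0) \<le> t 0 * norm (G x0)" using True by (intro mult_right_mono) auto
      ultimately have "\<tau> * norm (G x0) \<le> \<tau> * \<epsilon>" using \<tau> Qpos by linarith
      then have "norm (G x0) \<le> \<epsilon>" by (rule mult_left_le_imp_le[OF _ \<tau>(1)])
      then show ?thesis by (intro power_mono) auto
    qed
    finally have "(LINT w|M. (norm (G (x 0 w)))\<^sup>2) \<le> \<epsilon>\<^sup>2" .
    moreover have "integrable M (\<lambda>w. (norm (G (x 0 w)))\<^sup>2)"
      by (rule Bochner_Integration.integrable_cong[THEN iffD1, OF refl _ integrable_const[of "(norm (G x0))\<^sup>2"]])
        (simp add: initial)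
    moreover have "0 \<le> C * (1 / \<epsilon> ^ 3 + 1 / \<epsilon> ^ 3 * ln (1 / \<epsilon>))"
      using nn(2) nb(2) \<kappa>pos ln0 \<epsilon> by (simp add: C_def)
    ultimately show ?thesis
      using expected_calls[of 0] by (intro exI[of _ 0]) (simp add: C_def)
  next
    case False
    obtain i where i: "t i \<ge> \<tau>"
    proof -
      obtain i :: nat where "\<tau> / \<mu> \<le> real i" using real_arch_simple by blast
      then have "\<tau> \<le> \<mu> * real i" using \<mu> by (simp add: pos_divide_le_eq mult.commute)
      moreover have "\<mu> * real i \<le> t i"
      proof -
        have "\<mu> * real i = t i - t 0" by (simp add: t distrib_left)
        then show ?thesis using tpos[of 0] by linarith
      qed
      ultimately have "\<tau> \<le> t i" by (rule order_trans)
      then show ?thesis by (rule that)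
    qed
    \<comment> \<open>As \<open>\<mu> \<le> t 0 / 5\<close>, the first passage overshoots \<open>\<tau>\<close> by a fifth at most.\<close>
    define j where "j = (LEAST i. t i \<ge> \<tau>)"
    have j: "t j \<ge> \<tau>" unfolding j_def by (rule LeastI[of _ i]) (rule i)
    obtain j' where j': "j = Suc j'" using False j by (cases j) auto
    have "t j' < \<tau>" using not_less_Least[of j' "\<lambda>i. t i \<ge> \<tau>"] by (simp add: j_def[symmetric] j')
    moreover have "\<mu> \<le> t 0 / 5" using t_large[of 0] by simp
    ultimately have tj: "t j \<le> 6 / 5 * \<tau>" using False by (simp add: j' t_Suc)
    define K where "K = Suc j"
    define E where "E = (LINT w|M. (norm (G (x K w)))\<^sup>2)"
    have "(1 - \<mu> / 2) * (t j)\<^sup>2 * E \<le> 5 / 4 * energy0 + 3 / \<mu> * (\<Sum>k\<le>j. W k) * (\<sigma>\<^sup>2 / nn)"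
      unfolding E_def K_def by (rule residual_bound(2))
    also have "\<dots> \<le> 5 / 4 * Q\<^sup>2 + 3 / \<mu> * (t j ^ 3 / (3 * \<mu>)) * (\<epsilon> ^ 3 * \<mu>\<^sup>2 / (12 * sqrt 2 * Q))"
    proof (intro add_mono mult_mono mult_left_mono weight_sum noise)
      show "energy0 \<le> Q\<^sup>2" unfolding \<Psi>(2) using \<Psi>(1) Qpos by (intro power_mono) auto
      show "0 \<le> 3 / \<mu> * (t j ^ 3 / (3 * \<mu>))" using \<mu> tpos[of j] by simp
    qed (use \<mu> \<Psi> W_nonneg in \<open>auto intro: sum_nonneg\<close>)
    also have "3 / \<mu> * (t j ^ 3 / (3 * \<mu>)) * (\<epsilon> ^ 3 * \<mu>\<^sup>2 / (12 * sqrt 2 * Q)) = (t j)\<^sup>2 * (\<epsilon>\<^sup>2 * (t j * \<epsilon> / (12 * sqrt 2 * Q)))"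
      using \<mu> by (simp add: power2_eq_square power3_eq_cube)
    also have "\<dots> \<le> (t j)\<^sup>2 * (\<epsilon>\<^sup>2 * (1 / 5))"
    proof (intro mult_left_mono)
      have "t j * \<epsilon> \<le> 6 / 5 * \<tau> * \<epsilon>" using tj \<epsilon> by (intro mult_right_mono) auto
      also have "\<dots> = 12 / 5 * Q" using \<tau>(2) by simp
      also have "\<dots> \<le> 1 / 5 * (12 * sqrt 2 * Q)" using Qpos by simp
      finally show "t j * \<epsilon> / (12 * sqrt 2 * Q) \<le> 1 / 5" using Qpos by (simp add: pos_divide_le_eq)
    qed auto
    also have "5 / 4 * Q\<^sup>2 \<le> (t j)\<^sup>2 * (\<epsilon>\<^sup>2 * (5 / 16))"
    proof -
      have "2 * Q \<le> t j * \<epsilon>" unfolding \<tau>(2)[symmetric] using j \<epsilon> by (intro mult_right_mono) auto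
      then have "(2 * Q)\<^sup>2 \<le> (t j * \<epsilon>)\<^sup>2" using Qpos by (intro power_mono) auto
      then show ?thesis by (simp add: power_mult_distrib mult.commute)
    qed
    finally have bound: "(1 - \<mu> / 2) * (t j)\<^sup>2 * E \<le> (t j)\<^sup>2 * (\<epsilon>\<^sup>2 * (5 / 16)) + (t j)\<^sup>2 * (\<epsilon>\<^sup>2 * (1 / 5))" by simp
    have E0: "E \<ge> 0" unfolding E_def by (intro Bochner_Integration.integral_nonneg) simp
    have "2 / 3 * (t j)\<^sup>2 * E \<le> (1 - \<mu> / 2) * (t j)\<^sup>2 * E"
      using \<mu> E0 by (intro mult_right_mono) auto
    moreover have "2 / 3 * (t j)\<^sup>2 * E = (t j)\<^sup>2 * (2 / 3 * E)" by simp
    ultimately have "(t j)\<^sup>2 * (2 / 3 * E) \<le> (t j)\<^sup>2 * (\<epsilon>\<^sup>2 * (5 / 16 + 1 / 5))"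
      using bound unfolding distrib_left by linarith
    then have "2 / 3 * E \<le> \<epsilon>\<^sup>2 * (5 / 16 + 1 / 5)"
      by (rule mult_left_le_imp_le[OF _ zero_less_power[OF tpos]])
    moreover have "\<epsilon>\<^sup>2 * (5 / 16 + 1 / 5) = 41 / 80 * \<epsilon>\<^sup>2" by simp
    moreover have "v \<le> u" if "2 / 3 * v \<le> 41 / 80 * u" "0 \<le> u" for u v :: real using that by linarith
    ultimately have E: "E \<le> \<epsilon>\<^sup>2" by (metis zero_le_power2)
    have K\<epsilon>: "real K * \<epsilon> \<le> \<kappa>"
    proof -
      have "1 / \<mu> > 0" using \<mu> by simp
      then have "r \<ge> 1" using r by linarith
      then have "\<mu> * real K \<le> t j" using \<mu> unfolding t K_def by (intro mult_left_mono) auto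
      then have "\<mu> * real K * \<epsilon> \<le> 6 / 5 * \<tau> * \<epsilon>" using tj \<epsilon> by (intro mult_right_mono) auto
      also have "\<dots> = \<mu> * \<kappa>" using \<tau>(2) \<mu> by (simp add: \<kappa>)
      finally show ?thesis using \<mu> by (simp add: mult.assoc)
    qed
    have K1: "real K \<ge> 1" by (simp add: K_def)
    have lnK: "ln (real K) \<le> \<kappa> + ln (1 / \<epsilon>)"
    proof -
      have "real K \<le> \<kappa> * (1 / \<epsilon>)" using K\<epsilon> \<epsilon> by (simp add: pos_le_divide_eq)
      then have "ln (real K) \<le> ln (\<kappa> * (1 / \<epsilon>))" using K1 by (subst ln_le_cancel_iff) auto
      also have "\<dots> = ln \<kappa> + ln (1 / \<epsilon>)" using \<kappa>pos \<epsilon> by (intro ln_mult_pos) auto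
      finally show ?thesis using ln_le_minus_one[OF \<kappa>pos] by linarith
    qed
    have pk: "p k \<le> 2 * \<epsilon> + 4 * (1 / (real k + 1))" if k1: "k \<ge> 1" for k
    proof -
      obtain k' where k': "k = Suc k'" using k1 by (cases k) auto
      have "t k' - 1 > 0" using t_large[of k'] \<mu> by linarith
      moreover have "\<mu> * real (Suc (Suc k')) \<le> t k' - 1"
      proof -
        have "\<mu> * real (Suc (Suc k')) = t k' - t 0 + 2 * \<mu>" by (simp add: t algebra_simps)
        then show ?thesis using t_large[of 0] \<mu> by linarith
      qed
      ultimately have "4 * \<mu> / (t k' - 1) \<le> 4 * \<mu> / (\<mu> * real (Suc (Suc k')))"
        using \<mu> by (intro divide_left_mono mult_pos_pos) auto
      also have "\<dots> = 4 * (1 / (real k + 1))" using \<mu> by (simp add: k')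
      finally show ?thesis by (simp add: k' p)
    qed
    have "(LINT w|M. real (total_calls b n (\<lambda>k. c k w) K))
       = (\<Sum>k<K. (if k = 0 then real nn else p k * real nn)) + real K * (2 * real nb + 1)"
      unfolding expected_calls(2) b(1) n(1) by (simp add: sum.distrib algebra_simps)
    also have "(\<Sum>k<K. (if k = 0 then real nn else p k * real nn)) = real nn * (1 + (\<Sum>k = 1..<K. p k))"
    proof -
      have "(\<Sum>k<K. (if k = 0 then real nn else p k * real nn)) = real nn + (\<Sum>k = 1..<K. p k * real nn)"
        unfolding lessThan_atLeast0 K_def by (subst sum.atLeast_Suc_lessThan) (auto intro!: sum.cong)
      then show ?thesis by (simp add: distrib_left sum_distrib_left mult.commute)
    qed
    also have "real nn * (1 + (\<Sum>k = 1..<K. p k)) \<le> (1 + cn) / \<epsilon> ^ 3 * (1 + 6 * \<kappa> + 4 * ln (1 / \<epsilon>))"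
    proof (rule mult_mono[OF nn(1)])
      have "(\<Sum>k = 1..<K. p k) \<le> (\<Sum>k = 1..<K. 2 * \<epsilon> + 4 * (1 / (real k + 1)))"
        using pk by (intro sum_mono) simp
      also have "\<dots> = real j * (2 * \<epsilon>) + 4 * (\<Sum>k = 1..<K. 1 / (real k + 1))"
        by (simp only: sum.distrib sum_distrib_left[symmetric]) (simp add: K_def)
      also have "\<dots> \<le> 2 * \<kappa> + 4 * (\<kappa> + ln (1 / \<epsilon>))"
      proof (intro add_mono mult_left_mono)
        show "real j * (2 * \<epsilon>) \<le> 2 * \<kappa>" using K\<epsilon> \<epsilon> by (simp add: K_def distrib_right)
        show "(\<Sum>k = 1..<K. 1 / (real k + 1)) \<le> \<kappa> + ln (1 / \<epsilon>)"
          using sum_reciprocal_le_ln[of j] lnK unfolding K_def by linarith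
      qed simp
      finally show "1 + (\<Sum>k = 1..<K. p k) \<le> 1 + 6 * \<kappa> + 4 * ln (1 / \<epsilon>)" by simp
      show "0 \<le> (1 + cn) / \<epsilon> ^ 3" using nn(2) \<epsilon> by simp
      have "0 \<le> p k" if "k \<in> {1..<K}" for k
        using p_bounds(1)[of "k - 1"] that by simp
      then show "0 \<le> 1 + (\<Sum>k = 1..<K. p k)" by (intro add_nonneg_nonneg sum_nonneg) auto
    qed
    also have "real K * (2 * real nb + 1) \<le> 1 / \<epsilon> ^ 3 * (\<kappa> * (2 * cb + 3))"
    proof -
      have "1 \<le> 1 / \<epsilon>\<^sup>2" using \<epsilon> \<epsilon>1 by (simp add: pos_le_divide_eq power_le_one)
      then have "2 * real nb + 1 \<le> (2 * cb + 3) / \<epsilon>\<^sup>2"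
        using nb(1) by (simp add: add_divide_distrib)
      moreover have "real K \<le> \<kappa> / \<epsilon>" using K\<epsilon> \<epsilon> by (simp add: pos_le_divide_eq)
      ultimately have "real K * (2 * real nb + 1) \<le> \<kappa> / \<epsilon> * ((2 * cb + 3) / \<epsilon>\<^sup>2)"
        using \<kappa>pos \<epsilon> by (intro mult_mono) auto
      then show ?thesis by (simp add: power2_eq_square power3_eq_cube mult_ac)
    qed
    finally have "(LINT w|M. real (total_calls b n (\<lambda>k. c k w) K))
        \<le> (1 + cn) / \<epsilon> ^ 3 * (1 + 6 * \<kappa> + 4 * ln (1 / \<epsilon>)) + 1 / \<epsilon> ^ 3 * (\<kappa> * (2 * cb + 3))" by simp
    also have "\<dots> = 1 / \<epsilon> ^ 3 * ((1 + cn) * (1 + 6 * \<kappa> + 4 * ln (1 / \<epsilon>)) + \<kappa> * (2 * cb + 3))"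
    proof -
      have "u / v * y + 1 / v * y' = 1 / v * (u * y + y')" for u v y y' :: real
        by (simp add: add_divide_distrib)
      then show ?thesis by (simp only:)
    qed
    also have "\<dots> \<le> 1 / \<epsilon> ^ 3 * (C * (1 + ln (1 / \<epsilon>)))"
    proof (rule mult_left_mono)
      have "0 \<le> (1 + cn) * (1 + 6 * \<kappa>) * ln (1 / \<epsilon>) + (1 + cn) * 4 + \<kappa> * (2 * cb + 3) * ln (1 / \<epsilon>)"
        using nn(2) nb(2) \<kappa>pos ln0 by (intro add_nonneg_nonneg mult_nonneg_nonneg) auto
      moreover have "C * (1 + l) = (1 + cn) * (1 + 6 * \<kappa> + 4 * l) + \<kappa> * (2 * cb + 3)
          + ((1 + cn) * (1 + 6 * \<kappa>) * l + (1 + cn) * 4 + \<kappa> * (2 * cb + 3) * l)" for l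
        by (simp add: C_def algebra_simps)
      ultimately show "(1 + cn) * (1 + 6 * \<kappa> + 4 * ln (1 / \<epsilon>)) + \<kappa> * (2 * cb + 3) \<le> C * (1 + ln (1 / \<epsilon>))"
        by simp
    qed (use \<epsilon> in simp)
    also have "\<dots> = C * (1 / \<epsilon> ^ 3 + 1 / \<epsilon> ^ 3 * ln (1 / \<epsilon>))" by (simp add: algebra_simps)
    finally show ?thesis
      using residual_bound(1)[of j] E expected_calls(1)[of K] unfolding E_def C_def[symmetric]
      by (intro exI[of _ K]) (simp add: K_def)
  qed
qed

end

theorem corollary22:
  fixes D :: "'x measure"
    and FF :: "real ^ 'p \<Rightarrow> 'x \<Rightarrow> real ^ 'p"
    and F :: "real ^ 'p \<Rightarrow> real ^ 'p"
    and T :: "real ^ 'p \<Rightarrow> (real ^ 'p) set"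
    and x0 xs :: "real ^ 'p"
    and \<sigma> \<rho> L Lh \<Lambda> lam \<mu> \<nu> \<beta> \<beta>b r \<Psi>0 cb cn :: real
    and t \<eta> :: "nat \<Rightarrow> real"
  assumes "prob_space D"
    and "(\<lambda>(x, \<xi>). FF x \<xi>) \<in> borel_measurable (borel \<Otimes>\<^sub>M D)"
    and "\<And>x. integrable D (FF x)"
    and "\<And>x. F x = (LINT \<xi>|D. FF x \<xi>)"
    and "\<sigma> \<ge> 0"
    and "\<And>x. integrable D (\<lambda>\<xi>. (norm (FF x \<xi> - F x))\<^sup>2)"
    and "\<And>x. (LINT \<xi>|D. (norm (FF x \<xi> - F x))\<^sup>2) \<le> \<sigma>\<^sup>2"
    and "\<rho> \<ge> 0" and "maximally_co_hypomonotone \<rho> T"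
    and "L > 0"
    and "\<And>x y. (F x - F y) \<bullet> (x - y) \<ge> (1 / L) * (LINT \<xi>|D. (norm (FF x \<xi> - FF y \<xi>))\<^sup>2)"
    and "xs \<in> op_zer (op_sum F T)"
    and "x0 \<in> op_dom (op_sum F T)"
    and "L * \<rho> < 1" and "Lh > L" and "Lh * \<rho> < 1"
    and "\<beta>b = (lam * (4 - Lh * lam) - 4 * \<rho>) / (4 * (1 - \<rho> * Lh))"
    and "\<Lambda> = (Lh - L) / (L * Lh)"
    and "lam > 0" and "2 * \<rho> \<le> lam" and "lam < 2 * (1 + sqrt (1 - Lh * \<rho>)) / Lh"
    and "0 < \<mu>" and "\<mu> < 2 / 3"
    and "\<nu> = \<mu> / 2"
    and "0 < \<beta>" and "\<beta> \<le> (2 - \<mu>) * \<beta>b / (2 + \<mu>)"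
    and "r > 5 + 1 / \<mu>"
    and "\<And>k. t k = \<mu> * (real k + r)"
    and "\<And>k. \<eta> k = 2 * \<beta> * (t k - 1) / (t k - \<nu>)"
    and "\<Psi>0 = sqrt (\<mu>\<^sup>2 * r\<^sup>2 * (norm (fb_residual lam F T x0))\<^sup>2
                   + (2 * r - 1) / (4 * \<beta>\<^sup>2 * (\<mu> * r - 1)) * (norm (x0 - xs))\<^sup>2)"
    and "cb = 10 * \<beta> / (\<mu> * \<Lambda>)"
    and "cn = 12 * \<sigma>\<^sup>2 * max 1 (2 * sqrt 2 * \<Psi>0 / \<mu>\<^sup>2)"
  shows "\<exists>C::real. \<forall>\<epsilon>. 0 < \<epsilon> \<and> \<epsilon> \<le> (\<mu> * (r - 5) - 1) / (2 * \<mu> * (r - 1) - 2) \<longrightarrow>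
    (let b = (\<lambda>k::nat. max 1 (nat \<lfloor>cb / \<epsilon>^2\<rfloor>));
         n = (\<lambda>k::nat. max 1 (nat \<lfloor>cn / \<epsilon>^3\<rfloor>));
         p = (\<lambda>k::nat. 2 * \<epsilon> + 4 * \<mu> / (\<mu> * (real k + r - 1) - 1))
     in \<forall>(M :: 'w measure) c s S x z.
          lsvrg_sampling M D p b n c s S \<and>
          (\<forall>w \<in> space M.
             vfosa_plus lam T t \<eta> \<nu> x0
               (lsvrg_estimator FF b n (\<lambda>k. c k w) (\<lambda>k i. s k i w) (\<lambda>k j. S k j w) (\<lambda>k. x k w))
               (\<lambda>k. x k w) (\<lambda>k. z k w))
          \<longrightarrow>
          (\<exists>K. integrable M (\<lambda>w. (norm (fb_residual lam F T (x K w)))\<^sup>2) \<and>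
               (LINT w|M. (norm (fb_residual lam F T (x K w)))\<^sup>2) \<le> \<epsilon>\<^sup>2 \<and>
               integrable M (\<lambda>w. real (total_calls b n (\<lambda>k. c k w) K)) \<and>
               (LINT w|M. real (total_calls b n (\<lambda>k. c k w) K))
                 \<le> C * (1 / \<epsilon>^3 + 1 / \<epsilon>^3 * ln (1 / \<epsilon>))))"
proof -
  interpret sample: stochastic_map D FF F \<sigma>
    by (rule stochastic_map.intro) fact+
  define Q where "Q = max \<Psi>0 (\<mu>\<^sup>2 / (2 * sqrt 2))"
  define \<kappa> where "\<kappa> = 12 / 5 * Q / \<mu>"
  have \<mu>: "0 < \<mu>" by fact
  have \<mu>r: "\<mu> * r > 1 + 5 * \<mu>"
  proof -
    have "\<mu> * (5 + 1 / \<mu>) < \<mu> * r" using \<open>r > 5 + 1 / \<mu>\<close> \<mu> by simp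
    then show ?thesis using \<mu> by (simp add: distrib_left)
  qed
  have r: "r > 5"
  proof -
    have "1 / \<mu> > 0" using \<mu> by simp
    then show ?thesis using assms(27) by linarith
  qed
  have \<Lambda>: "\<Lambda> > 0" using \<open>L > 0\<close> \<open>Lh > L\<close> by (simp add: assms(18))
  have Q: "Q > 0" using \<mu> by (simp add: Q_def less_max_iff_disj)
  have max_Q: "\<mu>\<^sup>2 * max 1 (2 * sqrt 2 * \<Psi>0 / \<mu>\<^sup>2) = 2 * sqrt 2 * Q"
  proof -
    have "\<mu>\<^sup>2 * max 1 (2 * sqrt 2 * \<Psi>0 / \<mu>\<^sup>2) = max (\<mu>\<^sup>2) (2 * sqrt 2 * \<Psi>0)"
      using \<mu> by (simp add: max_mult_distrib_left)
    also have "\<dots> = 2 * sqrt 2 * Q"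
      by (simp add: Q_def max_mult_distrib_left max.commute)
    finally show ?thesis .
  qed
  have cn: "cn \<ge> 0" and cb: "cb \<ge> 0"
    using \<mu> \<Lambda> \<open>0 < \<beta>\<close> by (simp_all add: assms(32) assms(31))
  have energy: "\<Psi>0\<^sup>2 = (t 0)\<^sup>2 * (norm (fb_residual lam F T x0))\<^sup>2
      + (t 0 - \<mu> / 2) / (2 * \<beta>\<^sup>2 * \<mu> * (t 0 - 1)) * (norm (x0 - xs))\<^sup>2"
  proof -
    have t0: "t 0 = \<mu> * r" using assms(28)[of 0] by simp
    have "(2 * r - 1) / (4 * \<beta>\<^sup>2 * (\<mu> * r - 1)) = (t 0 - \<mu> / 2) / (2 * \<beta>\<^sup>2 * \<mu> * (t 0 - 1))"
    proof -
      have "t 0 - \<mu> / 2 = \<mu> / 2 * (2 * r - 1)" by (simp add: t0 algebra_simps)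
      moreover have "\<mu> / 2 * q / (2 * \<beta>\<^sup>2 * \<mu> * d) = q / (4 * \<beta>\<^sup>2 * d)" for q d using \<mu> by simp
      ultimately show ?thesis by (simp only: t0)
    qed
    moreover have "0 \<le> (t 0 - \<mu> / 2) / (2 * \<beta>\<^sup>2 * \<mu> * (t 0 - 1)) * (norm (x0 - xs))\<^sup>2"
      using \<mu> \<mu>r r unfolding t0 by (intro mult_nonneg_nonneg divide_nonneg_nonneg) auto
    ultimately show ?thesis
      unfolding assms(30) by (subst real_sqrt_pow2) (simp_all add: t0 power_mult_distrib)
  qed
  have \<Psi>0: "\<Psi>0 \<ge> 0" unfolding assms(30)
    using \<mu> \<mu>r r by (intro real_sqrt_ge_zero add_nonneg_nonneg mult_nonneg_nonneg divide_nonneg_nonneg) auto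
  show ?thesis
  proof (rule exI[of _ "(1 + cn) * (5 + 6 * \<kappa>) + \<kappa> * (2 * cb + 3)"], unfold Let_def, intro allI impI, elim conjE)
    fix \<epsilon> :: real and M :: "'w measure" and c s S x z
    let ?b = "\<lambda>k::nat. max 1 (nat \<lfloor>cb / \<epsilon>^2\<rfloor>)"
    let ?n = "\<lambda>k::nat. max 1 (nat \<lfloor>cn / \<epsilon>^3\<rfloor>)"
    let ?p = "\<lambda>k::nat. 2 * \<epsilon> + 4 * \<mu> / (\<mu> * (real k + r - 1) - 1)"
    assume \<epsilon>: "0 < \<epsilon>" and le: "\<epsilon> \<le> (\<mu> * (r - 5) - 1) / (2 * \<mu> * (r - 1) - 2)"
      and sampling: "lsvrg_sampling M D ?p ?b ?n c s S"
      and run: "\<forall>w\<in>space M. vfosa_plus lam T t \<eta> \<nu> x0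
             (lsvrg_estimator FF ?b ?n (\<lambda>k. c k w) (\<lambda>k i. s k i w) (\<lambda>k j. S k j w) (\<lambda>k. x k w))
             (\<lambda>k. x k w) (\<lambda>k. z k w)"
    have \<epsilon>1: "\<epsilon> \<le> 1"
    proof -
      have "(\<mu> * (r - 5) - 1) / (2 * \<mu> * (r - 1) - 2) \<le> 1"
        using \<mu> \<mu>r by (simp add: algebra_simps pos_divide_le_eq)
      then show ?thesis using le by simp
    qed
    have b_size: "cb / \<epsilon>\<^sup>2 / 2 \<le> real (?b 0)" "real (?b 0) \<le> 1 + cb / \<epsilon>\<^sup>2"
      using batch_size_bounds[of "cb / \<epsilon>\<^sup>2"] cb by simp_all
    have n_size: "cn / \<epsilon> ^ 3 / 2 \<le> real (?n 0)" "real (?n 0) \<le> 1 + cn / \<epsilon> ^ 3"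
      using batch_size_bounds[of "cn / \<epsilon> ^ 3"] cn \<epsilon> by simp_all
    have batch: "real (?b 0) \<ge> 5 * \<beta> / (\<mu> * ((Lh - L) / (L * Lh))) / \<epsilon>\<^sup>2"
    proof -
      have "5 * \<beta> / (\<mu> * \<Lambda>) / \<epsilon>\<^sup>2 = cb / \<epsilon>\<^sup>2 / 2" by (simp add: assms(31))
      then show ?thesis using b_size(1) unfolding assms(18) by linarith
    qed
    have coercive: "(F u - F v) \<bullet> (u - v) \<ge> (1 / L) * sample.msd u v" for u v
      unfolding sample.msd_def by fact
    have refresh: "?p (Suc k) = 2 * \<epsilon> + 4 * \<mu> / (t k - 1)" for k
      using assms(28)[of k] by simp
    have step_size: "\<eta> k = 2 * \<beta> * (t k - 1) / (t k - \<mu> / 2)" for k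
      using assms(29)[of k] assms(24) by simp
    have run': "vfosa_plus lam T t \<eta> (\<mu> / 2) x0
             (lsvrg_estimator FF ?b ?n (\<lambda>k. c k w) (\<lambda>k i. s k i w) (\<lambda>k j. S k j w) (\<lambda>k. x k w))
             (\<lambda>k. x k w) (\<lambda>k. z k w)" if "w \<in> space M" for w
      using run that unfolding assms(24) by blast
    interpret vfosa_run D FF F \<sigma> M ?p ?b ?n c s S T x0 xs \<rho> L Lh lam \<mu> \<beta> \<beta>b r \<epsilon> "?b 0" "?n 0" x z t \<eta>
    proof (rule vfosa_run.intro)
      show "sampling M D ?p ?b ?n c s S" using sampling by (rule sampling.intro)
      show "vfosa_run_axioms D FF F M ?p ?b ?n c s S T x0 xs \<rho> L Lh lam \<mu> \<beta> \<beta>b r \<epsilon> (?b 0) (?n 0) x z t \<eta>"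
        by (rule vfosa_run_axioms.intro)
          (fact assms coercive refresh step_size run' batch \<epsilon> | rule refl | simp)+
    qed (rule sample.stochastic_map_axioms)
    have noise: "\<sigma>\<^sup>2 / real (?n 0) \<le> \<epsilon> ^ 3 * \<mu>\<^sup>2 / (12 * sqrt 2 * Q)"
    proof -
      let ?m = "max 1 (2 * sqrt 2 * \<Psi>0 / \<mu>\<^sup>2)"
      have "6 * \<sigma>\<^sup>2 * ?m \<le> real (?n 0) * \<epsilon> ^ 3"
        using n_size(1) \<epsilon> unfolding assms(32) by (simp add: pos_divide_le_eq)
      then have "\<mu>\<^sup>2 * (6 * \<sigma>\<^sup>2 * ?m) \<le> \<mu>\<^sup>2 * (real (?n 0) * \<epsilon> ^ 3)" by (intro mult_left_mono) auto
      moreover have "\<mu>\<^sup>2 * (6 * \<sigma>\<^sup>2 * ?m) = \<sigma>\<^sup>2 * (12 * sqrt 2 * Q)"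
        using max_Q by (simp add: mult_ac)
      ultimately have "\<sigma>\<^sup>2 * (12 * sqrt 2 * Q) \<le> \<epsilon> ^ 3 * \<mu>\<^sup>2 * real (?n 0)" by (simp only: mult_ac)
      moreover have "real (?n 0) > 0" "12 * sqrt 2 * Q > 0" using Q by simp_all
      ultimately show ?thesis by (simp only: pos_divide_le_eq pos_le_divide_eq times_divide_eq_left)
    qed
    have one_le: "1 \<le> 1 / \<epsilon> ^ k" for k using \<epsilon> \<epsilon>1 by (simp add: pos_le_divide_eq power_le_one)
    have sizes: "real (?n 0) \<le> (1 + cn) / \<epsilon> ^ 3" "real (?b 0) \<le> (1 + cb) / \<epsilon>\<^sup>2"
      using n_size(2) b_size(2) one_le[of 3] one_le[of 2] by (simp_all add: add_divide_distrib)
    have "energy0 = \<Psi>0\<^sup>2" unfolding energy0_def energy ..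
    from complexity[OF \<epsilon>1 \<Psi>0 this Q_def noise sizes(1) cn sizes(2) cb \<kappa>_def]
    show "\<exists>K. integrable M (\<lambda>w. (norm (fb_residual lam F T (x K w)))\<^sup>2) \<and>
               (LINT w|M. (norm (fb_residual lam F T (x K w)))\<^sup>2) \<le> \<epsilon>\<^sup>2 \<and>
               integrable M (\<lambda>w. real (total_calls ?b ?n (\<lambda>k. c k w) K)) \<and>
               (LINT w|M. real (total_calls ?b ?n (\<lambda>k. c k w) K))
                 \<le> ((1 + cn) * (5 + 6 * \<kappa>) + \<kappa> * (2 * cb + 3)) * (1 / \<epsilon>^3 + 1 / \<epsilon>^3 * ln (1 / \<epsilon>))" .
  qed
qed

end
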